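(* Let $K$ be a finitely generated field and let $M$ be a Galois extension of $K$ which is not separably closed. Then $M$ is not PAC over $K$.
   Context: A field is finitely generated if it is finitely generated over its prime field. For a field $M$ and a subring $R\subseteq M$, $M$ is said to be PAC over $R$ if for every absolutely irreducible variety $V$ defined over $M$ of dimension $r\ge 0$ and every dominating separable rational map $\phi\colon V\to\mathbb{A}^r_M$ there exists $\mathbf{a}\in V(M)$ with $\phi(\mathbf{a})\in R^r$. *)

theory Defs
  imports
    "HOL-Algebra.Algebraic_Closure_Type"
    "HOL-Algebra.Generated_Fields"
    "HOL-Library.Poly_Mapping"
    "HOL-Library.FuncSet"
begin

text \<open>
  Univariate polynomials of HOL-Algebra are coefficient lists, leading coefficient first:
  the entry \<open>p ! i\<close> belongs to exponent \<open>length p - 1 - i\<close>.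
\<close>

definition list_pderiv :: "('a, 'b) ring_scheme \<Rightarrow> 'a list \<Rightarrow> 'a list" where
  "list_pderiv L p =
     ring.normalize L (map (\<lambda>i. add_pow L (length p - 1 - i) (p ! i)) [0..<length p - 1])"

text \<open>
  A polynomial is separable if it generates the unit ideal together with its derivative, that is,
  if it has no multiple root in any extension field.
\<close>

definition separable_poly :: "('a, 'b) ring_scheme \<Rightarrow> 'a set \<Rightarrow> 'a list \<Rightarrow> bool" where
  "separable_poly L K p \<longleftrightarrow>
     p \<in> carrier (K[X]\<^bsub>L\<^esub>) \<and>
     (\<exists>a\<in>carrier (K[X]\<^bsub>L\<^esub>). \<exists>b\<in>carrier (K[X]\<^bsub>L\<^esub>).
        (a \<otimes>\<^bsub>K[X]\<^bsub>L\<^esub>\<^esub> p) \<oplus>\<^bsub>K[X]\<^bsub>L\<^esub>\<^esub> (b \<otimes>\<^bsub>K[X]\<^bsub>L\<^esub>\<^esub> list_pderiv L p) = \<one>\<^bsub>K[X]\<^bsub>L\<^esub>\<^esub>)"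

definition separable_over :: "('a, 'b) ring_scheme \<Rightarrow> 'a set \<Rightarrow> 'a \<Rightarrow> bool" where
  "separable_over L K x \<longleftrightarrow>
     x \<in> carrier L \<and> \<not> ring.transcendental L K x \<and> separable_poly L K (ring.Irr L K x)"

definition separable_extension :: "('a, 'b) ring_scheme \<Rightarrow> 'a set \<Rightarrow> bool" where
  "separable_extension L K \<longleftrightarrow> (\<forall>x\<in>carrier L. separable_over L K x)"

definition normal_extension :: "('a, 'b) ring_scheme \<Rightarrow> 'a set \<Rightarrow> bool" where
  "normal_extension L K \<longleftrightarrow>
     (\<forall>x\<in>carrier L. \<not> ring.transcendental L K x) \<and>
     (\<forall>p\<in>carrier (K[X]\<^bsub>L\<^esub>). pirreducible\<^bsub>L\<^esub> K p \<longrightarrow>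
        (\<exists>x\<in>carrier L. ring.eval L p x = \<zero>\<^bsub>L\<^esub>) \<longrightarrow> ring.splitted L p)"

definition galois_extension :: "('a, 'b) ring_scheme \<Rightarrow> 'a set \<Rightarrow> bool" where
  "galois_extension L K \<longleftrightarrow>
     field L \<and> subfield K L \<and> normal_extension L K \<and> separable_extension L K"

text \<open>
  \<open>generate_field L S\<close> is the least subfield of \<open>L\<close> containing \<open>S\<close>; it contains the prime
  field, so this is finite generation over the prime field.
\<close>

definition finitely_generated_field :: "('a, 'b) ring_scheme \<Rightarrow> 'a set \<Rightarrow> bool" where
  "finitely_generated_field L K \<longleftrightarrow>
     (\<exists>S. finite S \<and> S \<subseteq> carrier L \<and> K = generate_field L S)"

definition separable_closure :: "'a::field itself \<Rightarrow> 'a alg_closure set" where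
  "separable_closure _ = {x. separable_over ring_of_type_algebra (range (to_ac :: 'a \<Rightarrow> _)) x}"

definition separably_closed :: "'a::field itself \<Rightarrow> bool" where
  "separably_closed T \<longleftrightarrow> separable_closure T = range to_ac"

text \<open>
  A polynomial is a finitely supported map from monomials to coefficients, the variables being
  indexed by \<^typ>\<open>nat\<close>; the ring in \<open>n\<close> variables uses the variables \<open>0, \<dots>, n - 1\<close>.
\<close>

type_synonym 'a mpoly = "(nat \<Rightarrow>\<^sub>0 nat) \<Rightarrow>\<^sub>0 'a"

definition mpolys :: "nat \<Rightarrow> ('a::zero) mpoly set" where
  "mpolys n = {p. \<forall>m\<in>Poly_Mapping.keys p. Poly_Mapping.keys m \<subseteq> {..<n}}"

definition mpoly_ring :: "nat \<Rightarrow> ('a::comm_ring_1) mpoly ring" where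
  "mpoly_ring n = ring_of_type_algebra\<lparr>carrier := mpolys n\<rparr>"

definition mpoly_eval :: "('a::comm_ring_1) mpoly \<Rightarrow> (nat \<Rightarrow> 'a) \<Rightarrow> 'a" where
  "mpoly_eval p x =
     (\<Sum>m\<in>Poly_Mapping.keys p.
        Poly_Mapping.lookup p m * (\<Prod>i\<in>Poly_Mapping.keys m. x i ^ Poly_Mapping.lookup m i))"

definition lift_mpoly :: "('a::field) mpoly \<Rightarrow> 'a alg_closure mpoly" where
  "lift_mpoly p = Poly_Mapping.map to_ac p"

definition const_mpoly :: "'a::zero \<Rightarrow> 'a mpoly" where
  "const_mpoly c = Poly_Mapping.single 0 c"

text \<open>
  A point of affine \<open>n\<close>-space is a function on indices that is \<^term>\<open>undefined\<close> from \<open>n\<close> on,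
  so that points with the same \<open>n\<close> coordinates are equal.
\<close>

definition affine_space :: "nat \<Rightarrow> (nat \<Rightarrow> 'a) set" where
  "affine_space n = {..<n} \<rightarrow>\<^sub>E UNIV"

definition zero_locus :: "nat \<Rightarrow> ('a::comm_ring_1) mpoly set \<Rightarrow> (nat \<Rightarrow> 'a) set" where
  "zero_locus n S = {x\<in>affine_space n. \<forall>p\<in>S. mpoly_eval p x = 0}"

definition zariski_closed :: "nat \<Rightarrow> (nat \<Rightarrow> 'a::comm_ring_1) set \<Rightarrow> bool" where
  "zariski_closed n V \<longleftrightarrow> (\<exists>S\<subseteq>mpolys n. V = zero_locus n S)"

definition zariski_irreducible :: "nat \<Rightarrow> (nat \<Rightarrow> 'a::comm_ring_1) set \<Rightarrow> bool" where
  "zariski_irreducible n V \<longleftrightarrow>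
     V \<noteq> {} \<and>
     (\<forall>A B. zariski_closed n A \<longrightarrow> zariski_closed n B \<longrightarrow> V \<subseteq> A \<union> B \<longrightarrow> V \<subseteq> A \<or> V \<subseteq> B)"

definition zariski_dense :: "nat \<Rightarrow> (nat \<Rightarrow> 'a::comm_ring_1) set \<Rightarrow> bool" where
  "zariski_dense n Y \<longleftrightarrow> (\<forall>A. zariski_closed n A \<longrightarrow> Y \<subseteq> A \<longrightarrow> A = affine_space n)"

definition vanishing_ideal :: "nat \<Rightarrow> (nat \<Rightarrow> 'a::comm_ring_1) set \<Rightarrow> 'a mpoly set" where
  "vanishing_ideal n V = {p\<in>mpolys n. \<forall>x\<in>V. mpoly_eval p x = 0}"

text \<open>
  In the following, the base field \<open>M\<close> is the universe of the type \<^typ>\<open>'m::field\<close>, and varieties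
  are identified with their sets of points over \<^typ>\<open>'m alg_closure\<close>.
\<close>

definition base_ideal :: "nat \<Rightarrow> (nat \<Rightarrow> 'm::field alg_closure) set \<Rightarrow> 'm mpoly set" where
  "base_ideal n V = {p\<in>mpolys n. lift_mpoly p \<in> vanishing_ideal n V}"

definition defined_over_base :: "nat \<Rightarrow> (nat \<Rightarrow> 'm::field alg_closure) set \<Rightarrow> bool" where
  "defined_over_base n V \<longleftrightarrow>
     vanishing_ideal n V = Idl\<^bsub>mpoly_ring n\<^esub> (lift_mpoly ` base_ideal n V)"

definition abs_irreducible_variety :: "nat \<Rightarrow> (nat \<Rightarrow> 'm::field alg_closure) set \<Rightarrow> bool" where
  "abs_irreducible_variety n V \<longleftrightarrow>
     zariski_closed n V \<and> zariski_irreducible n V \<and> defined_over_base n V"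

definition rational_points ::
    "nat \<Rightarrow> (nat \<Rightarrow> 'm::field alg_closure) set \<Rightarrow> (nat \<Rightarrow> 'm alg_closure) set" where
  "rational_points n V = {a\<in>V. \<forall>i<n. a i \<in> range to_ac}"

text \<open>
  With \<open>P\<close> the prime ideal of \<open>V\<close> in \<open>M[X\<^sub>0, \<dots>, X\<^bsub>n-1\<^esub>]\<close>, the function field \<open>M(V)\<close> is
  realised as the residue field at \<open>P\<close>, i.e. as the quotient of the localisation at \<open>P\<close>
  (a subring of the field of rational functions) by its maximal ideal.  It is canonically the
  fraction field of the coordinate ring \<open>M[X\<^sub>0, \<dots>, X\<^bsub>n-1\<^esub>]/P\<close>.
\<close>

definition local_ring :: "nat \<Rightarrow> (nat \<Rightarrow> 'm::field alg_closure) set \<Rightarrow> 'm mpoly fract ring" where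
  "local_ring n V = ring_of_type_algebra
     \<lparr>carrier := {Fract p q |p q. p \<in> mpolys n \<and> q \<in> mpolys n - base_ideal n V}\<rparr>"

definition local_max_ideal :: "nat \<Rightarrow> (nat \<Rightarrow> 'm::field alg_closure) set \<Rightarrow> 'm mpoly fract set" where
  "local_max_ideal n V =
     {Fract p q |p q. p \<in> base_ideal n V \<and> q \<in> mpolys n - base_ideal n V}"

definition function_field :: "nat \<Rightarrow> (nat \<Rightarrow> 'm::field alg_closure) set \<Rightarrow> 'm mpoly fract set ring" where
  "function_field n V = local_ring n V Quot local_max_ideal n V"

definition rat_fun ::
    "nat \<Rightarrow> (nat \<Rightarrow> 'm::field alg_closure) set \<Rightarrow> 'm mpoly \<Rightarrow> 'm mpoly \<Rightarrow> 'm mpoly fract set" where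
  "rat_fun n V p q = local_max_ideal n V +>\<^bsub>local_ring n V\<^esub> Fract p q"

definition const_fun :: "nat \<Rightarrow> (nat \<Rightarrow> 'm::field alg_closure) set \<Rightarrow> 'm \<Rightarrow> 'm mpoly fract set" where
  "const_fun n V c = rat_fun n V (const_mpoly c) 1"

text \<open>
  \<open>rat_fun_value n V f a y\<close> says that the rational function \<open>f\<close> is defined at the point \<open>a\<close> of \<open>V\<close>
  and has value \<open>y\<close> there.
\<close>

definition rat_fun_value ::
    "nat \<Rightarrow> (nat \<Rightarrow> 'm::field alg_closure) set \<Rightarrow> 'm mpoly fract set \<Rightarrow>
     (nat \<Rightarrow> 'm alg_closure) \<Rightarrow> 'm alg_closure \<Rightarrow> bool" where
  "rat_fun_value n V f a y \<longleftrightarrow>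
     a \<in> V \<and>
     (\<exists>p\<in>mpolys n. \<exists>q\<in>mpolys n.
        f = rat_fun n V p q \<and> mpoly_eval (lift_mpoly q) a \<noteq> 0 \<and>
        y = mpoly_eval (lift_mpoly p) a / mpoly_eval (lift_mpoly q) a)"

definition mpoly_eval_fun ::
    "nat \<Rightarrow> (nat \<Rightarrow> 'm::field alg_closure) set \<Rightarrow> 'm mpoly \<Rightarrow> (nat \<Rightarrow> 'm mpoly fract set) \<Rightarrow>
     'm mpoly fract set" where
  "mpoly_eval_fun n V g t =
     (let F = function_field n V in
       finsum F
         (\<lambda>m. const_fun n V (Poly_Mapping.lookup g m) \<otimes>\<^bsub>F\<^esub>
               finprod F (\<lambda>i. t i [^]\<^bsub>F\<^esub> Poly_Mapping.lookup m i) (Poly_Mapping.keys m))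
         (Poly_Mapping.keys g))"

definition alg_independent ::
    "nat \<Rightarrow> (nat \<Rightarrow> 'm::field alg_closure) set \<Rightarrow> nat \<Rightarrow> (nat \<Rightarrow> 'm mpoly fract set) \<Rightarrow> bool" where
  "alg_independent n V r t \<longleftrightarrow>
     (\<forall>g\<in>mpolys r. mpoly_eval_fun n V g t = \<zero>\<^bsub>function_field n V\<^esub> \<longrightarrow> g = 0)"

definition generated_over_base ::
    "nat \<Rightarrow> (nat \<Rightarrow> 'm::field alg_closure) set \<Rightarrow> nat \<Rightarrow> (nat \<Rightarrow> 'm mpoly fract set) \<Rightarrow>
     'm mpoly fract set set" where
  "generated_over_base n V r t =
     generate_field (function_field n V) (range (const_fun n V) \<union> t ` {..<r})"

text \<open>The dimension of \<open>V\<close> is the transcendence degree of \<open>M(V)\<close> over \<open>M\<close>.\<close>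

definition has_dimension :: "nat \<Rightarrow> (nat \<Rightarrow> 'm::field alg_closure) set \<Rightarrow> nat \<Rightarrow> bool" where
  "has_dimension n V r \<longleftrightarrow>
     (\<exists>t\<in>{..<r} \<rightarrow> carrier (function_field n V).
        alg_independent n V r t \<and>
        (\<forall>f\<in>carrier (function_field n V).
           \<not> ring.transcendental (function_field n V) (generated_over_base n V r t) f))"

text \<open>A rational map from \<open>V\<close> to affine \<open>r\<close>-space over \<open>M\<close> is given by \<open>r\<close> elements of \<open>M(V)\<close>.\<close>

definition rational_map ::
    "nat \<Rightarrow> (nat \<Rightarrow> 'm::field alg_closure) set \<Rightarrow> nat \<Rightarrow> (nat \<Rightarrow> 'm mpoly fract set) \<Rightarrow> bool" where
  "rational_map n V r \<phi> \<longleftrightarrow> \<phi> \<in> {..<r} \<rightarrow> carrier (function_field n V)"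

definition map_value ::
    "nat \<Rightarrow> (nat \<Rightarrow> 'm::field alg_closure) set \<Rightarrow> nat \<Rightarrow> (nat \<Rightarrow> 'm mpoly fract set) \<Rightarrow>
     (nat \<Rightarrow> 'm alg_closure) \<Rightarrow> (nat \<Rightarrow> 'm alg_closure) \<Rightarrow> bool" where
  "map_value n V r \<phi> a y \<longleftrightarrow>
     a \<in> V \<and> y \<in> affine_space r \<and> (\<forall>i<r. rat_fun_value n V (\<phi> i) a (y i))"

definition dominating ::
    "nat \<Rightarrow> (nat \<Rightarrow> 'm::field alg_closure) set \<Rightarrow> nat \<Rightarrow> (nat \<Rightarrow> 'm mpoly fract set) \<Rightarrow> bool" where
  "dominating n V r \<phi> \<longleftrightarrow> zariski_dense r {y. \<exists>a. map_value n V r \<phi> a y}"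

text \<open>
  A dominating map to affine space of dimension \<open>dim V\<close> makes \<open>M(V)\<close> algebraic over \<open>M(\<phi>)\<close>,
  so separability can be required elementwise.
\<close>

definition separable_map ::
    "nat \<Rightarrow> (nat \<Rightarrow> 'm::field alg_closure) set \<Rightarrow> nat \<Rightarrow> (nat \<Rightarrow> 'm mpoly fract set) \<Rightarrow> bool" where
  "separable_map n V r \<phi> \<longleftrightarrow>
     separable_extension (function_field n V) (generated_over_base n V r \<phi>)"

definition PAC_over :: "'m::field set \<Rightarrow> bool" where
  "PAC_over R \<longleftrightarrow>
     (\<forall>n r (V :: (nat \<Rightarrow> 'm alg_closure) set) \<phi>.
        abs_irreducible_variety n V \<longrightarrow> has_dimension n V r \<longrightarrow>
        rational_map n V r \<phi> \<longrightarrow> dominating n V r \<phi> \<longrightarrow> separable_map n V r \<phi> \<longrightarrow>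
        (\<exists>a\<in>rational_points n V. \<exists>y. map_value n V r \<phi> a y \<and> (\<forall>i<r. y i \<in> to_ac ` R)))"

end

theory Submission
  imports Defs "Jordan_Normal_Form.Char_Poly"
begin

text \<open>
  Let first \<open>\<alpha> \<notin> K\<close>, with a conjugate \<open>\<alpha>' \<noteq> \<alpha>\<close>. The generic element of a proper separable extension
  \<open>M(\<theta>)\<close> of degree \<open>d\<close>, normalised so that it never specialises into \<open>M\<close>, has a characteristic
  polynomial \<open>\<tau>\<close> without root in \<open>M\<close>, whatever the values of its \<open>d\<close> parameters. Let \<open>\<tau>'\<close> be a
  generic monic polynomial of degree \<open>d\<close> with a root, in \<open>d\<close> further parameters, and write
  \<open>\<tau> = u + \<alpha> v\<close> and \<open>\<tau>' = u + \<alpha>' v\<close>. The coefficients of \<open>u\<close> and \<open>v\<close> form a dominating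
  separable map from affine \<open>2d\<close>-space to itself. If it took a value over \<open>K\<close> at a point over \<open>M\<close>, then
  \<open>u + \<alpha> v\<close> and \<open>u + \<alpha>' v\<close> would be conjugate over \<open>K\<close>, while only the second has a root in \<open>M\<close>.

  Let now \<open>K = M\<close>. If \<open>M\<close> is finite, the reciprocal of \<open>\<Prod>s\<in>M. (X - s)\<close> is nowhere defined on \<open>M\<close>.
  If \<open>M\<close> is infinite, it is finite over a subfield with a discrete valuation, which extends to \<open>M\<close>.
  For a uniformiser \<open>\<pi>\<close> and large \<open>m\<close> the values of \<open>x\<^sup>m\<close>, \<open>\<pi> y\<^sup>m\<close> and \<open>\<pi>\<^sup>2\<close> are pairwise distinct, so
  the absolutely irreducible curve \<open>x\<^sup>m + \<pi> y\<^sup>m + \<pi>\<^sup>2 = 0\<close> has no rational point.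
\<close>

section \<open>Subfields and separable elements\<close>

text \<open>The two cases need different obstructions: a conjugate \<alpha>' exists only outside K.
  Without the normalisation the generic element could specialise into M, all its higher coordinates
  being 0, and \<tau> would acquire a root; f has no zero in M but takes every value over the
  algebraic closure, so no value of the map is lost. Since \<alpha> and \<alpha>' differ, (u, v) and
  (\<tau>, \<tau>') determine each other linearly, so dominance and separability can be checked on
  \<tau> and \<tau>', where Lagrange interpolation recovers the coordinates of the generic element
  from its conjugates.

  Separability of a map concerns every element of the function field, whereas only generators can be
  treated by hand; derivations show that it passes to all that the generators generate. For the
  curve, values in M have denominators, relative to the value of \<pi>, bounded by the degree over
  the valued subfield. The exponents of \<pi> in the three terms differ by 1 or 2, so m has to
  exceed twice that bound; it must also be nonzero in M, which keeps the projection to a coordinate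
  line separable.\<close>

definition is_subfield :: "'a::field set \<Rightarrow> bool" where
  "is_subfield E \<longleftrightarrow> 1 \<in> E \<and> (\<forall>x\<in>E. \<forall>y\<in>E. x - y \<in> E \<and> x * y \<in> E) \<and> (\<forall>x\<in>E. inverse x \<in> E)"

definition polys_over :: "'a::comm_ring_1 set \<Rightarrow> 'a poly set" where
  "polys_over E = {p. \<forall>i. Polynomial.coeff p i \<in> E}"

text \<open>Any polynomial with a simple root at x serves as a witness, not only the minimal one: p
  is a multiple of the minimal polynomial, so a simple root of p at x is a simple root of the latter
  too.\<close>

definition sep_over :: "'a::field set \<Rightarrow> 'a \<Rightarrow> bool" where
  "sep_over E x \<longleftrightarrow> (\<exists>p\<in>polys_over E. poly p x = 0 \<and> poly (pderiv p) x \<noteq> 0)"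

text \<open>The root rule takes its coefficients from the set being generated, so towers of
  separable steps are built in and transitivity of separability becomes the single statement
  \<open>sep_over_sepgen\<close>.\<close>

inductive_set sepgen :: "'a::field set \<Rightarrow> 'a set" for E where
  sepgen_base: "x \<in> E \<Longrightarrow> x \<in> sepgen E"
| sepgen_diff: "x \<in> sepgen E \<Longrightarrow> y \<in> sepgen E \<Longrightarrow> x - y \<in> sepgen E"
| sepgen_mult: "x \<in> sepgen E \<Longrightarrow> y \<in> sepgen E \<Longrightarrow> x * y \<in> sepgen E"
| sepgen_inverse: "x \<in> sepgen E \<Longrightarrow> inverse x \<in> sepgen E"
| sepgen_root: "(\<And>i. Polynomial.coeff p i \<in> sepgen E) \<Longrightarrow> poly p x = 0 \<Longrightarrow>
    poly (pderiv p) x \<noteq> 0 \<Longrightarrow> x \<in> sepgen E"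

definition is_subring :: "'a::comm_ring_1 set \<Rightarrow> bool" where
  "is_subring R \<longleftrightarrow> 1 \<in> R \<and> (\<forall>x\<in>R. \<forall>y\<in>R. x - y \<in> R \<and> x * y \<in> R)"

context
  fixes R :: "'a::comm_ring_1 set"
  assumes R: "is_subring R"
begin

lemma subring_one: "1 \<in> R"
  and subring_diff: "x \<in> R \<Longrightarrow> y \<in> R \<Longrightarrow> x - y \<in> R"
  and subring_mult: "x \<in> R \<Longrightarrow> y \<in> R \<Longrightarrow> x * y \<in> R"
  using R by (auto simp: is_subring_def)

lemma subring_zero: "0 \<in> R"
  using subring_diff[OF subring_one subring_one] by simp

lemma subring_uminus: "x \<in> R \<Longrightarrow> - x \<in> R"
  using subring_diff[OF subring_zero] by simp

lemma subring_add: "x \<in> R \<Longrightarrow> y \<in> R \<Longrightarrow> x + y \<in> R"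
  using subring_diff[of x "- y"] subring_uminus by simp

lemma subring_sum: "(\<And>i. i \<in> A \<Longrightarrow> f i \<in> R) \<Longrightarrow> sum f A \<in> R"
  by (induction A rule: infinite_finite_induct) (auto intro: subring_zero subring_add)

lemma subring_prod: "(\<And>i. i \<in> A \<Longrightarrow> f i \<in> R) \<Longrightarrow> prod f A \<in> R"
  by (induction A rule: infinite_finite_induct) (auto intro: subring_one subring_mult)

lemma subring_power: "x \<in> R \<Longrightarrow> x ^ k \<in> R"
  by (induction k) (auto intro: subring_one subring_mult)

lemma subring_of_nat: "of_nat k \<in> R"
  by (induction k) (auto intro: subring_one subring_zero subring_add)

lemma is_subring_polys_over: "is_subring (polys_over R)"
  unfolding is_subring_def polys_over_def
  by (auto simp: coeff_mult Polynomial.coeff_1 intro!: subring_diff subring_sum subring_mult subring_one subring_zero)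

lemma polys_over_const: "c \<in> R \<Longrightarrow> [:c:] \<in> polys_over R"
  by (auto simp: polys_over_def coeff_pCons subring_zero split: nat.split)

lemma polys_over_monom: "c \<in> R \<Longrightarrow> Polynomial.monom c n \<in> polys_over R"
  by (auto simp: polys_over_def subring_zero)

lemma polys_over_pCons: "c \<in> R \<Longrightarrow> p \<in> polys_over R \<Longrightarrow> pCons c p \<in> polys_over R"
  by (auto simp: polys_over_def coeff_pCons split: nat.split)

lemma polys_over_X: "[:0, 1:] \<in> polys_over R"
  by (auto simp: polys_over_def coeff_pCons subring_zero subring_one split: nat.split)

lemma polys_over_smult: "c \<in> R \<Longrightarrow> p \<in> polys_over R \<Longrightarrow> smult c p \<in> polys_over R"
  by (auto simp: polys_over_def subring_mult)

lemma poly_in_subring: "p \<in> polys_over R \<Longrightarrow> x \<in> R \<Longrightarrow> poly p x \<in> R"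
  unfolding poly_altdef polys_over_def by (auto intro!: subring_sum subring_mult subring_power)

end

lemma polys_over_pderiv:
  fixes R :: "'a::idom set"
  shows "is_subring R \<Longrightarrow> p \<in> polys_over R \<Longrightarrow> pderiv p \<in> polys_over R"
  by (auto simp: polys_over_def coeff_pderiv simp del: of_nat_Suc intro: subring_mult subring_of_nat)

lemma is_subfield_imp_subring: "is_subfield E \<Longrightarrow> is_subring E"
  by (auto simp: is_subfield_def is_subring_def)

lemma subfield_inverse: "is_subfield E \<Longrightarrow> x \<in> E \<Longrightarrow> inverse x \<in> E"
  by (auto simp: is_subfield_def)

lemma subfield_divide: "is_subfield E \<Longrightarrow> x \<in> E \<Longrightarrow> y \<in> E \<Longrightarrow> x / y \<in> E"
  by (auto simp: is_subfield_def field_class.field_divide_inverse)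

lemma is_subfield_sepgen: "is_subfield E \<Longrightarrow> is_subfield (sepgen E)"
  by (auto simp: is_subfield_def intro: sepgen.intros)

lemma polys_over_division:
  fixes E :: "'a::field set"
  assumes E: "is_subfield E" and p: "p \<in> polys_over E" and q: "q \<in> polys_over E" "q \<noteq> 0"
  shows "\<exists>s\<in>polys_over E. \<exists>r\<in>polys_over E. p = s * q + r \<and> (r = 0 \<or> Polynomial.degree r < Polynomial.degree q)"
  using p
\<comment> \<open>The zero polynomial has to rank strictly below the nonzero constants, which also
  have degree 0, so that cancelling a constant counts as progress.\<close>
proof (induction "if p = 0 then 0 else Suc (Polynomial.degree p)" arbitrary: p rule: less_induct)
  case less
  note sr = is_subfield_imp_subring[OF E]
  note psr = is_subring_polys_over[OF sr]
  show ?case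
  proof (cases "p = 0 \<or> Polynomial.degree p < Polynomial.degree q")
    case True
    then show ?thesis using less.prems subring_zero[OF psr] by force
  next
    case False
    define t where "t = Polynomial.monom (lead_coeff p / lead_coeff q) (Polynomial.degree p - Polynomial.degree q)"
    have tE: "t \<in> polys_over E"
      unfolding t_def using less.prems q
      by (intro polys_over_monom[OF sr] subfield_divide[OF E]) (auto simp: polys_over_def)
    define p' where "p' = p - t * q"
    have p'E: "p' \<in> polys_over E"
      unfolding p'_def using less.prems tE q psr by (intro subring_diff subring_mult) auto
    have lc: "lead_coeff p / lead_coeff q \<noteq> 0" using False q by auto
    have dt: "Polynomial.degree t = Polynomial.degree p - Polynomial.degree q"
      unfolding t_def by (rule Polynomial.degree_monom_eq[OF lc])
    have t0: "t \<noteq> 0" unfolding t_def using lc by (simp only: monom_eq_0_iff not_False_eq_True)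
    have degt: "Polynomial.degree (t * q) = Polynomial.degree p"
      using False q by (simp add: degree_mult_eq t0 dt)
    have lct: "lead_coeff (t * q) = lead_coeff p"
    proof -
      have "lead_coeff t = lead_coeff p / lead_coeff q" using dt by (simp add: t_def)
      then show ?thesis using q by (simp add: lead_coeff_mult del: degree_mult_eq)
    qed
    have "p' = 0 \<or> Polynomial.degree p' < Polynomial.degree p"
    proof (cases "Polynomial.degree p = 0")
      case True
      have "Polynomial.degree p' = 0" unfolding p'_def using degt True
        by (metis degree_diff_le le_zero_eq order_refl)
      moreover have "Polynomial.coeff p' 0 = 0" using lct True degt by (simp add: p'_def)
      ultimately show ?thesis by (metis leading_coeff_0_iff)
    next
      case False
      have "Polynomial.degree p' \<le> Polynomial.degree p"
        unfolding p'_def using degt by (metis degree_diff_le order_refl)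
      moreover have "Polynomial.coeff p' (Polynomial.degree p) = 0"
        using lct degt by (simp add: p'_def)
      ultimately show ?thesis
        by (metis leading_coeff_0_iff le_neq_implies_less)
    qed
    then have "(if p' = 0 then 0 else Suc (Polynomial.degree p')) < (if p = 0 then 0 else Suc (Polynomial.degree p))"
      using False by auto
    from less.hyps[OF this p'E] obtain s r where sr': "s \<in> polys_over E" "r \<in> polys_over E"
      "p' = s * q + r" "r = 0 \<or> Polynomial.degree r < Polynomial.degree q" by blast
    have "p = (s + t) * q + r" using sr'(3) by (simp add: p'_def algebra_simps)
    then show ?thesis using sr' tE subring_add[OF psr] by blast
  qed
qed

text \<open>
  A derivation is represented by its graph, which is a subring of the ring of dual numbers; the
  last conjunct says that the graph is single-valued.
\<close>

definition dual_subring :: "('a::field \<times> 'a) set \<Rightarrow> bool" where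
  "dual_subring G \<longleftrightarrow> (1, 0) \<in> G \<and>
     (\<forall>a a' b b'. (a, a') \<in> G \<longrightarrow> (b, b') \<in> G \<longrightarrow> (a - b, a' - b') \<in> G \<and> (a * b, a' * b + a * b') \<in> G) \<and>
     (\<forall>b. (0, b) \<in> G \<longrightarrow> b = 0)"

definition deriv_graph :: "('a::field \<times> 'a) set \<Rightarrow> bool" where
  "deriv_graph G \<longleftrightarrow> dual_subring G \<and> (\<forall>a\<in>Domain G. inverse a \<in> Domain G)"

context
  fixes G :: "('a::field \<times> 'a) set"
  assumes G: "dual_subring G"
begin

lemma dual_one: "(1, 0) \<in> G"
  and dual_diff: "(a, a') \<in> G \<Longrightarrow> (b, b') \<in> G \<Longrightarrow> (a - b, a' - b') \<in> G"
  and dual_mult: "(a, a') \<in> G \<Longrightarrow> (b, b') \<in> G \<Longrightarrow> (a * b, a' * b + a * b') \<in> G"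
  and dual_zeroD: "(0, b) \<in> G \<Longrightarrow> b = 0"
  using G by (auto simp: dual_subring_def)

lemma dual_single_valued: "(a, b) \<in> G \<Longrightarrow> (a, c) \<in> G \<Longrightarrow> b = c"
  using dual_diff[of a b a c] dual_zeroD[of "b - c"] by simp

lemma dual_zero: "(0, 0) \<in> G"
  using dual_diff[OF dual_one dual_one] by simp

lemma dual_add: "(a, a') \<in> G \<Longrightarrow> (b, b') \<in> G \<Longrightarrow> (a + b, a' + b') \<in> G"
  using dual_diff[of a a' "- b" "- b'"] dual_diff[OF dual_zero, of b b'] by simp

lemma dual_sum: "(\<And>i. i \<in> A \<Longrightarrow> (f i, f' i) \<in> G) \<Longrightarrow> (sum f A, sum f' A) \<in> G"
  by (induction A rule: infinite_finite_induct) (auto intro: dual_zero dual_add)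

lemma is_subring_Domain: "is_subring (Domain G)"
  unfolding is_subring_def
proof (intro conjI ballI)
  show "1 \<in> Domain G" using dual_one by blast
next
  fix x y assume "x \<in> Domain G" "y \<in> Domain G"
  then obtain x' y' where "(x, x') \<in> G" "(y, y') \<in> G" by blast
  from dual_diff[OF this] dual_mult[OF this] show "x - y \<in> Domain G" "x * y \<in> Domain G" by blast+
qed

text \<open>The quotient rule extends a derivation from a ring to its fraction field. Independence
  of the chosen fraction reduces to the value at 0, where a = 0 forces a' = 0.\<close>

lemma deriv_graph_quotients:
  defines "Q \<equiv> {(a / c, (a' * c - a * c') / c\<^sup>2) |a a' c c'. (a, a') \<in> G \<and> (c, c') \<in> G \<and> c \<noteq> 0}"
  shows "deriv_graph Q" "G \<subseteq> Q"
proof -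
  show sub: "G \<subseteq> Q"
    unfolding Q_def using dual_one by force
  have QI: "(x, x') \<in> Q" if "(a, a') \<in> G" "(c, c') \<in> G" "c \<noteq> 0" "x = a / c" "x' = (a' * c - a * c') / c\<^sup>2"
    for x x' a a' c c' using that unfolding Q_def by blast
  have "dual_subring Q"
    unfolding dual_subring_def
  proof (intro conjI allI impI)
    show "(1, 0) \<in> Q" using sub dual_one by auto
  next
    fix x x' y y' assume "(x, x') \<in> Q" "(y, y') \<in> Q"
    then obtain a a' c c' b b' d d' where
      1: "(a, a') \<in> G" "(c, c') \<in> G" "c \<noteq> 0" "x = a / c" "x' = (a' * c - a * c') / c\<^sup>2" and
      2: "(b, b') \<in> G" "(d, d') \<in> G" "d \<noteq> 0" "y = b / d" "y' = (b' * d - b * d') / d\<^sup>2"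
      unfolding Q_def by blast
    show "(x - y, x' - y') \<in> Q"
      by (rule QI[OF dual_diff[OF dual_mult[OF 1(1) 2(2)] dual_mult[OF 2(1) 1(2)]] dual_mult[OF 1(2) 2(2)]])
        (use 1(3) 2(3) in \<open>simp_all add: 1(4,5) 2(4,5) divide_simps, simp_all add: algebra_simps power2_eq_square\<close>)
    show "(x * y, x' * y + x * y') \<in> Q"
      by (rule QI[OF dual_mult[OF 1(1) 2(1)] dual_mult[OF 1(2) 2(2)]])
        (use 1(3) 2(3) in \<open>simp_all add: 1(4,5) 2(4,5) divide_simps, simp_all add: algebra_simps power2_eq_square\<close>)
  next
    fix b assume "(0, b) \<in> Q"
    then obtain a a' c c' where 1: "(a, a') \<in> G" "(c, c') \<in> G" "c \<noteq> 0" "0 = a / c" "b = (a' * c - a * c') / c\<^sup>2"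
      unfolding Q_def by blast
    then have "a = 0" by simp
    then show "b = 0" using 1 dual_zeroD by auto
  qed
  moreover have "inverse x \<in> Domain Q" if xQ: "x \<in> Domain Q" for x
  proof (cases "x = 0")
    case True then show ?thesis using sub dual_zero by auto
  next
    case False
    obtain a a' c c' where 1: "(a, a') \<in> G" "(c, c') \<in> G" "c \<noteq> 0" "x = a / c"
      using xQ unfolding Q_def by blast
    have "(inverse x, (c' * a - c * a') / a\<^sup>2) \<in> Q"
      by (rule QI[OF 1(2) 1(1)]) (use 1 False in auto)
    then show ?thesis by blast
  qed
  ultimately show "deriv_graph Q" by (auto simp: deriv_graph_def)
qed

end

lemma deriv_graph_imp_subfield: "deriv_graph G \<Longrightarrow> is_subfield (Domain G)"
  using is_subring_Domain[of G] unfolding deriv_graph_def is_subfield_def is_subring_def by auto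

text \<open>
  Negating separability of \<open>z\<close> says precisely that \<open>u(z) \<mapsto> u'(z)\<close> is a well-defined derivation.
\<close>

lemma deriv_graph_inseparable:
  fixes E :: "'a::field set"
  assumes E: "is_subfield E" and z: "\<not> sep_over E z"
  shows "\<exists>G. deriv_graph G \<and> (\<forall>e\<in>E. (e, 0) \<in> G) \<and> (z, 1) \<in> G"
proof -
  note sr = is_subfield_imp_subring[OF E]
  note psr = is_subring_polys_over[OF sr]
  define D where "D = {(poly u z, poly (pderiv u) z) |u. u \<in> polys_over E}"
  have D: "dual_subring D"
    unfolding dual_subring_def
  proof (intro conjI allI impI)
    have "(poly 1 z, poly (pderiv 1) z) \<in> D" unfolding D_def using subring_one[OF psr] by blast
    then show "(1, 0) \<in> D" by simp
  next
    fix x x' y y' assume "(x, x') \<in> D" "(y, y') \<in> D"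
    then obtain u v where uv: "u \<in> polys_over E" "v \<in> polys_over E" "x = poly u z" "x' = poly (pderiv u) z"
      "y = poly v z" "y' = poly (pderiv v) z" unfolding D_def by blast
    have "(poly (u - v) z, poly (pderiv (u - v)) z) \<in> D" "(poly (u * v) z, poly (pderiv (u * v)) z) \<in> D"
      unfolding D_def using subring_diff[OF psr uv(1,2)] subring_mult[OF psr uv(1,2)] by blast+
    then show "(x - y, x' - y') \<in> D" "(x * y, x' * y + x * y') \<in> D"
      by (simp_all add: uv pderiv_diff pderiv_mult algebra_simps)
  next
    fix b assume "(0, b) \<in> D"
    then obtain u where "u \<in> polys_over E" "poly u z = 0" "b = poly (pderiv u) z"
      unfolding D_def by auto
    then show "b = 0" using z unfolding sep_over_def by blast
  qed
  have 1: "(e, 0) \<in> D" if "e \<in> E" for e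
  proof -
    have "[:e:] \<in> polys_over E" using polys_over_const[OF sr that] .
    then have "(poly [:e:] z, poly (pderiv [:e:]) z) \<in> D" unfolding D_def by blast
    then show ?thesis by (simp add: pderiv_pCons)
  qed
  have "[:0, 1:] \<in> polys_over E" using polys_over_X[OF sr] .
  then have "(poly [:0, 1:] z, poly (pderiv [:0, 1:]) z) \<in> D" unfolding D_def by blast
  then have 2: "(z, 1) \<in> D" by (simp add: pderiv_pCons)
  show ?thesis
    by (rule exI, intro conjI ballI, rule deriv_graph_quotients(1)[OF D])
      (rule subsetD[OF deriv_graph_quotients(2)[OF D]], erule 1, rule subsetD[OF deriv_graph_quotients(2)[OF D]], rule 2)
qed

text \<open>Differentiating p(x) = 0 leaves exactly one candidate for the derivative of x. Its
  consistency depends only on the minimal relation m of x, as all other relations are multiples of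
  m; that x is a simple root of p transfers the consistency from p to m.\<close>

lemma deriv_graph_adjoin:
  fixes G :: "('a::field \<times> 'a) set"
  assumes G: "deriv_graph G" and p: "p \<in> polys_over (Domain G)" "poly p x = 0" "poly (pderiv p) x \<noteq> 0"
  shows "\<exists>G'. deriv_graph G' \<and> G \<subseteq> G' \<and> x \<in> Domain G'"
proof -
  have dG: "dual_subring G" using G by (simp add: deriv_graph_def)
  note E = deriv_graph_imp_subfield[OF G]
  note sr = is_subfield_imp_subring[OF E]
  note psr = is_subring_polys_over[OF sr]
  \<comment> \<open>Here \<open>u'\<close> is u with its coefficients differentiated;
    \<open>val u u'\<close> below is the total derivative of u at x.\<close>
  define lifts where "lifts u u' \<longleftrightarrow> (\<forall>i. (Polynomial.coeff u i, Polynomial.coeff u' i) \<in> G)" for u u' :: "'a poly"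
  have lift_ex: "\<exists>u'. lifts u u'" if "u \<in> polys_over (Domain G)" for u
  proof -
    define d where "d a = (SOME a'. (a, a') \<in> G)" for a
    have d: "(a, d a) \<in> G" if "a \<in> Domain G" for a
      using that unfolding d_def by (auto intro: someI)
    have d0: "d 0 = 0" using d[of 0] dual_zero[OF dG] dual_zeroD[OF dG] by blast
    have "lifts u (map_poly d u)"
      unfolding lifts_def using that d by (auto simp: coeff_map_poly d0 polys_over_def)
    then show ?thesis ..
  qed
  have lift_unique: "u' = u''" if "lifts u u'" "lifts u u''" for u u' u''
    using that unfolding lifts_def by (intro poly_eqI) (blast intro: dual_single_valued[OF dG])
  have lift_diff: "lifts (u - v) (u' - v')" if "lifts u u'" "lifts v v'" for u u' v v'
    using that dual_diff[OF dG] unfolding lifts_def by auto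
  have lift_mult: "lifts (u * v) (u' * v + u * v')" if "lifts u u'" "lifts v v'" for u u' v v'
    using that unfolding lifts_def
    by (auto simp: coeff_mult simp flip: sum.distrib intro!: dual_sum[OF dG] dual_mult[OF dG])
  have lift_polys: "u \<in> polys_over (Domain G)" if "lifts u u'" for u u'
    using that by (auto simp: lifts_def polys_over_def)
  obtain p' where p': "lifts p p'" using lift_ex p(1) by blast
  define \<delta> where "\<delta> = - poly p' x / poly (pderiv p) x"
  define val where "val u u' = poly u' x + poly (pderiv u) x * \<delta>" for u u' :: "'a poly"
  have val_p: "val p p' = 0" using p(3) by (simp add: val_def \<delta>_def)
  have val_diff: "val (u - v) (u' - v') = val u u' - val v v'" for u u' v v'
    by (simp add: val_def pderiv_diff algebra_simps)
  have val_mult: "val (u * v) (u' * v + u * v') = val u u' * poly v x + poly u x * val v v'" for u u' v v'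
    by (simp add: val_def pderiv_mult algebra_simps)
  have "\<exists>m. m \<in> polys_over (Domain G) \<and> m \<noteq> 0 \<and> poly m x = 0" using p by (intro exI[of _ p]) auto
  then obtain m where m: "m \<in> polys_over (Domain G)" "m \<noteq> 0" "poly m x = 0"
    and mmin: "\<And>q. q \<in> polys_over (Domain G) \<Longrightarrow> q \<noteq> 0 \<Longrightarrow> poly q x = 0 \<Longrightarrow> Polynomial.degree m \<le> Polynomial.degree q"
    using ex_has_least_nat[of "\<lambda>m. m \<in> polys_over (Domain G) \<and> m \<noteq> 0 \<and> poly m x = 0" _ Polynomial.degree] by metis
  have m_dvd: "\<exists>k\<in>polys_over (Domain G). u = k * m" if u: "u \<in> polys_over (Domain G)" "poly u x = 0" for u
  proof -
    obtain s r where sr': "s \<in> polys_over (Domain G)" "r \<in> polys_over (Domain G)"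
      "u = s * m + r" "r = 0 \<or> Polynomial.degree r < Polynomial.degree m"
      using polys_over_division[OF E u(1) m(1,2)] by blast
    have "poly r x = 0" using sr'(3) u(2) m(3) by simp
    then have "r = 0" using mmin[OF sr'(2)] sr'(4) by force
    then show ?thesis using sr' by auto
  qed
  obtain m' where m': "lifts m m'" using lift_ex m(1) by blast
  obtain h where h: "h \<in> polys_over (Domain G)" "p = h * m" using m_dvd[OF p(1,2)] by blast
  obtain h' where h': "lifts h h'" using lift_ex h(1) by blast
  \<comment> \<open>From p = h * m and m(x) = 0, the total derivative of p is h(x) times that of m,
    and h(x) is nonzero because the root x of p is simple.\<close>
  have "p' = h' * m + h * m'" using lift_unique[OF p'] lift_mult[OF h' m'] h(2) by simp
  then have "0 = poly h x * val m m'" using val_p h(2) val_mult[of h m h' m'] m(3) by simp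
  moreover have "poly h x \<noteq> 0" using p(3) m(3) by (auto simp: h(2) pderiv_mult)
  ultimately have val_m: "val m m' = 0" by simp
  define D where "D = {(poly u x, val u u') |u u'. lifts u u'}"
  have D: "dual_subring D"
    unfolding dual_subring_def
  proof (intro conjI allI impI)
    have "lifts 1 0" using dual_one[OF dG] dual_zero[OF dG] by (auto simp: lifts_def Polynomial.coeff_1)
    then have "(poly 1 x, val 1 0) \<in> D" unfolding D_def by blast
    then show "(1, 0) \<in> D" by (simp add: val_def)
  next
    fix y y' w w' assume "(y, y') \<in> D" "(w, w') \<in> D"
    then obtain u u' v v' where uv: "lifts u u'" "lifts v v'" "y = poly u x" "y' = val u u'"
      "w = poly v x" "w' = val v v'" unfolding D_def by blast
    have "(poly (u - v) x, val (u - v) (u' - v')) \<in> D" "(poly (u * v) x, val (u * v) (u' * v + u * v')) \<in> D"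
      unfolding D_def using lift_diff[OF uv(1,2)] lift_mult[OF uv(1,2)] by blast+
    then show "(y - w, y' - w') \<in> D" "(y * w, y' * w + y * w') \<in> D"
      by (simp_all add: uv val_diff val_mult)
  next
    fix b assume "(0, b) \<in> D"
    then obtain u u' where u: "lifts u u'" "poly u x = 0" "b = val u u'" unfolding D_def by auto
    obtain k where k: "k \<in> polys_over (Domain G)" "u = k * m" using m_dvd[OF lift_polys[OF u(1)] u(2)] by blast
    obtain k' where k': "lifts k k'" using lift_ex k(1) by blast
    have "u' = k' * m + k * m'" using lift_unique[OF u(1)] lift_mult[OF k' m'] k(2) by simp
    then show "b = 0" using u(3) k(2) val_mult[of k m k' m'] m(3) val_m by simp
  qed
  have "(a, a') \<in> D" if a: "(a, a') \<in> G" for a a'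
  proof -
    have "lifts [:a:] [:a':]" using a dual_zero[OF dG] by (auto simp: lifts_def coeff_pCons split: nat.split)
    then have "(poly [:a:] x, val [:a:] [:a':]) \<in> D" unfolding D_def by blast
    then show ?thesis by (simp add: val_def pderiv_pCons)
  qed
  moreover have "x \<in> Domain D"
  proof -
    have "lifts [:0, 1:] 0" using dual_one[OF dG] dual_zero[OF dG] by (auto simp: lifts_def coeff_pCons split: nat.split)
    then have "(poly [:0, 1:] x, val [:0, 1:] 0) \<in> D" unfolding D_def by blast
    then show ?thesis by auto
  qed
  ultimately have sub: "G \<subseteq> D" "x \<in> Domain D" by auto
  show ?thesis
    by (rule exI, intro conjI, rule deriv_graph_quotients(1)[OF D])
      (rule subset_trans[OF sub(1) deriv_graph_quotients(2)[OF D]], rule subsetD[OF Domain_mono[OF deriv_graph_quotients(2)[OF D]] sub(2)])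
qed

text \<open>
  A maximal derivation extending \<open>u(z) \<mapsto> u'(z)\<close> would be defined on the whole of \<open>sepgen E\<close>
  and vanish there, but it maps \<open>z\<close> to 1.
\<close>

theorem sep_over_sepgen:
  fixes E :: "'a::field set"
  assumes E: "is_subfield E" and zg: "z \<in> sepgen E"
  shows "sep_over E z"
proof (rule ccontr)
  assume "\<not> sep_over E z"
  from deriv_graph_inseparable[OF E this] obtain G0 where
    G0: "deriv_graph G0" "\<forall>e\<in>E. (e, 0) \<in> G0" "(z, 1) \<in> G0" by blast
  define A where "A = {G. deriv_graph G \<and> G0 \<subseteq> G}"
  have "\<exists>M\<in>A. \<forall>Y\<in>A. M \<subseteq> Y \<longrightarrow> Y = M"
  proof (rule subset_Zorn_nonempty)
    show "A \<noteq> {}" using G0 by (auto simp: A_def)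
  next
    fix C assume C: "C \<noteq> {}" "subset.chain A C"
    have dual: "dual_subring G" if "G \<in> C" for G
      using that C(2) by (auto simp: subset.chain_def A_def deriv_graph_def)
    have common: "\<exists>G\<in>C. x \<in> G \<and> y \<in> G" if "x \<in> \<Union>C" "y \<in> \<Union>C" for x y
      using that C(2) unfolding subset.chain_def by blast
    have "dual_subring (\<Union>C)"
      unfolding dual_subring_def
    proof (intro conjI allI impI)
      show "(1, 0) \<in> \<Union>C" using C(1) dual dual_one by blast
    next
      fix a a' b b' assume "(a, a') \<in> \<Union>C" "(b, b') \<in> \<Union>C"
      then obtain G where G: "G \<in> C" "(a, a') \<in> G" "(b, b') \<in> G" using common by blast
      from dual_diff[OF dual[OF G(1)] G(2,3)] dual_mult[OF dual[OF G(1)] G(2,3)] G(1)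
      show "(a - b, a' - b') \<in> \<Union>C" "(a * b, a' * b + a * b') \<in> \<Union>C" by blast+
    next
      fix b assume "(0, b) \<in> \<Union>C"
      then show "b = 0" using dual dual_zeroD by blast
    qed
    moreover have "inverse a \<in> Domain (\<Union>C)" if "a \<in> Domain (\<Union>C)" for a
    proof -
      have "\<exists>G\<in>C. a \<in> Domain G" using that by auto
      then obtain G where G: "G \<in> C" "a \<in> Domain G" by metis
      then have "deriv_graph G" using C(2) by (auto simp: subset.chain_def A_def)
      then have "inverse a \<in> Domain G" using G(2) by (auto simp: deriv_graph_def)
      then show ?thesis using G(1) by blast
    qed
    moreover have "G0 \<subseteq> \<Union>C" using C unfolding A_def subset.chain_def by blast
    ultimately show "\<Union>C \<in> A" by (simp add: A_def deriv_graph_def)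
  qed
  then obtain G where GA: "G \<in> A" and Gm: "\<forall>Y\<in>A. G \<subseteq> Y \<longrightarrow> Y = G" by (rule bexE)
  have G: "deriv_graph G" "G0 \<subseteq> G" using GA by (simp_all add: A_def)
  have Gmax: "Y = G" if "deriv_graph Y" "G \<subseteq> Y" for Y
    using Gm that G(2) by (simp add: A_def)
  have dG: "dual_subring G" using G by (simp add: deriv_graph_def)
  have inv: "(inverse a, 0) \<in> G" if "(a, 0) \<in> G" for a
  proof (cases "a = 0")
    case False
    have "a \<in> Domain G" using that by (rule DomainI)
    then have "inverse a \<in> Domain G" using G(1) by (simp add: deriv_graph_def)
    then obtain b where b: "(inverse a, b) \<in> G" by (rule DomainE)
    have "(1, b * a) \<in> G" using dual_mult[OF dG b that] False by simp
    then have "b * a = 0" by (rule dual_single_valued[OF dG]) (rule dual_one[OF dG])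
    then show ?thesis using b False by simp
  qed (use dual_zero[OF dG] in simp)
  have "(y, 0) \<in> G" if "y \<in> sepgen E" for y
    using that
  proof induction
    case (sepgen_root p x)
    have "p \<in> polys_over (Domain G)"
      unfolding polys_over_def mem_Collect_eq by (intro allI DomainI[OF sepgen_root.IH])
    from deriv_graph_adjoin[OF G(1) this sepgen_root.hyps(2,3)] obtain G' where
      G': "deriv_graph G'" "G \<subseteq> G'" "x \<in> Domain G'" by (elim exE conjE)
    then have "x \<in> Domain G" using Gmax[of G'] by simp
    then obtain x' where x': "(x, x') \<in> G" by (rule DomainE)
    have pow: "(x ^ k, of_nat k * x ^ (k - 1) * x') \<in> G" for k
    proof (induction k)
      case (Suc k)
      have "x' * x ^ k + x * (of_nat k * x ^ (k - 1) * x') = of_nat (Suc k) * x ^ k * x'"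
        by (cases k) (auto simp: algebra_simps)
      then show ?case using dual_mult[OF dG x' Suc] by simp
    qed (use dual_one[OF dG] in simp)
    \<comment> \<open>The relation p(x) = 0 is differentiated termwise. The coefficients have
      derivative 0 by induction, so only p'(x) times x' remains.\<close>
    have "(\<Sum>i\<le>Polynomial.degree p. Polynomial.coeff p i * x ^ i,
           \<Sum>i\<le>Polynomial.degree p. 0 * x ^ i + Polynomial.coeff p i * (of_nat i * x ^ (i - 1) * x')) \<in> G"
      by (intro dual_sum[OF dG] dual_mult[OF dG] pow sepgen_root.IH)
    moreover have "(\<Sum>i\<le>Polynomial.degree p. 0 * x ^ i + Polynomial.coeff p i * (of_nat i * x ^ (i - 1) * x'))
      = poly (pderiv p) x * x'"
    proof -
      have "poly (pderiv p) x = (\<Sum>i\<le>Polynomial.degree p. Polynomial.coeff p i * (of_nat i * x ^ (i - 1)))"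
      proof -
        have "p = (\<Sum>i\<le>Polynomial.degree p. Polynomial.monom (Polynomial.coeff p i) i)"
          by (simp add: poly_as_sum_of_monoms)
        then have "poly (pderiv p) x = poly (pderiv (\<Sum>i\<le>Polynomial.degree p. Polynomial.monom (Polynomial.coeff p i) i)) x"
          by simp
        also have "\<dots> = (\<Sum>i\<le>Polynomial.degree p. Polynomial.coeff p i * (of_nat i * x ^ (i - 1)))"
          unfolding pderiv_sum by (simp add: pderiv_monom poly_sum poly_monom algebra_simps)
        finally show ?thesis .
      qed
      then show ?thesis by (simp add: sum_distrib_right mult.assoc)
    qed
    ultimately have "(0, poly (pderiv p) x * x') \<in> G"
      using sepgen_root.hyps(2) by (simp add: poly_altdef)
    then have "x' = 0" using dual_zeroD[OF dG] sepgen_root.hyps(3) by fastforce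
    then show ?case using x' by simp
  next
    case (sepgen_base x)
    then show ?case using G0(2) G(2) by auto
  next
    case (sepgen_diff x y)
    then show ?case using dual_diff[OF dG, of x 0 y 0] by simp
  next
    case (sepgen_mult x y)
    then show ?case using dual_mult[OF dG, of x 0 y 0] by simp
  qed (rule inv)
  from this[OF zg] subsetD[OF G(2) G0(3)] have "0 = (1::'a)" by (rule dual_single_valued[OF dG])
  then show False by simp
qed

section \<open>Separability in HOL-Algebra\<close>

text \<open>A nonzero combination g of least degree divides I and J. Since J(x) is nonzero, so is
  g(x), and x is a root of the cofactor of g in I; minimality of I then makes g constant.\<close>

lemma polys_over_bezout:
  fixes E :: "'a::field set"
  assumes E: "is_subfield E" and I: "I \<in> polys_over E" "I \<noteq> 0" "poly I x = 0"
    and Imin: "\<And>q. q \<in> polys_over E \<Longrightarrow> q \<noteq> 0 \<Longrightarrow> poly q x = 0 \<Longrightarrow> Polynomial.degree I \<le> Polynomial.degree q"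
    and J: "J \<in> polys_over E" "poly J x \<noteq> 0"
  shows "\<exists>a\<in>polys_over E. \<exists>b\<in>polys_over E. a * I + b * J = 1"
proof -
  note sr = is_subfield_imp_subring[OF E]
  note psr = is_subring_polys_over[OF sr]
  define P where "P g \<longleftrightarrow> g \<noteq> 0 \<and> (\<exists>a\<in>polys_over E. \<exists>b\<in>polys_over E. g = a * I + b * J)" for g
  have "P J" unfolding P_def using J subring_zero[OF psr] subring_one[OF psr]
    by (intro conjI bexI[of _ 0] bexI[of _ 1]) auto
  then obtain g where g: "P g" and gmin: "\<And>h. P h \<Longrightarrow> Polynomial.degree g \<le> Polynomial.degree h"
    using ex_has_least_nat[of P J Polynomial.degree] by metis
  from g obtain a b where ab: "a \<in> polys_over E" "b \<in> polys_over E" "g = a * I + b * J" and g0: "g \<noteq> 0"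
    unfolding P_def by blast
  have gE: "g \<in> polys_over E" unfolding ab(3) by (intro subring_add[OF psr] subring_mult[OF psr] ab I J)
  have dvd: "\<exists>s\<in>polys_over E. c * I + d * J = s * g" if cd: "c \<in> polys_over E" "d \<in> polys_over E" for c d
  proof -
    have "c * I + d * J \<in> polys_over E" by (intro subring_add[OF psr] subring_mult[OF psr] cd I J)
    from polys_over_division[OF E this gE g0] obtain s r where
      sr': "s \<in> polys_over E" "c * I + d * J = s * g + r" "r = 0 \<or> Polynomial.degree r < Polynomial.degree g" by blast
    have "r = (c - s * a) * I + (d - s * b) * J" using sr'(2) by (simp add: ab(3) algebra_simps)
    moreover have "c - s * a \<in> polys_over E" "d - s * b \<in> polys_over E"
      by (intro subring_diff[OF psr] subring_mult[OF psr] cd sr' ab)+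
    ultimately have "P r" if "r \<noteq> 0" using that unfolding P_def by blast
    then have "r = 0" using gmin sr'(3) by force
    then show ?thesis using sr' by auto
  qed
  obtain s where s: "s \<in> polys_over E" "I = s * g"
    using dvd[OF subring_one[OF psr] subring_zero[OF psr]] by auto
  obtain t where t: "t \<in> polys_over E" "J = t * g"
    using dvd[OF subring_zero[OF psr] subring_one[OF psr]] by auto
  have "poly s x = 0" using s(2) t(2) I(3) J(2) by auto
  moreover have "s \<noteq> 0" using s(2) I(2) by auto
  ultimately have "Polynomial.degree I \<le> Polynomial.degree s" using Imin[OF s(1)] by blast
  then have "Polynomial.degree g = 0" using s(2) I(2) by (simp add: degree_mult_eq)
  then obtain c where c: "g = [:c:]" by (rule degree_eq_zeroE)
  then have "c \<noteq> 0" using g0 by auto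
  have cE: "inverse c \<in> E" using gE c subfield_inverse[OF E] by (auto simp: polys_over_def coeff_pCons dest: spec[of _ 0])
  have "smult (inverse c) a * I + smult (inverse c) b * J = smult (inverse c) g"
    by (simp add: ab(3) smult_add_right)
  also have "\<dots> = 1" using c \<open>c \<noteq> 0\<close> by simp
  finally show ?thesis using polys_over_smult[OF sr cE] ab by blast
qed

text \<open>
  A field of HOL-Algebra is studied through a homomorphism to a type of class \<open>field\<close>; the coefficient
  lists of HOL-Algebra become elements of the type of polynomials.
\<close>

locale field_to_type = Ring.field F for F (structure) +
  fixes h :: "'a \<Rightarrow> 'd::Fields.field"
  assumes h: "h \<in> Ring.ring_hom F ring_of_type_algebra"
begin

lemma h_simps [simp]:
  "h \<one> = 1" "x \<in> carrier F \<Longrightarrow> y \<in> carrier F \<Longrightarrow> h (x \<otimes> y) = h x * h y"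
  "x \<in> carrier F \<Longrightarrow> y \<in> carrier F \<Longrightarrow> h (x \<oplus> y) = h x + h y"
  using h by (auto simp: Ring.ring_hom_def ring_of_type_algebra_def)

lemma h_zero [simp]: "h \<zero> = 0"
proof -
  have "h \<zero> + h \<zero> = h \<zero> + 0" using h_simps(3)[of \<zero> \<zero>] by (metis l_zero zero_closed add_0_right)
  then show ?thesis by (simp only: add_left_cancel)
qed

lemma h_uminus [simp]: "x \<in> carrier F \<Longrightarrow> h (\<ominus> x) = - h x"
  using h_simps(3)[of x "\<ominus> x"] by (simp add: r_neg eq_neg_iff_add_eq_0 add.commute)

lemma h_pow [simp]: "x \<in> carrier F \<Longrightarrow> h (x [^] (n::nat)) = h x ^ n"
  by (induction n) (auto simp: mult.commute)

lemma h_inv: "x \<in> carrier F \<Longrightarrow> x \<noteq> \<zero> \<Longrightarrow> h (inv x) * h x = 1"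
  by (metis h_simps(1,2) field_Units DiffI Units_inv_closed Units_l_inv singletonD)

lemma h_eq_0_iff [simp]: "x \<in> carrier F \<Longrightarrow> h x = 0 \<longleftrightarrow> x = \<zero>"
  using h_inv[of x] by fastforce

lemma h_eq_iff: "x \<in> carrier F \<Longrightarrow> y \<in> carrier F \<Longrightarrow> h x = h y \<longleftrightarrow> x = y"
  by (metis h_eq_0_iff h_simps(3) h_uminus a_inv_closed add.right_inverse add_eq_0_iff minus_equality minus_minus a_closed)

lemma h_finsum: "(\<And>i. i \<in> A \<Longrightarrow> f i \<in> carrier F) \<Longrightarrow> h (finsum F f A) = (\<Sum>i\<in>A. h (f i))"
  by (induction A rule: infinite_finite_induct) (auto simp: finsum_closed Pi_def)

lemma h_finprod: "(\<And>i. i \<in> A \<Longrightarrow> f i \<in> carrier F) \<Longrightarrow> h (finprod F f A) = (\<Prod>i\<in>A. h (f i))"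
  by (induction A rule: infinite_finite_induct) (auto simp: finprod_closed Pi_def)

lemma h_add_pow: "x \<in> carrier F \<Longrightarrow> h (add_pow F (n::nat) x) = of_nat n * h x"
  by (induction n) (simp_all add: add.nat_pow_Suc algebra_simps)

lemma is_subfield_image: "subfield E F \<Longrightarrow> is_subfield (h ` E)"
  unfolding is_subfield_def
proof (intro conjI ballI)
  assume E: "subfield E F"
  note Es = subfieldE(3)[OF E]
  show "1 \<in> h ` E" using subringE(3)[OF subfieldE(1)[OF E]] h_simps(1) by force
  fix u assume "u \<in> h ` E"
  then obtain x where x: "x \<in> E" "x \<in> carrier F" "u = h x" using Es by blast
  show "inverse u \<in> h ` E"
  proof (cases "x = \<zero>")
    case True
    then show ?thesis using x by force
  next
    case False
    have "inv x \<in> E" using subfield_m_inv(1)[OF E] x False by blast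
    moreover have "inverse u = h (inv x)" using h_inv[OF x(2) False] x(3) by (metis inverse_unique mult.commute)
    ultimately show ?thesis by blast
  qed
  fix v assume "v \<in> h ` E"
  then obtain y where y: "y \<in> E" "y \<in> carrier F" "v = h y" using Es by blast
  have "x \<oplus> \<ominus> y \<in> E" "x \<otimes> y \<in> E"
    using x(1) y(1) subringE(5,6,7)[OF subfieldE(1)[OF E]] by auto
  moreover have "u - v = h (x \<oplus> \<ominus> y)" "u * v = h (x \<otimes> y)" using x y by auto
  ultimately show "u - v \<in> h ` E" "u * v \<in> h ` E" by blast+
qed

definition poly_of :: "'a list \<Rightarrow> 'd poly" where
  "poly_of l = Poly (rev (map h l))"

lemma coeff_poly_of: "Polynomial.coeff (poly_of l) i = h (coeff l i)"
proof (induction l)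
  case (Cons a l)
  have "poly_of (a # l) = poly_of l + Polynomial.monom (h a) (length l)"
    by (simp add: poly_of_def Poly_append smult_monom)
  then show ?case using Cons coeff_length[of l "length l"] by auto
qed (simp add: poly_of_def)

lemma poly_poly_of: "set l \<subseteq> carrier F \<Longrightarrow> x \<in> carrier F \<Longrightarrow> poly (poly_of l) (h x) = h (eval l x)"
proof (induction l)
  case (Cons a l)
  have "poly_of (a # l) = poly_of l + Polynomial.monom (h a) (length l)"
    by (simp add: poly_of_def Poly_append smult_monom)
  then show ?case using Cons eval_in_carrier[of l x] by (simp add: poly_monom add.commute)
qed (simp add: poly_of_def)

context
  fixes E assumes E: "subfield E F"
begin

lemma poly_ring_set: "l \<in> carrier (E[X]) \<Longrightarrow> set l \<subseteq> carrier F"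
  using polynomial_in_carrier[OF subfieldE(1)[OF E]] univ_poly_carrier by blast

lemma poly_of_add: "p \<in> carrier (E[X]) \<Longrightarrow> q \<in> carrier (E[X]) \<Longrightarrow> poly_of (p \<oplus>\<^bsub>E[X]\<^esub> q) = poly_of p + poly_of q"
  using poly_ring_set[of p] poly_ring_set[of q]
  by (intro poly_eqI) (simp add: coeff_poly_of univ_poly_add poly_add_coeff del: poly_add.simps)

lemma poly_of_mult: "p \<in> carrier (E[X]) \<Longrightarrow> q \<in> carrier (E[X]) \<Longrightarrow> poly_of (p \<otimes>\<^bsub>E[X]\<^esub> q) = poly_of p * poly_of q"
  using poly_ring_set[of p] poly_ring_set[of q]
  by (intro poly_eqI) (simp add: coeff_poly_of univ_poly_mult poly_mult_coeff coeff_mult h_finsum del: poly_mult.simps)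

lemma poly_of_one: "poly_of \<one>\<^bsub>E[X]\<^esub> = 1"
  by (simp add: poly_of_def univ_poly_one)

lemma poly_of_in: "p \<in> carrier (E[X]) \<Longrightarrow> poly_of p \<in> polys_over (h ` E)"
  using coeff_in_carrier poly_coeff_in_carrier univ_poly_carrier
  unfolding polys_over_def coeff_poly_of mem_Collect_eq polynomial_def
proof (intro allI imageI)
  fix i assume "p \<in> carrier (E[X])"
  then have "set p \<subseteq> E" by (auto simp: polynomial_def simp flip: univ_poly_carrier)
  then show "coeff p i \<in> E"
    using coeff_img(3)[of p] subringE(2)[OF subfieldE(1)[OF E]] by (cases "i < length p") (auto simp: coeff_length coeff_nth)
qed

lemma degree_poly_of: "p \<in> carrier (E[X]) \<Longrightarrow> Polynomial.degree (poly_of p) = length p - 1"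
proof (cases p)
  case (Cons a l)
  assume p: "p \<in> carrier (E[X])"
  then have a: "a \<noteq> \<zero>" "a \<in> carrier F"
    using poly_ring_set[OF p] by (auto simp: Cons polynomial_def simp flip: univ_poly_carrier)
  show ?thesis
  proof (rule antisym)
    show "Polynomial.degree (poly_of p) \<le> length p - 1"
      by (rule degree_le) (auto simp: coeff_poly_of coeff_degree)
    show "length p - 1 \<le> Polynomial.degree (poly_of p)"
      using a by (intro le_degree) (auto simp: coeff_poly_of Cons)
  qed
qed (simp add: poly_of_def)

lemma poly_of_eq_0_iff: "p \<in> carrier (E[X]) \<Longrightarrow> poly_of p = 0 \<longleftrightarrow> p = []"
proof (cases p)
  case (Cons a l)
  assume p: "p \<in> carrier (E[X])"
  then have "a \<noteq> \<zero>" "a \<in> carrier F"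
    using poly_ring_set[OF p] by (auto simp: Cons polynomial_def simp flip: univ_poly_carrier)
  then have "Polynomial.coeff (poly_of p) (length l) \<noteq> 0" by (simp add: coeff_poly_of Cons)
  then show ?thesis by (auto simp: Cons)
qed (simp add: poly_of_def)

lemma poly_of_inj:
  assumes p: "p \<in> carrier (E[X])" and q: "q \<in> carrier (E[X])" and eq: "poly_of p = poly_of q"
  shows "p = q"
proof -
  have "h (coeff p i) = h (coeff q i)" for i using eq by (metis coeff_poly_of)
  then have "coeff p = coeff q"
    using h_eq_iff coeff_in_carrier poly_ring_set[OF p] poly_ring_set[OF q] by blast
  moreover have "polynomial E p" "polynomial E q" using p q univ_poly_carrier by blast+
  ultimately show ?thesis using coeff_iff_polynomial_cond by blast
qed

lemma poly_of_surj:
  assumes "p \<in> polys_over (h ` E)"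
  shows "\<exists>l\<in>carrier (E[X]). poly_of l = p"
proof -
  define g where "g = inv_into (carrier F) h"
  have inj: "inj_on h (carrier F)" using h_eq_iff by (auto simp: inj_on_def)
  have Es: "E \<subseteq> carrier F" using subfieldE(3)[OF E] .
  have g: "g u \<in> E \<and> h (g u) = u" if "u \<in> h ` E" for u
  proof -
    obtain e where "e \<in> E" "u = h e" using \<open>u \<in> h ` E\<close> by blast
    then show ?thesis using inv_into_f_f[OF inj] Es by (auto simp: g_def)
  qed
  define l where "l = map g (rev (coeffs p))"
  have cE: "c \<in> h ` E" if "c \<in> set (coeffs p)" for c
    using assms that by (auto simp: polys_over_def coeffs_def split: if_splits)
  have "l \<in> carrier (E[X])"
  proof (cases "p = 0")
    case False
    have "hd l = g (lead_coeff p)" using False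
      by (simp add: l_def hd_map hd_rev last_coeffs_eq_coeff_degree)
    moreover have "lead_coeff p \<in> h ` E" using assms by (auto simp: polys_over_def)
    ultimately have "hd l \<noteq> \<zero>" using g False by (metis h_zero leading_coeff_0_iff)
    moreover have "set l \<subseteq> E" using g cE by (auto simp: l_def)
    ultimately show ?thesis by (auto simp: polynomial_def simp flip: univ_poly_carrier)
  qed (auto simp: l_def polynomial_def simp flip: univ_poly_carrier)
  moreover have "poly_of l = p"
  proof -
    have "map h l = rev (coeffs p)" using g cE by (auto simp: l_def intro!: map_idI)
    then show ?thesis by (simp add: poly_of_def)
  qed
  ultimately show ?thesis by blast
qed

lemma list_pderiv_poly_of:
  assumes p: "p \<in> carrier (E[X])"
  shows "list_pderiv F p \<in> carrier (E[X])" "poly_of (list_pderiv F p) = pderiv (poly_of p)"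
proof -
  note Es = subfieldE(3)[OF E]
  note sE = subfieldE(1)[OF E]
  define l where "l = map (\<lambda>i. add_pow F (length p - 1 - i) (p ! i)) [0..<length p - 1]"
  have pE: "set p \<subseteq> E" using p by (auto simp: polynomial_def simp flip: univ_poly_carrier)
  have add_powE: "add_pow F (n::nat) x \<in> E" if "x \<in> E" for n x
    using that subringE(2,7)[OF sE] Es by (induction n) (simp_all add: add.nat_pow_Suc)
  have lE: "set l \<subseteq> E"
  proof
    fix u assume "u \<in> set l"
    then obtain i where i: "i < length p - 1" "u = add_pow F (length p - 1 - i) (p ! i)"
      unfolding l_def by (auto simp del: diff_Suc_eq_diff_pred)
    then have "p ! i \<in> set p" by (intro nth_mem) simp
    then show "u \<in> E" unfolding i(2) using pE by (intro add_powE) blast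
  qed
  have "polynomial E (normalize l)" using normalize_gives_polynomial[OF lE] .
  then show "list_pderiv F p \<in> carrier (E[X])" by (simp add: list_pderiv_def l_def univ_poly_carrier)
  show "poly_of (list_pderiv F p) = pderiv (poly_of p)"
  proof (rule poly_eqI)
    fix i
    \<comment> \<open>\<open>normalize\<close> strips leading zeros, which do occur in positive
      characteristic, and leaves every coefficient at its exponent.\<close>
    have "coeff (list_pderiv F p) i = coeff l i"
      using normalize_coeff[of l] by (simp add: list_pderiv_def l_def)
    also have "h \<dots> = of_nat (Suc i) * h (coeff p (Suc i))"
    proof (cases "Suc i < length p")
      case True
      have "coeff l i = add_pow F (Suc i) (p ! (length p - 1 - Suc i))"
        using True by (subst coeff_nth) (auto simp: l_def Suc_diff_Suc)
      moreover have "p ! (length p - 1 - Suc i) \<in> carrier F" 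
      proof -
        have "length p - 1 - Suc i < length p" using True by linarith
        then have "p ! (length p - 1 - Suc i) \<in> set p" by (rule nth_mem)
        then show ?thesis using pE Es by blast
      qed
      ultimately show ?thesis using coeff_nth[OF True] by (simp add: h_add_pow algebra_simps)
    next
      case False
      then show ?thesis by (simp add: coeff_length l_def)
    qed
    finally show "Polynomial.coeff (poly_of (list_pderiv F p)) i = Polynomial.coeff (pderiv (poly_of p)) i"
      by (simp add: coeff_poly_of coeff_pderiv)
  qed
qed

lemma algebraic_iff:
  assumes x: "x \<in> carrier F"
  shows "\<not> transcendental E x \<longleftrightarrow> (\<exists>p\<in>polys_over (h ` E). p \<noteq> 0 \<and> poly p (h x) = 0)"
proof
  assume "\<not> transcendental E x"
  then obtain p where p: "p \<in> carrier (E[X])" "p \<noteq> []" "eval p x = \<zero>"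
    using algebraicE[OF subfieldE(1)[OF E] x] by (auto simp: over_def)
  have "poly (poly_of p) (h x) = 0"
    using poly_poly_of[OF poly_ring_set[OF p(1)] x] p(3) by simp
  then show "\<exists>p\<in>polys_over (h ` E). p \<noteq> 0 \<and> poly p (h x) = 0"
    using poly_of_in[OF p(1)] poly_of_eq_0_iff[OF p(1)] p(2) by blast
next
  assume "\<exists>p\<in>polys_over (h ` E). p \<noteq> 0 \<and> poly p (h x) = 0"
  then obtain l where l: "l \<in> carrier (E[X])" "poly_of l \<noteq> 0" "poly (poly_of l) (h x) = 0"
    using poly_of_surj by blast
  then have "eval l x = \<zero>"
    using poly_poly_of[OF poly_ring_set[OF l(1)] x] eval_in_carrier[OF poly_ring_set[OF l(1)] x] by simp
  then show "\<not> transcendental E x" using algebraicI[OF l(1)] l(2) poly_of_eq_0_iff[OF l(1)] by (auto simp: over_def)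
qed

context
  fixes x assumes x: "x \<in> carrier F" and alg: "\<not> transcendental E x"
begin

definition min_poly :: "'d poly" where "min_poly = poly_of (Irr E x)"

lemma Irr_props:
  "Irr E x \<in> carrier (E[X])" "pirreducible E (Irr E x)" "hd (Irr E x) = \<one>" "eval (Irr E x) x = \<zero>"
  using IrrE[OF E x] alg by (auto simp: over_def)

lemma Irr_nonempty: "Irr E x \<noteq> []"
  using Irr_props(2) by (auto simp: ring_irreducible_def univ_poly_zero)

lemma min_poly_in: "min_poly \<in> polys_over (h ` E)"
  unfolding min_poly_def using poly_of_in[OF Irr_props(1)] .

lemma min_poly_root: "poly min_poly (h x) = 0"
  unfolding min_poly_def using poly_poly_of[OF poly_ring_set[OF Irr_props(1)] x] Irr_props(4) by simp

lemma min_poly_nonzero: "min_poly \<noteq> 0"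
  unfolding min_poly_def using poly_of_eq_0_iff[OF Irr_props(1)] Irr_nonempty by simp

lemma min_poly_monic: "Polynomial.lead_coeff min_poly = 1"
  unfolding min_poly_def degree_poly_of[OF Irr_props(1)] coeff_poly_of
  using lead_coeff_simp[OF Irr_nonempty] Irr_props(3) by simp

lemma min_poly_dvd:
  assumes p: "p \<in> polys_over (h ` E)" "poly p (h x) = 0"
  shows "\<exists>q\<in>polys_over (h ` E). p = min_poly * q"
proof -
  obtain l where l: "l \<in> carrier (E[X])" "poly_of l = p" using poly_of_surj[OF p(1)] by blast
  then have "eval l x = \<zero>"
    using poly_poly_of[OF poly_ring_set[OF l(1)] x] eval_in_carrier[OF poly_ring_set[OF l(1)] x] p(2) by simp
  then have "Irr E x pdivides l" using Irr_minimal[OF E x _ l(1)] alg by (simp add: over_def)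
  then have "Irr E x divides\<^bsub>E[X]\<^esub> l" using pdivides_iff_shell[OF E Irr_props(1) l(1)] by simp
  then obtain q where q: "q \<in> carrier (E[X])" "l = Irr E x \<otimes>\<^bsub>E[X]\<^esub> q" by (auto simp: factor_def)
  then have "p = min_poly * poly_of q" using poly_of_mult[OF Irr_props(1) q(1)] l(2) by (simp add: min_poly_def)
  then show ?thesis using poly_of_in[OF q(1)] by blast
qed

lemma min_poly_least:
  assumes "p \<in> polys_over (h ` E)" "p \<noteq> 0" "poly p (h x) = 0"
  shows "Polynomial.degree min_poly \<le> Polynomial.degree p"
  using min_poly_dvd[OF assms(1,3)] assms(2) by (auto simp: degree_mult_eq)

end

text \<open>The Bezout identity, evaluated at x, shows that the derivative of the minimal polynomial
  does not vanish there. Conversely, a simple root of any witness is one of the minimal polynomial,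
  and \<open>polys_over_bezout\<close> returns the identity, which is then pulled back to
  coefficient lists.\<close>

theorem separable_over_iff:
  assumes x: "x \<in> carrier F"
  shows "separable_over F E x \<longleftrightarrow> sep_over (h ` E) (h x)"
proof
  assume "separable_over F E x"
  then have alg: "\<not> transcendental E x" and sep: "separable_poly F E (Irr E x)"
    by (auto simp: separable_over_def)
  note I = Irr_props[OF x alg]
  obtain a b where ab: "a \<in> carrier (E[X])" "b \<in> carrier (E[X])"
    "(a \<otimes>\<^bsub>E[X]\<^esub> Irr E x) \<oplus>\<^bsub>E[X]\<^esub> (b \<otimes>\<^bsub>E[X]\<^esub> list_pderiv F (Irr E x)) = \<one>\<^bsub>E[X]\<^esub>"
    using sep by (auto simp: separable_poly_def)
  interpret UP: Ring.ring "E[X]\<^bsub>F\<^esub>" using univ_poly_is_ring[OF subfieldE(1)[OF E]] .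
  have "poly_of a * min_poly x + poly_of b * pderiv (min_poly x) = 1"
    using arg_cong[OF ab(3), of poly_of] ab(1,2) I(1) list_pderiv_poly_of[OF I(1)]
    by (simp add: poly_of_add poly_of_mult poly_of_one min_poly_def[OF x alg])
  then have "poly (poly_of a * min_poly x + poly_of b * pderiv (min_poly x)) (h x) = 1" by simp
  then have "poly (pderiv (min_poly x)) (h x) \<noteq> 0" using min_poly_root[OF x alg] by auto
  then show "sep_over (h ` E) (h x)"
    unfolding sep_over_def using min_poly_in[OF x alg] min_poly_root[OF x alg] by blast
next
  assume "sep_over (h ` E) (h x)"
  then obtain p where p: "p \<in> polys_over (h ` E)" "poly p (h x) = 0" "poly (pderiv p) (h x) \<noteq> 0"
    by (auto simp: sep_over_def)
  then have "p \<noteq> 0" by auto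
  then have alg: "\<not> transcendental E x" using algebraic_iff[OF x] p by blast
  note I = Irr_props[OF x alg]
  note sf = is_subfield_image[OF E]
  obtain q where q: "q \<in> polys_over (h ` E)" "p = min_poly x * q" using min_poly_dvd[OF x alg p(1,2)] by blast
  have "poly (pderiv (min_poly x)) (h x) \<noteq> 0"
    using p(3) min_poly_root[OF x alg] by (auto simp: q(2) pderiv_mult)
  from polys_over_bezout[OF sf min_poly_in[OF x alg] min_poly_nonzero[OF x alg] min_poly_root[OF x alg]
      min_poly_least[OF x alg] polys_over_pderiv[OF is_subfield_imp_subring[OF sf] min_poly_in[OF x alg]] this]
  obtain a b where ab: "a \<in> polys_over (h ` E)" "b \<in> polys_over (h ` E)"
    "a * min_poly x + b * pderiv (min_poly x) = 1" by blast
  obtain a' b' where ab': "a' \<in> carrier (E[X])" "poly_of a' = a" "b' \<in> carrier (E[X])" "poly_of b' = b"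
    using poly_of_surj ab(1,2) by metis
  interpret UP: Ring.ring "E[X]\<^bsub>F\<^esub>" using univ_poly_is_ring[OF subfieldE(1)[OF E]] .
  have "poly_of ((a' \<otimes>\<^bsub>E[X]\<^esub> Irr E x) \<oplus>\<^bsub>E[X]\<^esub> (b' \<otimes>\<^bsub>E[X]\<^esub> list_pderiv F (Irr E x))) = poly_of \<one>\<^bsub>E[X]\<^esub>"
    using ab' ab(3) I(1) list_pderiv_poly_of[OF I(1)]
    by (simp add: poly_of_add poly_of_mult poly_of_one min_poly_def[OF x alg])
  then have "(a' \<otimes>\<^bsub>E[X]\<^esub> Irr E x) \<oplus>\<^bsub>E[X]\<^esub> (b' \<otimes>\<^bsub>E[X]\<^esub> list_pderiv F (Irr E x)) = \<one>\<^bsub>E[X]\<^esub>"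
    by (intro poly_of_inj) (use ab' I(1) list_pderiv_poly_of[OF I(1)] in auto)
  then show "separable_over F E x"
    using x alg I(1) ab' by (auto simp: separable_over_def separable_poly_def)
qed

end

end

section \<open>Evaluation of multivariate polynomials\<close>

definition mono_eval :: "(nat \<Rightarrow> 'b::comm_ring_1) \<Rightarrow> (nat \<Rightarrow>\<^sub>0 nat) \<Rightarrow> 'b" where
  "mono_eval x m = (\<Prod>i\<in>Poly_Mapping.keys m. x i ^ Poly_Mapping.lookup m i)"

text \<open>Coefficients are mapped by a separate h, so that evaluation in M, over its algebraic
  closure and at generic points of function fields are instances of one operation.\<close>

definition mev :: "('a::zero \<Rightarrow> 'b) \<Rightarrow> (nat \<Rightarrow> 'b::comm_ring_1) \<Rightarrow> 'a mpoly \<Rightarrow> 'b" where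
  "mev h x p = (\<Sum>m\<in>Poly_Mapping.keys p. h (Poly_Mapping.lookup p m) * mono_eval x m)"

definition mvar :: "nat \<Rightarrow> 'a::zero_neq_one mpoly" where
  "mvar i = Poly_Mapping.single (Poly_Mapping.single i 1) 1"

lemma mpoly_eval_eq: "mpoly_eval p x = mev (\<lambda>c. c) x p"
  by (simp add: mpoly_eval_def mev_def mono_eval_def)

lemma mono_eval_superset:
  assumes "finite S" "Poly_Mapping.keys m \<subseteq> S"
  shows "mono_eval x m = (\<Prod>i\<in>S. x i ^ Poly_Mapping.lookup m i)"
  unfolding mono_eval_def using assms
  by (intro prod.mono_neutral_left) (auto simp: in_keys_iff)

lemma mono_eval_0 [simp]: "mono_eval x 0 = 1"
  by (simp add: mono_eval_def)

lemma mono_eval_add: "mono_eval x (m + m') = mono_eval x m * mono_eval x m'"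
proof -
  let ?S = "Poly_Mapping.keys m \<union> Poly_Mapping.keys m'"
  have "Poly_Mapping.keys (m + m') \<subseteq> ?S" by (rule Poly_Mapping.keys_add)
  then have "mono_eval x (m + m') = (\<Prod>i\<in>?S. x i ^ Poly_Mapping.lookup (m + m') i)"
    by (intro mono_eval_superset) auto
  also have "\<dots> = (\<Prod>i\<in>?S. x i ^ Poly_Mapping.lookup m i) * (\<Prod>i\<in>?S. x i ^ Poly_Mapping.lookup m' i)"
    by (simp add: lookup_add power_add prod.distrib)
  also have "\<dots> = mono_eval x m * mono_eval x m'"
    by (simp add: mono_eval_superset[of ?S])
  finally show ?thesis .
qed

lemma mono_eval_single [simp]: "mono_eval x (Poly_Mapping.single i k) = x i ^ k"
  by (simp add: mono_eval_def)

lemma mpoly_expansion: "(\<Sum>m\<in>Poly_Mapping.keys p. Poly_Mapping.single m (Poly_Mapping.lookup p m)) = p"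
proof (rule poly_mapping_eqI)
  fix k
  have "Poly_Mapping.lookup (\<Sum>m\<in>Poly_Mapping.keys p. Poly_Mapping.single m (Poly_Mapping.lookup p m)) k =
    (\<Sum>m\<in>Poly_Mapping.keys p. if m = k then Poly_Mapping.lookup p m else 0)"
    by (simp add: lookup_sum lookup_single when_def)
  also have "\<dots> = Poly_Mapping.lookup p k" by (auto simp: in_keys_iff)
  finally show "Poly_Mapping.lookup (\<Sum>m\<in>Poly_Mapping.keys p. Poly_Mapping.single m (Poly_Mapping.lookup p m)) k
    = Poly_Mapping.lookup p k" .
qed

context comm_ring_hom
begin

lemma mev_superset:
  assumes "finite S" "Poly_Mapping.keys p \<subseteq> S"
  shows "mev hom x p = (\<Sum>m\<in>S. hom (Poly_Mapping.lookup p m) * mono_eval x m)"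
  unfolding mev_def using assms
  by (intro sum.mono_neutral_left) (auto simp: in_keys_iff)

lemma mev_zero [simp]: "mev hom x 0 = 0"
  by (simp add: mev_def)

lemma mev_single: "mev hom x (Poly_Mapping.single m c) = hom c * mono_eval x m"
  by (simp add: mev_def)

lemma mev_const [simp]: "mev hom x (const_mpoly c) = hom c"
  by (simp add: mev_single const_mpoly_def)

lemma mev_var [simp]: "mev hom x (mvar i) = x i"
  by (simp add: mev_single mvar_def)

lemma mev_add: "mev hom x (p + q) = mev hom x p + mev hom x q"
proof -
  let ?S = "Poly_Mapping.keys p \<union> Poly_Mapping.keys q"
  have "mev hom x (p + q) = (\<Sum>m\<in>?S. hom (Poly_Mapping.lookup (p + q) m) * mono_eval x m)"
    using Poly_Mapping.keys_add[of p q] by (intro mev_superset) auto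
  also have "\<dots> = mev hom x p + mev hom x q"
    by (simp add: mev_superset[of ?S] lookup_add hom_add sum.distrib algebra_simps)
  finally show ?thesis .
qed

lemma mev_sum: "mev hom x (sum f A) = (\<Sum>i\<in>A. mev hom x (f i))"
  by (induction A rule: infinite_finite_induct) (auto simp: mev_add)

lemma mev_mult: "mev hom x (p * q) = mev hom x p * mev hom x q"
proof -
  have "p * q = (\<Sum>m\<in>Poly_Mapping.keys p. Poly_Mapping.single m (Poly_Mapping.lookup p m)) *
    (\<Sum>m\<in>Poly_Mapping.keys q. Poly_Mapping.single m (Poly_Mapping.lookup q m))"
    by (simp add: mpoly_expansion)
  also have "\<dots> = (\<Sum>m\<in>Poly_Mapping.keys p. \<Sum>m'\<in>Poly_Mapping.keys q.
      Poly_Mapping.single (m + m') (Poly_Mapping.lookup p m * Poly_Mapping.lookup q m'))"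
    by (simp add: sum_product mult_single)
  finally show ?thesis
    by (simp only: mev_sum mev_single mono_eval_add hom_mult)
      (simp add: mev_def sum_product algebra_simps)
qed

lemma comm_ring_hom_mev: "comm_ring_hom (mev hom x)"
proof
  show "mev hom x 1 = 1" using mev_single[of x 0 1] by simp
qed (simp_all add: mev_add mev_mult)

lemma mev_cong_hom:
  assumes "comm_ring_hom g"
  shows "g (mev hom x p) = mev (\<lambda>c. g (hom c)) (\<lambda>i. g (x i)) p"
proof -
  interpret g: comm_ring_hom g by fact
  show ?thesis
    by (simp add: mev_def mono_eval_def g.hom_sum g.hom_mult g.hom_prod g.hom_power)
qed

end

lemma mev_cong: "p \<in> mpolys n \<Longrightarrow> (\<And>i. i < n \<Longrightarrow> x i = y i) \<Longrightarrow> mev h x p = mev h y p"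
  unfolding mev_def mono_eval_def mpolys_def
proof (intro sum.cong refl arg_cong2[of _ _ _ _ "(*)"] prod.cong)
  fix m i assume "p \<in> {p. \<forall>m\<in>Poly_Mapping.keys p. Poly_Mapping.keys m \<subseteq> {..<n}}" and xy: "\<And>i. i < n \<Longrightarrow> x i = y i"
    and "m \<in> Poly_Mapping.keys p" "i \<in> Poly_Mapping.keys m"
  then have "i < n" by auto
  then show "x i ^ Poly_Mapping.lookup m i = y i ^ Poly_Mapping.lookup m i" using xy by simp
qed

lemma is_subring_mpolys: "is_subring (mpolys n :: 'a::comm_ring_1 mpoly set)"
  unfolding is_subring_def
proof (intro conjI ballI)
  show "(1::'a mpoly) \<in> mpolys n" by (auto simp: mpolys_def)
next
  fix p q :: "'a mpoly" assume pq: "p \<in> mpolys n" "q \<in> mpolys n"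
  show "p - q \<in> mpolys n" using pq keys_diff[of p q] unfolding mpolys_def by blast
  have "Poly_Mapping.keys (a + b) \<subseteq> {..<n}" if "a \<in> Poly_Mapping.keys p" "b \<in> Poly_Mapping.keys q" for a b
    using Poly_Mapping.keys_add[of a b] pq that unfolding mpolys_def by blast
  then show "p * q \<in> mpolys n" using keys_mult[of p q] unfolding mpolys_def by blast
qed

lemma mvar_in_mpolys: "i < n \<Longrightarrow> mvar i \<in> mpolys n"
  by (auto simp: mvar_def mpolys_def)

lemma const_mpoly_in_mpolys: "const_mpoly c \<in> mpolys n"
  by (auto simp: const_mpoly_def mpolys_def)

lemma const_mpoly_hom: "comm_ring_hom (const_mpoly :: 'a::comm_ring_1 \<Rightarrow> 'a mpoly)"
  by standard (auto simp: const_mpoly_def single_add mult_single)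

lemma mono_eval_mvar: "mono_eval (mvar :: nat \<Rightarrow> 'a::comm_ring_1 mpoly) m = Poly_Mapping.single m 1"
proof -
  have pow: "(mvar i :: 'a mpoly) ^ k = Poly_Mapping.single (Poly_Mapping.single i k) 1" for i k
    by (induction k) (auto simp: mvar_def mult_single simp flip: single_add)
  have "(\<Prod>i\<in>S. (mvar i :: 'a mpoly) ^ f i) = Poly_Mapping.single (\<Sum>i\<in>S. Poly_Mapping.single i (f i)) 1" if "finite S" for S f
    using that by induction (auto simp: pow mult_single)
  then show ?thesis using mpoly_expansion[of m] by (simp add: mono_eval_def)
qed

lemma mev_const_mvar: "mev const_mpoly mvar p = p"
  by (simp add: mev_def mono_eval_mvar const_mpoly_def mult_single mpoly_expansion)

lemma to_ac_hom: "comm_ring_hom to_ac"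
  by standard auto

lemma id_hom: "comm_ring_hom (\<lambda>c. c)"
  by standard auto

lemma lookup_lift_mpoly: "Poly_Mapping.lookup (lift_mpoly p) m = to_ac (Poly_Mapping.lookup p m)"
  by (simp add: lift_mpoly_def Poly_Mapping.map.rep_eq when_def)

lemma keys_lift_mpoly: "Poly_Mapping.keys (lift_mpoly p) = Poly_Mapping.keys p"
  by (auto simp: in_keys_iff lookup_lift_mpoly)

lemma lift_mpoly_in_mpolys: "lift_mpoly p \<in> mpolys n \<longleftrightarrow> p \<in> mpolys n"
  by (simp add: mpolys_def keys_lift_mpoly)

lemma lift_mpoly_eq_0_iff: "lift_mpoly p = 0 \<longleftrightarrow> p = 0"
  by (simp add: poly_mapping_eq_iff fun_eq_iff lookup_lift_mpoly)

lemma mev_lift: "mev h x (lift_mpoly p) = mev (\<lambda>c. h (to_ac c)) x p"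
  by (simp add: mev_def keys_lift_mpoly lookup_lift_mpoly)

lemma lift_mpoly_eq_mev: "lift_mpoly p = mev (\<lambda>c. const_mpoly (to_ac c)) mvar p"
  using mev_lift[of const_mpoly mvar p] mev_const_mvar[of "lift_mpoly p"] by simp

lemma comm_ring_hom_compose: "comm_ring_hom f \<Longrightarrow> comm_ring_hom g \<Longrightarrow> comm_ring_hom (\<lambda>x. f (g x))"
proof -
  assume "comm_ring_hom f" "comm_ring_hom g"
  then interpret f: comm_ring_hom f + g: comm_ring_hom g .
  show ?thesis by standard (auto simp: f.hom_add g.hom_add f.hom_mult g.hom_mult)
qed

lemma lift_mpoly_hom: "comm_ring_hom lift_mpoly"
  using comm_ring_hom.comm_ring_hom_mev[OF comm_ring_hom_compose[OF const_mpoly_hom to_ac_hom]]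
  by (simp add: lift_mpoly_eq_mev[abs_def])

lemma mpoly_eval_lift: "mpoly_eval (lift_mpoly p) a = mev to_ac a p"
  by (simp add: mpoly_eval_eq mev_lift)

lemma mev_in_subring:
  assumes R: "is_subring R" and h: "\<And>c. h c \<in> R" and x: "\<And>i. i < n \<Longrightarrow> x i \<in> R" and p: "p \<in> mpolys n"
  shows "mev h x p \<in> R"
  unfolding mev_def mono_eval_def using p
  by (intro subring_sum[OF R] subring_mult[OF R] subring_prod[OF R] subring_power[OF R] h x)
    (auto simp: mpolys_def)

text \<open>Serves the induction on the number of variables: monomials are grouped by the exponent
  of the last variable.\<close>

lemma mpolys_Suc_expansion:
  fixes p :: "'a::comm_ring_1 mpoly"
  assumes p: "p \<in> mpolys (Suc n)"
  obtains P d where "\<And>k. P k \<in> mpolys n" "p = (\<Sum>k\<le>d. P k * mvar n ^ k)"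
proof -
  let ?K = "Poly_Mapping.keys p"
  define d where "d = Max (insert 0 ((\<lambda>m. Poly_Mapping.lookup m n) ` ?K))"
  define red where "red m = m - Poly_Mapping.single n (Poly_Mapping.lookup m n)" for m :: "nat \<Rightarrow>\<^sub>0 nat"
  define P where "P k = (\<Sum>m\<in>{m\<in>?K. Poly_Mapping.lookup m n = k}. Poly_Mapping.single (red m) (Poly_Mapping.lookup p m))" for k
  have red: "red m + Poly_Mapping.single n (Poly_Mapping.lookup m n) = m" for m
    by (rule poly_mapping_eqI) (simp add: red_def lookup_add lookup_minus lookup_single when_def)
  have keys_red: "Poly_Mapping.keys (red m) \<subseteq> {..<n}" if "m \<in> ?K" for m
  proof
    fix i assume i: "i \<in> Poly_Mapping.keys (red m)"
    then have "i \<noteq> n" "i \<in> Poly_Mapping.keys m"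
      by (auto simp: in_keys_iff red_def lookup_minus lookup_single when_def split: if_splits)
    moreover have "Poly_Mapping.keys m \<subseteq> {..<Suc n}" using p that by (simp add: mpolys_def)
    ultimately have "i < Suc n" "i \<noteq> n" by auto
    then show "i \<in> {..<n}" by simp
  qed
  have single_mpolys: "Poly_Mapping.single m c \<in> mpolys n" if "Poly_Mapping.keys m \<subseteq> {..<n}" for m and c :: 'a
    using that by (auto simp: mpolys_def)
  have 1: "P k \<in> mpolys n" for k
    unfolding P_def by (intro subring_sum[OF is_subring_mpolys] single_mpolys keys_red) auto
  have pow: "(mvar i :: 'a mpoly) ^ k = Poly_Mapping.single (Poly_Mapping.single i k) 1" for i k
    by (induction k) (auto simp: mvar_def mult_single simp flip: single_add)
  have "(\<Sum>k\<le>d. P k * mvar n ^ k) =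
    (\<Sum>k\<le>d. \<Sum>m\<in>{m\<in>?K. Poly_Mapping.lookup m n = k}. Poly_Mapping.single m (Poly_Mapping.lookup p m))"
    unfolding P_def sum_distrib_right pow mult_single
    by (intro sum.cong refl) (use red in auto)
  also have "\<dots> = (\<Sum>m\<in>?K. Poly_Mapping.single m (Poly_Mapping.lookup p m))"
    by (rule sum.group) (auto simp: d_def)
  also have "\<dots> = p" by (rule mpoly_expansion)
  finally show ?thesis using that[of P d] 1 by simp
qed

lemma mpolys_0: "p \<in> mpolys 0 \<Longrightarrow> p = const_mpoly (Poly_Mapping.lookup p 0)"
  by (rule poly_mapping_eqI) (auto simp: mpolys_def const_mpoly_def lookup_single when_def in_keys_iff keys_eq_empty)

text \<open>Fixing all variables but the last leaves a univariate polynomial with infinitely many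
  roots; its coefficients are values of polynomials in fewer variables.\<close>

lemma mpoly_eq_0I:
  fixes p :: "'a::field mpoly"
  assumes inf: "infinite (UNIV :: 'a set)" and p: "p \<in> mpolys n"
    and zero: "\<And>x. mev (\<lambda>c. c) x p = 0"
  shows "p = 0"
  using p zero
proof (induction n arbitrary: p)
  case 0
  obtain c where c: "p = const_mpoly c" using mpolys_0[OF 0(1)] by blast
  have "c = 0" using 0(2)[of "\<lambda>_. 0"] comm_ring_hom.mev_const[OF id_hom, of _ c] unfolding c by metis
  then show ?case by (simp add: c const_mpoly_def)
next
  case (Suc n)
  obtain P d where P: "\<And>k. P k \<in> mpolys n" "p = (\<Sum>k\<le>d. P k * mvar n ^ k)"
    using mpolys_Suc_expansion[OF Suc.prems(1)] by blast
  have "mev (\<lambda>c. c) x (P k) = 0" if "k \<le> d" for x k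
  proof -
    define q where "q = (\<Sum>k\<le>d. Polynomial.monom (mev (\<lambda>c. c) x (P k)) k)"
    have "poly q t = 0" for t
    proof -
      interpret m: comm_ring_hom "mev (\<lambda>c::'a. c) (x(n := t))" by (rule comm_ring_hom.comm_ring_hom_mev[OF id_hom])
      have mvar_t: "mev (\<lambda>c::'a. c) (x(n := t)) (mvar n) = t" using comm_ring_hom.mev_var[OF id_hom, of "x(n := t)" n] by simp
      have "poly q t = (\<Sum>k\<le>d. mev (\<lambda>c. c) x (P k) * t ^ k)"
        by (simp add: q_def poly_sum poly_monom)
      also have "\<dots> = (\<Sum>k\<le>d. mev (\<lambda>c. c) (x(n := t)) (P k) * t ^ k)"
        by (intro sum.cong refl arg_cong2[of _ _ _ _ "(*)"] mev_cong[OF P(1)]) auto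
      also have "\<dots> = mev (\<lambda>c. c) (x(n := t)) p"
        by (simp add: P(2) m.hom_sum m.hom_mult m.hom_power mvar_t)
      finally show ?thesis using Suc.prems(2) by simp
    qed
    then have "q = 0" using poly_roots_finite[of q] inf by auto
    then have "Polynomial.coeff q k = 0" by simp
    then show ?thesis using that by (simp add: q_def coeff_sum if_distrib[of "\<lambda>f. f k"] coeff_monom cong: if_cong)
  qed
  then have "P k = 0" if "k \<le> d" for k using Suc.IH[OF P(1)] that by blast
  then show ?case unfolding P(2) by simp
qed

text \<open>As in Euclid's argument: over a finite field, the product of all X - a, increased by 1,
  has no root.\<close>

lemma infinite_alg_closure: "infinite (UNIV :: 'a::field alg_closure set)"
proof
  assume fin: "finite (UNIV :: 'a alg_closure set)"
  define p where "p = (\<Prod>a\<in>(UNIV :: 'a alg_closure set). [:- a, 1:]) + 1"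
  have "Polynomial.degree (\<Prod>a\<in>(UNIV :: 'a alg_closure set). [:- a, 1:]) = card (UNIV :: 'a alg_closure set)"
    by (subst degree_prod_sum_eq) auto
  moreover have "card (UNIV :: 'a alg_closure set) > 0" using fin by (simp add: card_gt_0_iff)
  ultimately have "Polynomial.degree p > 0" unfolding p_def by (subst degree_add_eq_left) auto
  then obtain x where "poly p x = 0" using alg_closed_imp_poly_has_root by blast
  then have "(\<Prod>a\<in>UNIV. x - a) + 1 = 0" by (simp add: p_def poly_prod)
  moreover have "(\<Prod>a\<in>UNIV. x - a) = 0" by (rule prod_zero[OF fin]) auto
  ultimately show False by simp
qed

lemma mpoly_eq_0_affine:
  fixes p :: "'a::field alg_closure mpoly"
  assumes p: "p \<in> mpolys n" and zero: "\<And>x. x \<in> affine_space n \<Longrightarrow> mpoly_eval p x = 0"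
  shows "p = 0"
proof (rule mpoly_eq_0I[OF infinite_alg_closure p])
  fix x :: "nat \<Rightarrow> 'a alg_closure"
  have "restrict x {..<n} \<in> affine_space n" by (auto simp: affine_space_def)
  then have "mev (\<lambda>c. c) (restrict x {..<n}) p = 0" using zero by (simp add: mpoly_eval_eq)
  then show "mev (\<lambda>c. c) x p = 0" using mev_cong[OF p, of x "restrict x {..<n}"] by simp
qed

section \<open>Function fields\<close>

lemma rota_simps:
  "carrier (ring_of_type_algebra :: 'a::ring_1 ring) = UNIV"
  "x \<otimes>\<^bsub>(ring_of_type_algebra :: 'a ring)\<^esub> y = x * y"
  "x \<oplus>\<^bsub>(ring_of_type_algebra :: 'a ring)\<^esub> y = x + y"
  "\<one>\<^bsub>(ring_of_type_algebra :: 'a ring)\<^esub> = 1"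
  "\<zero>\<^bsub>(ring_of_type_algebra :: 'a ring)\<^esub> = 0"
  by (simp_all add: ring_of_type_algebra_def)

lemma rota_uminus: "\<ominus>\<^bsub>(ring_of_type_algebra :: 'a::comm_ring_1 ring)\<^esub> x = - x"
proof -
  interpret Ring.ring "ring_of_type_algebra :: 'a ring" by (rule ring_from_type_algebra)
  have "- x \<oplus>\<^bsub>ring_of_type_algebra\<^esub> x = \<zero>\<^bsub>ring_of_type_algebra\<^esub>" by (simp add: rota_simps)
  then show ?thesis using minus_equality[of "- x" x] by (simp add: rota_simps)
qed

text \<open>
  The coordinate functions \<open>\<xi>\<close> in the field \<open>'d\<close> have the same polynomial relations over the
  base field as the coordinates on \<open>V\<close>, so that the function field of \<open>V\<close> embeds in \<open>'d\<close>.
\<close>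

locale function_field_model = kap: comm_ring_hom \<kappa>
  for \<kappa> :: "'m::Fields.field \<Rightarrow> 'd::Fields.field" +
  fixes n :: nat and V :: "(nat \<Rightarrow> 'm alg_closure) set" and \<xi> :: "nat \<Rightarrow> 'd"
  assumes relations: "p \<in> mpolys n \<Longrightarrow> p \<in> base_ideal n V \<longleftrightarrow> mev \<kappa> \<xi> p = 0"
begin

abbreviation ev :: "'m mpoly \<Rightarrow> 'd" where "ev \<equiv> mev \<kappa> \<xi>"

sublocale ev: comm_ring_hom ev
  by (rule kap.comm_ring_hom_mev)

definition denoms :: "'m mpoly set" where "denoms = mpolys n - base_ideal n V"

lemma denoms_iff: "q \<in> denoms \<longleftrightarrow> q \<in> mpolys n \<and> ev q \<noteq> 0"
  using relations by (auto simp: denoms_def)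

lemma denoms_nonzero: "q \<in> denoms \<Longrightarrow> q \<noteq> 0"
  by (auto simp: denoms_iff)

lemma denoms_mult: "p \<in> denoms \<Longrightarrow> q \<in> denoms \<Longrightarrow> p * q \<in> denoms"
  by (auto simp: denoms_iff ev.hom_mult intro: subring_mult[OF is_subring_mpolys])

lemma one_in_denoms: "1 \<in> denoms"
  by (auto simp: denoms_iff intro: subring_one[OF is_subring_mpolys])

text \<open>A fraction may also be written with numerator and denominator both vanishing at the
  generic point; the choice is therefore restricted to representations with an admissible
  denominator, among which the value is unique.\<close>

definition loc_val :: "'m mpoly fract \<Rightarrow> 'd" where
  "loc_val f = (SOME d. \<exists>p\<in>mpolys n. \<exists>q\<in>denoms. f = Fract p q \<and> d = ev p / ev q)"

lemma loc_val_Fract: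
  assumes "p \<in> mpolys n" "q \<in> denoms"
  shows "loc_val (Fract p q) = ev p / ev q"
proof -
  have "\<exists>p'\<in>mpolys n. \<exists>q'\<in>denoms. Fract p q = Fract p' q' \<and> loc_val (Fract p q) = ev p' / ev q'"
    unfolding loc_val_def
  proof (rule someI_ex)
    show "\<exists>d. \<exists>p'\<in>mpolys n. \<exists>q'\<in>denoms. Fract p q = Fract p' q' \<and> d = ev p' / ev q'"
      by (rule exI[of _ "ev p / ev q"], rule bexI[OF _ assms(1)], rule bexI[OF _ assms(2)]) simp
  qed
  then obtain p' q' where pq': "p' \<in> mpolys n" "q' \<in> denoms" "Fract p q = Fract p' q'"
    "loc_val (Fract p q) = ev p' / ev q'" by blast
  have "p * q' = p' * q" using pq'(2,3) assms denoms_nonzero by (auto simp: eq_fract)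
  then have "ev p * ev q' = ev p' * ev q" by (metis ev.hom_mult)
  then show ?thesis using pq'(2,4) assms by (simp add: denoms_iff frac_eq_eq)
qed

abbreviation loc :: "'m mpoly fract ring" where "loc \<equiv> local_ring n V"

lemma loc_carrierE:
  assumes "f \<in> carrier loc"
  obtains p q where "p \<in> mpolys n" "q \<in> denoms" "f = Fract p q"
  using assms by (auto simp: local_ring_def denoms_def)

lemma loc_carrierI: "p \<in> mpolys n \<Longrightarrow> q \<in> denoms \<Longrightarrow> Fract p q \<in> carrier loc"
  by (auto simp: local_ring_def denoms_def)

lemma loc_simps: "x \<otimes>\<^bsub>loc\<^esub> y = x * y" "x \<oplus>\<^bsub>loc\<^esub> y = x + y" "\<one>\<^bsub>loc\<^esub> = 1" "\<zero>\<^bsub>loc\<^esub> = 0"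
  by (simp_all add: local_ring_def ring_of_type_algebra_def)

lemma loc_cring: "cring loc"
proof -
  interpret R: cring "ring_of_type_algebra :: 'm mpoly fract ring" by (rule cring_from_type_algebra)
  have "subring (carrier loc) (ring_of_type_algebra :: 'm mpoly fract ring)"
  proof (rule R.subringI)
    show "carrier loc \<subseteq> carrier ring_of_type_algebra" by (simp add: rota_simps)
    have "Fract 1 1 \<in> carrier loc" by (intro loc_carrierI one_in_denoms subring_one[OF is_subring_mpolys])
    then show "\<one>\<^bsub>ring_of_type_algebra\<^esub> \<in> carrier loc" by (simp add: rota_simps One_fract_def)
  next
    fix f assume "f \<in> carrier loc"
    then obtain p q where pq: "p \<in> mpolys n" "q \<in> denoms" "f = Fract p q" by (rule loc_carrierE)
    show "\<ominus>\<^bsub>ring_of_type_algebra\<^esub> f \<in> carrier loc"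
      unfolding rota_uminus pq(3) minus_fract by (intro loc_carrierI subring_uminus[OF is_subring_mpolys] pq)
    fix g assume "g \<in> carrier loc"
    then obtain p' q' where pq': "p' \<in> mpolys n" "q' \<in> denoms" "g = Fract p' q'" by (rule loc_carrierE)
    show "f \<otimes>\<^bsub>ring_of_type_algebra\<^esub> g \<in> carrier loc"
      unfolding rota_simps pq(3) pq'(3) mult_fract by (intro loc_carrierI denoms_mult subring_mult[OF is_subring_mpolys] pq pq')
    have "f + g = Fract (p * q' + p' * q) (q * q')"
      unfolding pq(3) pq'(3) using denoms_nonzero pq pq' by (intro add_fract) auto
    moreover have "p * q' + p' * q \<in> mpolys n"
      using pq pq' denoms_iff by (intro subring_add[OF is_subring_mpolys] subring_mult[OF is_subring_mpolys]) auto
    ultimately show "f \<oplus>\<^bsub>ring_of_type_algebra\<^esub> g \<in> carrier loc"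
      unfolding rota_simps using pq pq' by (metis loc_carrierI denoms_mult)
  qed
  then have "subcring (carrier loc) (ring_of_type_algebra :: 'm mpoly fract ring)"
    by (intro R.subcringI') 
  moreover have "loc = ring_of_type_algebra\<lparr>carrier := carrier loc\<rparr>" by (simp add: local_ring_def)
  ultimately show ?thesis using R.subcring_iff by (metis rota_simps(1) subset_UNIV)
qed

lemma loc_val_hom: "loc_val \<in> Ring.ring_hom loc ring_of_type_algebra"
proof (rule ring_hom_memI)
  show "loc_val \<one>\<^bsub>loc\<^esub> = \<one>\<^bsub>ring_of_type_algebra\<^esub>"
    using loc_val_Fract[OF subring_one[OF is_subring_mpolys] one_in_denoms]
    by (simp add: rota_simps loc_simps One_fract_def)
  fix f g assume f: "f \<in> carrier loc" and g: "g \<in> carrier loc"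
  obtain p q where pq: "p \<in> mpolys n" "q \<in> denoms" "f = Fract p q" using f by (rule loc_carrierE)
  obtain p' q' where pq': "p' \<in> mpolys n" "q' \<in> denoms" "g = Fract p' q'" using g by (rule loc_carrierE)
  have nz: "ev q \<noteq> 0" "ev q' \<noteq> 0" using pq pq' denoms_iff by auto
  have vals: "loc_val f = ev p / ev q" "loc_val g = ev p' / ev q'"
    using loc_val_Fract pq pq' by auto
  have "f * g = Fract (p * p') (q * q')" by (simp add: pq pq')
  then have "loc_val (f * g) = ev (p * p') / ev (q * q')"
    by (simp add: loc_val_Fract denoms_mult pq pq' subring_mult[OF is_subring_mpolys] del: mult_fract)
  then show "loc_val (f \<otimes>\<^bsub>loc\<^esub> g) = loc_val f \<otimes>\<^bsub>ring_of_type_algebra\<^esub> loc_val g"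
    by (simp add: rota_simps loc_simps vals ev.hom_mult)
  have "f + g = Fract (p * q' + p' * q) (q * q')"
    unfolding pq(3) pq'(3) using denoms_nonzero pq pq' by (intro add_fract) auto
  moreover have "p * q' + p' * q \<in> mpolys n"
    using pq pq' denoms_iff by (intro subring_add[OF is_subring_mpolys] subring_mult[OF is_subring_mpolys]) auto
  ultimately have "loc_val (f + g) = ev (p * q' + p' * q) / ev (q * q')"
    using loc_val_Fract denoms_mult pq(2) pq'(2) by simp
  then show "loc_val (f \<oplus>\<^bsub>loc\<^esub> g) = loc_val f \<oplus>\<^bsub>ring_of_type_algebra\<^esub> loc_val g"
    using nz by (simp add: rota_simps loc_simps vals ev.hom_mult ev.hom_add add_frac_eq)
qed (simp add: rota_simps)

lemma lv: "ring_hom_ring loc (ring_of_type_algebra :: 'd ring) loc_val"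
  by (rule ring_hom_ringI2[OF cring.axioms(1)[OF loc_cring] ring_from_type_algebra loc_val_hom])

text \<open>Turns the quotient in the definition of the function field into a quotient by a kernel,
  so that the homomorphism theorem provides the embedding \<open>ff_val\<close>.\<close>

lemma kernel_loc_val: "a_kernel loc ring_of_type_algebra loc_val = local_max_ideal n V"
proof -
  have key: "Fract p q \<in> a_kernel loc ring_of_type_algebra loc_val \<longleftrightarrow> p \<in> base_ideal n V"
    if "p \<in> mpolys n" "q \<in> denoms" for p q
    using that loc_val_Fract[OF that] relations[OF that(1)] denoms_iff[of q]
    by (simp add: a_kernel_def' loc_carrierI rota_simps)
  show ?thesis
  proof (intro equalityI subsetI)
    fix f assume f: "f \<in> a_kernel loc ring_of_type_algebra loc_val"
    then have "f \<in> carrier loc" by (simp add: a_kernel_def')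
    then obtain p q where pq: "p \<in> mpolys n" "q \<in> denoms" "f = Fract p q" by (rule loc_carrierE)
    then have "p \<in> base_ideal n V" using key f by simp
    then show "f \<in> local_max_ideal n V"
      unfolding local_max_ideal_def using pq(2,3) unfolding denoms_def by blast
  next
    fix f assume "f \<in> local_max_ideal n V"
    then obtain p q where pq: "p \<in> base_ideal n V" "q \<in> denoms" "f = Fract p q"
      unfolding local_max_ideal_def denoms_def by blast
    moreover have "p \<in> mpolys n" using pq(1) by (simp add: base_ideal_def)
    ultimately show "f \<in> a_kernel loc ring_of_type_algebra loc_val" using key by simp
  qed
qed

abbreviation FF :: "'m mpoly fract set ring" where "FF \<equiv> function_field n V"

definition ff_val :: "'m mpoly fract set \<Rightarrow> 'd" where "ff_val f = the_elem (loc_val ` f)"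

lemma FF_eq: "FF = loc Quot a_kernel loc ring_of_type_algebra loc_val"
  by (simp add: function_field_def kernel_loc_val)

lemma ff_val_hom: "ff_val \<in> Ring.ring_hom FF ring_of_type_algebra"
  using ring_hom_ring.the_elem_hom[OF lv] by (simp add: FF_eq ff_val_def[abs_def])

lemma rat_fun_in_FF: "p \<in> mpolys n \<Longrightarrow> q \<in> denoms \<Longrightarrow> rat_fun n V p q \<in> carrier FF"
  unfolding rat_fun_def function_field_def FactRing_def A_RCOSETS_def'
  using loc_carrierI by auto

lemma FF_carrierE:
  assumes "f \<in> carrier FF"
  obtains p q where "p \<in> mpolys n" "q \<in> denoms" "f = rat_fun n V p q"
proof -
  obtain x where x: "x \<in> carrier loc" "f = local_max_ideal n V +>\<^bsub>loc\<^esub> x"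
    using assms ring_hom_ring.quot_mem[OF lv, of f] by (auto simp: FF_eq kernel_loc_val)
  then show ?thesis using that by (metis loc_carrierE rat_fun_def)
qed

lemma ff_val_rat_fun: "p \<in> mpolys n \<Longrightarrow> q \<in> denoms \<Longrightarrow> ff_val (rat_fun n V p q) = ev p / ev q"
  unfolding ff_val_def rat_fun_def
  using ring_hom_ring.the_elem_simp[OF lv loc_carrierI] loc_val_Fract by (simp add: kernel_loc_val)

lemma ff_val_inj: "f \<in> carrier FF \<Longrightarrow> g \<in> carrier FF \<Longrightarrow> ff_val f = ff_val g \<Longrightarrow> f = g"
  unfolding FF_eq ff_val_def by (rule ring_hom_ring.the_elem_inj[OF lv])

lemma FF_cring: "cring FF"
  unfolding FF_eq by (rule ideal.quotient_is_cring[OF ring_hom_ring.kernel_is_ideal[OF lv] loc_cring])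

text \<open>Inverses are explicit: the numerator of a nonzero class is itself an admissible
  denominator.\<close>

lemma FF_field: "Ring.field FF"
proof -
  interpret F: cring "function_field n V" by (rule FF_cring)
  have hom: "ff_val (f \<otimes>\<^bsub>FF\<^esub> g) = ff_val f * ff_val g" if "f \<in> carrier FF" "g \<in> carrier FF" for f g
    using ring_hom_mult[OF ff_val_hom that] by (simp add: rota_simps)
  have one: "ff_val \<one>\<^bsub>FF\<^esub> = 1" using ring_hom_one[OF ff_val_hom] by (simp add: rota_simps)
  have zero: "ff_val \<zero>\<^bsub>FF\<^esub> = 0"
    using ring_hom_zero[OF ff_val_hom] F.ring_axioms ring_from_type_algebra by (auto simp: rota_simps)
  have "Units FF = carrier FF - {\<zero>\<^bsub>FF\<^esub>}"
  proof (intro equalityI subsetI DiffI)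
    fix f assume f: "f \<in> Units FF"
    then show "f \<in> carrier FF" by auto
    obtain g where "g \<in> carrier FF" "g \<otimes>\<^bsub>FF\<^esub> f = \<one>\<^bsub>FF\<^esub>" using f by (auto simp: Units_def)
    then have "ff_val f \<noteq> 0" using hom[of g f] one f by auto
    then show "f \<notin> {\<zero>\<^bsub>FF\<^esub>}" using zero by auto
  next
    fix f assume "f \<in> carrier FF - {\<zero>\<^bsub>FF\<^esub>}"
    then have f: "f \<in> carrier FF" and f0: "f \<noteq> \<zero>\<^bsub>FF\<^esub>" by simp_all
    obtain p q where pq: "p \<in> mpolys n" "q \<in> denoms" "f = rat_fun n V p q" using f by (rule FF_carrierE)
    have "ff_val f \<noteq> 0"
    proof
      assume "ff_val f = 0"
      then have "f = \<zero>\<^bsub>FF\<^esub>" by (intro ff_val_inj f F.zero_closed) (simp add: zero)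
      with f0 show False by contradiction
    qed
    then have "ev p \<noteq> 0" using ff_val_rat_fun[OF pq(1,2)] pq(3) by simp
    then have p: "p \<in> denoms" using pq(1) denoms_iff by simp
    have q: "q \<in> mpolys n" "ev q \<noteq> 0" using pq(2) denoms_iff by simp_all
    define g where "g = rat_fun n V q p"
    have g: "g \<in> carrier FF" unfolding g_def by (rule rat_fun_in_FF[OF q(1) p])
    have "ff_val g = ev q / ev p" unfolding g_def by (rule ff_val_rat_fun[OF q(1) p])
    then have "ff_val (g \<otimes>\<^bsub>FF\<^esub> f) = 1"
      using hom[OF g f] ff_val_rat_fun[OF pq(1,2)] pq(3) \<open>ev p \<noteq> 0\<close> q(2) by simp
    then have gf: "g \<otimes>\<^bsub>FF\<^esub> f = \<one>\<^bsub>FF\<^esub>"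
      by (intro ff_val_inj F.m_closed g f F.one_closed) (simp add: one)
    then have "f \<otimes>\<^bsub>FF\<^esub> g = \<one>\<^bsub>FF\<^esub>" using F.m_comm[OF g f] by simp
    then show "f \<in> Units FF" unfolding Units_def using f g gf by blast
  qed
  then show ?thesis by (rule F.cring_fieldI)
qed

lemma field_to_type: "field_to_type FF ff_val"
  by (rule field_to_type.intro[OF FF_field field_to_type_axioms.intro[OF ff_val_hom]])

lemma const_fun_in_FF: "const_fun n V c \<in> carrier FF"
  unfolding const_fun_def by (intro rat_fun_in_FF const_mpoly_in_mpolys one_in_denoms)

lemma ff_val_const_fun: "ff_val (const_fun n V c) = \<kappa> c"
  unfolding const_fun_def by (simp add: ff_val_rat_fun const_mpoly_in_mpolys one_in_denoms)

lemma ff_val_mpoly_eval_fun: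
  assumes g: "g \<in> mpolys r" and t: "\<And>i. i < r \<Longrightarrow> t i \<in> carrier FF"
  shows "ff_val (mpoly_eval_fun n V g t) = mev \<kappa> (\<lambda>i. ff_val (t i)) g"
proof -
  interpret ff: field_to_type "function_field n V" ff_val by (rule field_to_type)
  have ti: "t i \<in> carrier FF" if "m \<in> Poly_Mapping.keys g" "i \<in> Poly_Mapping.keys m" for m i
    using g t that by (auto simp: mpolys_def)
  have mon: "finprod FF (\<lambda>i. t i [^]\<^bsub>FF\<^esub> Poly_Mapping.lookup m i) (Poly_Mapping.keys m) \<in> carrier FF"
    if "m \<in> Poly_Mapping.keys g" for m
    using ti[OF that] by (intro ff.finprod_closed) auto
  have "ff_val (mpoly_eval_fun n V g t) = (\<Sum>m\<in>Poly_Mapping.keys g. ff_val (const_fun n V (Poly_Mapping.lookup g m) \<otimes>\<^bsub>FF\<^esub>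
               finprod FF (\<lambda>i. t i [^]\<^bsub>FF\<^esub> Poly_Mapping.lookup m i) (Poly_Mapping.keys m)))"
    unfolding mpoly_eval_fun_def Let_def using mon const_fun_in_FF by (intro ff.h_finsum) auto
  also have "\<dots> = (\<Sum>m\<in>Poly_Mapping.keys g. \<kappa> (Poly_Mapping.lookup g m) * (\<Prod>i\<in>Poly_Mapping.keys m. ff_val (t i) ^ Poly_Mapping.lookup m i))"
  proof (intro sum.cong refl)
    fix m assume m: "m \<in> Poly_Mapping.keys g"
    have "ff_val (finprod FF (\<lambda>i. t i [^]\<^bsub>FF\<^esub> Poly_Mapping.lookup m i) (Poly_Mapping.keys m)) =
      (\<Prod>i\<in>Poly_Mapping.keys m. ff_val (t i) ^ Poly_Mapping.lookup m i)"
      using ti[OF m] by (subst ff.h_finprod) auto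
    then show "ff_val (const_fun n V (Poly_Mapping.lookup g m) \<otimes>\<^bsub>FF\<^esub>
               finprod FF (\<lambda>i. t i [^]\<^bsub>FF\<^esub> Poly_Mapping.lookup m i) (Poly_Mapping.keys m)) =
      \<kappa> (Poly_Mapping.lookup g m) * (\<Prod>i\<in>Poly_Mapping.keys m. ff_val (t i) ^ Poly_Mapping.lookup m i)"
      using const_fun_in_FF mon[OF m] by (simp add: ff_val_const_fun)
  qed
  finally show ?thesis by (simp add: mev_def mono_eval_def)
qed

end

text \<open>The cleared polynomial on the left does not depend on \<kappa>' and x, so the same one
  can be evaluated at the generic point and at the points of V.\<close>

lemma mev_clear_denoms:
  fixes \<kappa>' :: "'a::comm_ring_1 \<Rightarrow> 'd::Fields.field"
  assumes \<kappa>': "comm_ring_hom \<kappa>'" and g: "g \<in> mpolys r" and nz: "\<And>i. i < r \<Longrightarrow> mev \<kappa>' x (q i) \<noteq> 0"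
    and N: "\<And>m i. m \<in> Poly_Mapping.keys g \<Longrightarrow> i < r \<Longrightarrow> Poly_Mapping.lookup m i \<le> N"
  shows "mev \<kappa>' x (\<Sum>m\<in>Poly_Mapping.keys g. const_mpoly (Poly_Mapping.lookup g m) *
      (\<Prod>i<r. p i ^ Poly_Mapping.lookup m i * q i ^ (N - Poly_Mapping.lookup m i))) =
    mev \<kappa>' x (\<Prod>i<r. q i ^ N) * mev \<kappa>' (\<lambda>i. mev \<kappa>' x (p i) / mev \<kappa>' x (q i)) g"
proof -
  interpret k: comm_ring_hom \<kappa>' by fact
  interpret e: comm_ring_hom "mev \<kappa>' x" by (rule k.comm_ring_hom_mev)
  have "mono_eval (\<lambda>i. mev \<kappa>' x (p i) / mev \<kappa>' x (q i)) m * (\<Prod>i<r. mev \<kappa>' x (q i) ^ N) =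
      (\<Prod>i<r. mev \<kappa>' x (p i) ^ Poly_Mapping.lookup m i * mev \<kappa>' x (q i) ^ (N - Poly_Mapping.lookup m i))"
    if m: "m \<in> Poly_Mapping.keys g" for m
  proof -
    have "Poly_Mapping.keys m \<subseteq> {..<r}" using g m by (simp add: mpolys_def)
    then have "mono_eval (\<lambda>i. mev \<kappa>' x (p i) / mev \<kappa>' x (q i)) m * (\<Prod>i<r. mev \<kappa>' x (q i) ^ N) =
       (\<Prod>i<r. (mev \<kappa>' x (p i) / mev \<kappa>' x (q i)) ^ Poly_Mapping.lookup m i * mev \<kappa>' x (q i) ^ N)"
      by (simp add: mono_eval_superset[of "{..<r}"] prod.distrib)
    also have "\<dots> = (\<Prod>i<r. mev \<kappa>' x (p i) ^ Poly_Mapping.lookup m i * mev \<kappa>' x (q i) ^ (N - Poly_Mapping.lookup m i))"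
    proof (intro prod.cong refl)
      fix i assume "i \<in> {..<r}"
      then have "i < r" by simp
      then show "(mev \<kappa>' x (p i) / mev \<kappa>' x (q i)) ^ Poly_Mapping.lookup m i * mev \<kappa>' x (q i) ^ N =
        mev \<kappa>' x (p i) ^ Poly_Mapping.lookup m i * mev \<kappa>' x (q i) ^ (N - Poly_Mapping.lookup m i)"
        using nz N[OF m] by (simp add: power_divide power_diff)
    qed
    finally show ?thesis .
  qed
  note key = this
  have "mev \<kappa>' x (\<Sum>m\<in>Poly_Mapping.keys g. const_mpoly (Poly_Mapping.lookup g m) *
      (\<Prod>i<r. p i ^ Poly_Mapping.lookup m i * q i ^ (N - Poly_Mapping.lookup m i))) =
    (\<Sum>m\<in>Poly_Mapping.keys g. \<kappa>' (Poly_Mapping.lookup g m) *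
      (\<Prod>i<r. mev \<kappa>' x (p i) ^ Poly_Mapping.lookup m i * mev \<kappa>' x (q i) ^ (N - Poly_Mapping.lookup m i)))"
    by (simp add: e.hom_sum e.hom_mult e.hom_prod e.hom_power)
  also have "\<dots> = (\<Sum>m\<in>Poly_Mapping.keys g. \<kappa>' (Poly_Mapping.lookup g m) *
      (mono_eval (\<lambda>i. mev \<kappa>' x (p i) / mev \<kappa>' x (q i)) m * (\<Prod>i<r. mev \<kappa>' x (q i) ^ N)))"
    by (intro sum.cong refl) (simp add: key)
  also have "\<dots> = (\<Prod>i<r. mev \<kappa>' x (q i) ^ N) * mev \<kappa>' (\<lambda>i. mev \<kappa>' x (p i) / mev \<kappa>' x (q i)) g"
    by (simp add: mev_def[of \<kappa>' "\<lambda>i. mev \<kappa>' x (p i) / mev \<kappa>' x (q i)"] sum_distrib_left mult_ac)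
  finally show ?thesis by (simp add: e.hom_prod e.hom_power)
qed

lemma base_ideal_vanish: "p \<in> base_ideal n V \<Longrightarrow> a \<in> V \<Longrightarrow> mev to_ac a p = 0"
  by (auto simp: base_ideal_def vanishing_ideal_def mpoly_eval_lift)

context function_field_model
begin

text \<open>A function may be defined at a point through a representation other than p/q, even where
  q vanishes. The cross-multiplied equation survives this, since the difference of the cross
  products lies in the ideal of V.\<close>

lemma rat_fun_value_rat_fun:
  assumes p: "p \<in> mpolys n" and q: "q \<in> denoms" and val: "rat_fun_value n V (rat_fun n V p q) a y"
  shows "a \<in> V \<and> mev to_ac a p = y * mev to_ac a q"
proof -
  obtain p' q' where a: "a \<in> V" and pq': "p' \<in> mpolys n" "q' \<in> mpolys n" "rat_fun n V p q = rat_fun n V p' q'"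
    "mev to_ac a q' \<noteq> 0" "y = mev to_ac a p' / mev to_ac a q'"
    using val by (auto simp: rat_fun_value_def mpoly_eval_lift)
  have q': "q' \<in> denoms" using pq'(2,4) base_ideal_vanish[OF _ a] by (auto simp: denoms_def)
  have qm: "q \<in> mpolys n" using q denoms_iff by simp
  have "ev p / ev q = ev p' / ev q'" using ff_val_rat_fun p q pq'(1,3) q' by metis
  then have "ev p * ev q' = ev p' * ev q" using q q' denoms_iff by (simp add: frac_eq_eq)
  then have "ev (p * q' - p' * q) = 0" by (simp add: ev.hom_minus ev.hom_mult)
  moreover have "p * q' - p' * q \<in> mpolys n"
    by (intro subring_diff[OF is_subring_mpolys] subring_mult[OF is_subring_mpolys] p qm pq')
  ultimately have "p * q' - p' * q \<in> base_ideal n V" using relations by blast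
  then have vanish: "mev to_ac a (p * q' - p' * q) = 0" using base_ideal_vanish a by blast
  interpret t: comm_ring_hom "mev to_ac a :: 'm mpoly \<Rightarrow> _" by (rule comm_ring_hom.comm_ring_hom_mev[OF to_ac_hom])
  have "mev to_ac a p * mev to_ac a q' = mev to_ac a p' * mev to_ac a q"
    using vanish by (simp add: t.hom_minus t.hom_mult)
  then have "mev to_ac a p = mev to_ac a p' * mev to_ac a q / mev to_ac a q'"
    using pq'(4) by (simp add: nonzero_eq_divide_eq)
  then show ?thesis using a pq'(5) by simp
qed

text \<open>
  A dominating map has algebraically independent components, so the dimension of \<open>V\<close> need not be
  computed separately.
\<close>

theorem PAC_overD:
  fixes p q :: "nat \<Rightarrow> 'm mpoly"
  assumes PAC: "PAC_over R" and V: "abs_irreducible_variety n V"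
    and p: "\<And>i. i < r \<Longrightarrow> p i \<in> mpolys n" and q: "\<And>i. i < r \<Longrightarrow> q i \<in> denoms"
    and g: "g \<in> mpolys r" "g \<noteq> 0"
    and dense: "\<And>y. y \<in> affine_space r \<Longrightarrow> mpoly_eval g y \<noteq> 0 \<Longrightarrow>
      \<exists>a\<in>V. \<forall>i<r. mev to_ac a (q i) \<noteq> 0 \<and> mev to_ac a (p i) = y i * mev to_ac a (q i)"
    and sep: "\<And>E i. is_subfield E \<Longrightarrow> range \<kappa> \<subseteq> E \<Longrightarrow> (\<And>i. i < r \<Longrightarrow> ev (p i) / ev (q i) \<in> E) \<Longrightarrow>
      i < n \<Longrightarrow> \<xi> i \<in> sepgen E"
  shows "\<exists>a\<in>V. (\<forall>i<n. a i \<in> range to_ac) \<and>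
    (\<forall>i<r. \<exists>y\<in>R. mev to_ac a (p i) = to_ac y * mev to_ac a (q i))"
proof -
  interpret ff: field_to_type "function_field n V" ff_val by (rule field_to_type)
  define \<phi> where "\<phi> i = rat_fun n V (p i) (q i)" for i
  have \<phi>: "\<phi> i \<in> carrier FF" if "i < r" for i
    unfolding \<phi>_def using that by (intro rat_fun_in_FF p q)
  have val_\<phi>: "ff_val (\<phi> i) = ev (p i) / ev (q i)" if "i < r" for i
    unfolding \<phi>_def using that by (intro ff_val_rat_fun p q)
  have qm: "q i \<in> mpolys n" if "i < r" for i using q[OF that] denoms_iff by simp
  have map_value: "map_value n V r \<phi> a y"
    if "a \<in> V" "y \<in> affine_space r" "\<And>i. i < r \<Longrightarrow> mev to_ac a (q i) \<noteq> 0 \<and> mev to_ac a (p i) = y i * mev to_ac a (q i)" for a y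
    unfolding map_value_def rat_fun_value_def mpoly_eval_lift
  proof (intro conjI allI impI that(1,2))
    fix i assume i: "i < r"
    show "\<exists>p'\<in>mpolys n. \<exists>q'\<in>mpolys n. \<phi> i = rat_fun n V p' q' \<and> mev to_ac a q' \<noteq> 0 \<and> y i = mev to_ac a p' / mev to_ac a q'"
      using that(3)[OF i] by (intro bexI[OF _ p[OF i]] bexI[OF _ qm[OF i]]) (simp add: \<phi>_def)
  qed
  have rat: "rational_map n V r \<phi>" using \<phi> by (auto simp: rational_map_def)
  have dom: "dominating n V r \<phi>"
    unfolding dominating_def zariski_dense_def
  proof (intro allI impI)
    fix A assume A: "zariski_closed r A" and sub: "{y. \<exists>a. map_value n V r \<phi> a y} \<subseteq> A"
    obtain S where S: "S \<subseteq> mpolys r" "A = zero_locus r S" using A by (auto simp: zariski_closed_def)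
    have S0: "s = 0" if s: "s \<in> S" for s
    proof -
      interpret i: comm_ring_hom "mev (\<lambda>c. c) y :: 'm alg_closure mpoly \<Rightarrow> _" for y by (rule comm_ring_hom.comm_ring_hom_mev[OF id_hom])
      \<comment> \<open>Every y with g(y) nonzero is a value of the map, so s vanishes there, and
        the product vanishes everywhere.\<close>
      have "s * g = 0"
      proof (rule mpoly_eq_0_affine)
        show "s * g \<in> mpolys r" using s S(1) g(1) subring_mult[OF is_subring_mpolys] by blast
        fix y :: "nat \<Rightarrow> 'm alg_closure" assume y: "y \<in> affine_space r"
        show "mpoly_eval (s * g) y = 0"
        proof (cases "mpoly_eval g y = 0")
          case True
          then show ?thesis by (simp add: mpoly_eval_eq i.hom_mult)
        next
          case False
          then obtain a where "a \<in> V" "\<forall>i<r. mev to_ac a (q i) \<noteq> 0 \<and> mev to_ac a (p i) = y i * mev to_ac a (q i)"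
            using dense[OF y] by blast
          then have "map_value n V r \<phi> a y" using map_value y by blast
          then have "y \<in> A" using sub by blast
          then have "mpoly_eval s y = 0" using s S(2) by (simp add: zero_locus_def)
          then show ?thesis by (simp add: mpoly_eval_eq i.hom_mult)
        qed
      qed
      then show ?thesis using g(2) by simp
    qed
    have "mpoly_eval s y = 0" if "s \<in> S" for s y using S0[OF that] by (simp add: mpoly_eval_def)
    then show "A = affine_space r"
      unfolding S(2) zero_locus_def by auto
  qed
  define E where "E = generated_over_base n V r \<phi>"
  have gens: "range (const_fun n V) \<union> \<phi> ` {..<r} \<subseteq> carrier FF" using \<phi> const_fun_in_FF by auto
  have E: "subfield E FF"
    unfolding E_def generated_over_base_def by (rule ff.generate_field_is_subfield[OF gens])
  have Egen: "range (const_fun n V) \<union> \<phi> ` {..<r} \<subseteq> E"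
    unfolding E_def generated_over_base_def by (auto intro: generate_field.incl)
  note sfE = ff.is_subfield_image[OF E]
  have \<kappa>E: "\<kappa> c \<in> ff_val ` E" for c using Egen ff_val_const_fun[of c] by (metis image_eqI Un_subset_iff range_subsetD)
  have \<phi>E: "ev (p i) / ev (q i) \<in> ff_val ` E" if "i < r" for i
    using Egen val_\<phi>[OF that] that by (metis image_eqI Un_subset_iff image_subset_iff lessThan_iff)
  have \<xi>: "\<xi> i \<in> sepgen (ff_val ` E)" if "i < n" for i
    by (rule sep[OF sfE _ _ that]) (use \<kappa>E \<phi>E in auto)
  note sg = is_subfield_sepgen[OF sfE]
  \<comment> \<open>Every function is a quotient of polynomials in the coordinates, so their
    separability carries over to the whole function field.\<close>
  have ev_sep: "ev w \<in> sepgen (ff_val ` E)" if "w \<in> mpolys n" for w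
    by (rule mev_in_subring[OF is_subfield_imp_subring[OF sg] _ _ that]) (auto intro: \<xi> sepgen_base \<kappa>E)
  have sepE: "separable_over FF E f" if f: "f \<in> carrier FF" for f
  proof -
    obtain u w where uw: "u \<in> mpolys n" "w \<in> denoms" "f = rat_fun n V u w" using f by (rule FF_carrierE)
    have "ff_val f \<in> sepgen (ff_val ` E)"
      unfolding uw(3) ff_val_rat_fun[OF uw(1,2)]
      using uw denoms_iff by (intro subfield_divide[OF sg] ev_sep) auto
    then show ?thesis using ff.separable_over_iff[OF E f] sep_over_sepgen[OF sfE] by blast
  qed
  have separable: "separable_map n V r \<phi>"
    unfolding separable_map_def separable_extension_def using sepE by (simp add: E_def)
  have indep: "alg_independent n V r \<phi>"
    unfolding alg_independent_def
  proof (intro ballI impI)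
    fix w assume w: "w \<in> mpolys r" and "mpoly_eval_fun n V w \<phi> = \<zero>\<^bsub>FF\<^esub>"
    then have "mev \<kappa> (\<lambda>i. ff_val (\<phi> i)) w = 0" using ff_val_mpoly_eval_fun[of w r \<phi>, OF w \<phi>] by simp
    also have "mev \<kappa> (\<lambda>i. ff_val (\<phi> i)) w = mev \<kappa> (\<lambda>i. ev (p i) / ev (q i)) w"
      by (rule mev_cong[OF w]) (rule val_\<phi>)
    finally have w0: "mev \<kappa> (\<lambda>i. ev (p i) / ev (q i)) w = 0" .
    define N where "N = Max (insert 0 ((\<lambda>(m, i). Poly_Mapping.lookup m i) ` (Poly_Mapping.keys w \<times> {..<r})))"
    have N: "Poly_Mapping.lookup m i \<le> N" if "m \<in> Poly_Mapping.keys w" "i < r" for m i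
      unfolding N_def using that by (intro Max_ge) (auto intro!: image_eqI[of _ _ "(m, i)"])
    define P where "P = (\<Sum>m\<in>Poly_Mapping.keys w. const_mpoly (Poly_Mapping.lookup w m) *
      (\<Prod>i<r. p i ^ Poly_Mapping.lookup m i * q i ^ (N - Poly_Mapping.lookup m i)))"
    have evq: "ev (q i) \<noteq> 0" if "i < r" for i using q[OF that] denoms_iff by simp
    have "ev P = ev (\<Prod>i<r. q i ^ N) * mev \<kappa> (\<lambda>i. ev (p i) / ev (q i)) w"
      unfolding P_def by (rule mev_clear_denoms[where q = q, OF kap.comm_ring_hom_axioms w]) (fact evq, fact N)
    then have "ev P = 0" unfolding w0 by simp
    moreover have "P \<in> mpolys n"
      unfolding P_def by (intro subring_sum[OF is_subring_mpolys] subring_mult[OF is_subring_mpolys]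
        subring_prod[OF is_subring_mpolys] subring_power[OF is_subring_mpolys] const_mpoly_in_mpolys p qm) auto
    \<comment> \<open>A relation among the components has become, after clearing denominators, a
      polynomial vanishing on V; evaluating it at preimages of y makes w vanish wherever g does
      not.\<close>
    ultimately have P: "P \<in> base_ideal n V" using relations by blast
    interpret i: comm_ring_hom "mev (\<lambda>c. c) y :: 'm alg_closure mpoly \<Rightarrow> _" for y by (rule comm_ring_hom.comm_ring_hom_mev[OF id_hom])
    have "lift_mpoly w * g = 0"
    proof (rule mpoly_eq_0_affine)
      show "lift_mpoly w * g \<in> mpolys r"
        using w g(1) by (intro subring_mult[OF is_subring_mpolys]) (simp_all add: lift_mpoly_in_mpolys)
      fix y :: "nat \<Rightarrow> 'm alg_closure" assume y: "y \<in> affine_space r"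
      show "mpoly_eval (lift_mpoly w * g) y = 0"
      proof (cases "mpoly_eval g y = 0")
        case True
        then show ?thesis by (simp add: mpoly_eval_eq i.hom_mult)
      next
        case False
        then obtain a where a: "a \<in> V" "\<And>i. i < r \<Longrightarrow> mev to_ac a (q i) \<noteq> 0" "\<And>i. i < r \<Longrightarrow> mev to_ac a (p i) = y i * mev to_ac a (q i)"
          using dense[OF y] by blast
        interpret t: comm_ring_hom "mev to_ac a :: 'm mpoly \<Rightarrow> _" by (rule comm_ring_hom.comm_ring_hom_mev[OF to_ac_hom])
        have "mev to_ac a (\<Prod>i<r. q i ^ N) * mev to_ac (\<lambda>i. mev to_ac a (p i) / mev to_ac a (q i)) w = mev to_ac a P"
          unfolding P_def by (rule mev_clear_denoms[where q = q, OF to_ac_hom w, symmetric]) (fact a(2), fact N)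
        also have "\<dots> = 0" using base_ideal_vanish[OF P a(1)] .
        finally have "mev to_ac a (\<Prod>i<r. q i ^ N) = 0 \<or> mev to_ac (\<lambda>i. mev to_ac a (p i) / mev to_ac a (q i)) w = 0" by simp
        moreover have "mev to_ac a (\<Prod>i<r. q i ^ N) \<noteq> 0" using a(2) by (simp add: t.hom_prod t.hom_power)
        moreover have "mev to_ac (\<lambda>i. mev to_ac a (p i) / mev to_ac a (q i)) w = mev to_ac y w"
          by (rule mev_cong[OF w]) (use a(2,3) in auto)
        ultimately have "mev to_ac y w = 0" by simp
        then show ?thesis by (simp add: mpoly_eval_eq i.hom_mult mev_lift)
      qed
    qed
    then have "lift_mpoly w = 0" using g(2) by simp
    then show "w = 0" by (simp add: lift_mpoly_eq_0_iff)
  qed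
  have "has_dimension n V r"
    unfolding has_dimension_def
  proof (intro bexI[of _ \<phi>] conjI ballI indep)
    show "\<phi> \<in> {..<r} \<rightarrow> carrier FF" using \<phi> by auto
    fix f assume "f \<in> carrier FF"
    then show "\<not> ring.transcendental FF (generated_over_base n V r \<phi>) f"
      using sepE unfolding E_def separable_over_def by blast
  qed
  with PAC V rat dom separable obtain a y where ay: "a \<in> rational_points n V" "map_value n V r \<phi> a y"
    "\<And>i. i < r \<Longrightarrow> y i \<in> to_ac ` R"
    unfolding PAC_over_def by blast
  have "\<exists>z\<in>R. mev to_ac a (p i) = to_ac z * mev to_ac a (q i)" if i: "i < r" for i
  proof -
    have "rat_fun_value n V (rat_fun n V (p i) (q i)) a (y i)"
      using ay(2) i by (simp add: map_value_def \<phi>_def)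
    from rat_fun_value_rat_fun[OF p[OF i] q[OF i] this] ay(3)[OF i] show ?thesis by auto
  qed
  then show ?thesis using ay(1) by (auto simp: rational_points_def)
qed

end

section \<open>Affine space\<close>

lemma cring_mpoly_ring: "cring (mpoly_ring n :: 'a::comm_ring_1 mpoly ring)"
proof -
  interpret R: cring "ring_of_type_algebra :: 'a mpoly ring" by (rule cring_from_type_algebra)
  note sr = is_subring_mpolys[where 'a = 'a, of n]
  have "subring (mpolys n) (ring_of_type_algebra :: 'a mpoly ring)"
    by (rule R.subringI)
      (use subring_one[OF sr] subring_uminus[OF sr] subring_mult[OF sr] subring_add[OF sr] in \<open>auto simp: rota_simps rota_uminus\<close>)
  then have "subcring (mpolys n) (ring_of_type_algebra :: 'a mpoly ring)" by (rule R.subcringI')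
  then show ?thesis using R.subcring_iff[of "mpolys n"] by (simp add: mpoly_ring_def rota_simps)
qed

lemma mpoly_ring_simps:
  "carrier (mpoly_ring n) = mpolys n" "x \<otimes>\<^bsub>mpoly_ring n\<^esub> y = x * y" "\<zero>\<^bsub>mpoly_ring n\<^esub> = 0"
  by (simp_all add: mpoly_ring_def ring_of_type_algebra_def)

lemma vanishing_ideal_affine_space:
  "vanishing_ideal n (affine_space n :: (nat \<Rightarrow> 'a::Fields.field alg_closure) set) = {0}"
proof -
  have "p = 0" if "p \<in> vanishing_ideal n (affine_space n)" for p :: "'a alg_closure mpoly"
    using that by (intro mpoly_eq_0_affine[of p n]) (auto simp: vanishing_ideal_def)
  moreover have "(0 :: 'a alg_closure mpoly) \<in> vanishing_ideal n (affine_space n)"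
    using subring_zero[OF is_subring_mpolys] by (auto simp: vanishing_ideal_def mpoly_eval_def)
  ultimately show ?thesis by blast
qed

lemma base_ideal_affine_space: "base_ideal n (affine_space n) = {0}"
proof -
  have "base_ideal n (affine_space n) = {p \<in> mpolys n. lift_mpoly p = 0}"
    unfolding base_ideal_def vanishing_ideal_affine_space by simp
  then show ?thesis using subring_zero[OF is_subring_mpolys] by (auto simp: lift_mpoly_eq_0_iff)
qed

text \<open>A point of V outside A and one outside B are each detected by a polynomial, and the
  product of the two polynomials vanishes on V.\<close>

lemma zariski_irreducibleI:
  fixes V :: "(nat \<Rightarrow> 'a::idom) set"
  assumes ne: "V \<noteq> {}"
    and prime: "\<And>p q. p \<in> mpolys n \<Longrightarrow> q \<in> mpolys n \<Longrightarrow> (\<And>x. x \<in> V \<Longrightarrow> mpoly_eval p x * mpoly_eval q x = 0) \<Longrightarrow>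
      (\<forall>x\<in>V. mpoly_eval p x = 0) \<or> (\<forall>x\<in>V. mpoly_eval q x = 0)"
    and V: "V \<subseteq> affine_space n"
  shows "zariski_irreducible n V"
  unfolding zariski_irreducible_def
proof (intro conjI ne allI impI)
  fix A B assume A: "zariski_closed n A" and B: "zariski_closed n B" and sub: "V \<subseteq> A \<union> B"
  obtain S where S: "S \<subseteq> mpolys n" "A = zero_locus n S" using A by (auto simp: zariski_closed_def)
  obtain T where T: "T \<subseteq> mpolys n" "B = zero_locus n T" using B by (auto simp: zariski_closed_def)
  show "V \<subseteq> A \<or> V \<subseteq> B"
  proof (rule ccontr)
    assume "\<not> (V \<subseteq> A \<or> V \<subseteq> B)"
    then obtain a b where ab: "a \<in> V" "a \<notin> A" "b \<in> V" "b \<notin> B" by blast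
    have "a \<in> affine_space n" "b \<in> affine_space n" using ab V by auto
    with ab obtain p q where pq: "p \<in> S" "mpoly_eval p a \<noteq> 0" "q \<in> T" "mpoly_eval q b \<noteq> 0"
      unfolding S(2) T(2) zero_locus_def by auto
    have "mpoly_eval p x * mpoly_eval q x = 0" if "x \<in> V" for x
    proof -
      have "x \<in> A \<or> x \<in> B" using that sub by blast
      then show ?thesis using pq(1,3) unfolding S(2) T(2) zero_locus_def by auto
    qed
    with prime[of p q] pq S(1) T(1) ab show False by blast
  qed
qed

lemma abs_irreducible_affine_space:
  "abs_irreducible_variety n (affine_space n :: (nat \<Rightarrow> 'm::Fields.field alg_closure) set)"
  unfolding abs_irreducible_variety_def
proof (intro conjI)
  have "(affine_space n :: (nat \<Rightarrow> 'm alg_closure) set) = zero_locus n {}" by (simp add: zero_locus_def)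
  then show "zariski_closed n (affine_space n :: (nat \<Rightarrow> 'm alg_closure) set)"
    unfolding zariski_closed_def by blast
  show "zariski_irreducible n (affine_space n :: (nat \<Rightarrow> 'm alg_closure) set)"
  proof (rule zariski_irreducibleI)
    have "(\<lambda>i. if i < n then 0 else undefined) \<in> (affine_space n :: (nat \<Rightarrow> 'm alg_closure) set)"
      by (auto simp: affine_space_def split: if_splits)
    then show "affine_space n \<noteq> ({} :: (nat \<Rightarrow> 'm alg_closure) set)" by blast
    fix p q :: "'m alg_closure mpoly"
    assume pq: "p \<in> mpolys n" "q \<in> mpolys n"
      and zero: "\<And>x. x \<in> affine_space n \<Longrightarrow> mpoly_eval p x * mpoly_eval q x = 0"
    have "p * q = 0"
    proof (rule mpoly_eq_0_affine)
      show "p * q \<in> mpolys n" by (rule subring_mult[OF is_subring_mpolys pq])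
      show "mpoly_eval (p * q) x = 0" if "x \<in> affine_space n" for x
        using zero[OF that] by (simp add: mpoly_eval_eq comm_ring_hom.mev_mult[OF id_hom] mult_eq_0_iff)
    qed
    then have "p = 0 \<or> q = 0" by simp
    moreover have "mpoly_eval 0 x = 0" for x :: "nat \<Rightarrow> 'm alg_closure" by (simp add: mpoly_eval_def)
    ultimately show "(\<forall>x\<in>affine_space n. mpoly_eval p x = 0) \<or> (\<forall>x\<in>affine_space n. mpoly_eval q x = 0)"
      by blast
  qed simp
  interpret cring "mpoly_ring n :: 'm alg_closure mpoly ring" by (rule cring_mpoly_ring)
  have "lift_mpoly (0 :: 'm mpoly) = 0" by (simp add: lift_mpoly_eq_0_iff)
  then show "defined_over_base n (affine_space n :: (nat \<Rightarrow> 'm alg_closure) set)"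
    unfolding defined_over_base_def base_ideal_affine_space vanishing_ideal_affine_space
    using genideal_zero by (simp add: mpoly_ring_simps)
qed

text \<open>The function field of affine space is modelled inside the rational functions over the
  algebraic closure rather than over M, so that the roots \<theta> i are available as
  constants.\<close>

definition gen_const :: "'c::idom \<Rightarrow> 'c mpoly fract" where
  "gen_const c = Fract (const_mpoly c) 1"

definition gen_var :: "nat \<Rightarrow> 'c::idom mpoly fract" where
  "gen_var i = Fract (mvar i) 1"

lemma Fract_one_hom: "comm_ring_hom (\<lambda>x. Fract x 1)"
  by standard (auto simp: Zero_fract_def One_fract_def)

lemma Fract_one_eq_iff: "Fract x 1 = Fract y 1 \<longleftrightarrow> x = y"
  by (simp add: eq_fract)

lemma gen_const_hom: "comm_ring_hom gen_const"
  unfolding gen_const_def[abs_def] by (rule comm_ring_hom_compose[OF Fract_one_hom const_mpoly_hom])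

lemma gen_const_to_ac_hom: "comm_ring_hom (\<lambda>c. gen_const (to_ac c))"
  by (rule comm_ring_hom_compose[OF gen_const_hom to_ac_hom])

lemma mev_generic: "mev (\<lambda>c. gen_const (to_ac c)) gen_var p = Fract (lift_mpoly p) 1"
proof -
  have "Fract (lift_mpoly p) 1 = mev (\<lambda>c. Fract (const_mpoly (to_ac c)) 1) (\<lambda>i. Fract (mvar i) 1) p"
    unfolding lift_mpoly_eq_mev
    by (rule comm_ring_hom.mev_cong_hom[OF comm_ring_hom_compose[OF const_mpoly_hom to_ac_hom] Fract_one_hom])
  then show ?thesis by (simp add: gen_const_def gen_var_def[abs_def])
qed

lemma function_field_model_affine:
  "function_field_model (\<lambda>c. gen_const (to_ac c)) n (affine_space n) gen_var"
proof (intro function_field_model.intro gen_const_to_ac_hom function_field_model_axioms.intro)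
  fix p :: "'a mpoly" assume "p \<in> mpolys n"
  have "Fract (lift_mpoly p) 1 = 0 \<longleftrightarrow> p = 0"
    unfolding Zero_fract_def Fract_one_eq_iff by (rule lift_mpoly_eq_0_iff)
  then show "p \<in> base_ideal n (affine_space n) \<longleftrightarrow> mev (\<lambda>c. gen_const (to_ac c)) gen_var p = 0"
    by (simp add: base_ideal_affine_space mev_generic)
qed

lemma mev_to_ac_rational: "mev to_ac (\<lambda>i. to_ac (b i)) p = to_ac (mev (\<lambda>c. c) b p)"
  using comm_ring_hom.mev_cong_hom[OF id_hom to_ac_hom, of b p] by simp

text \<open>On affine space the ideal is 0, so every nonzero polynomial is an admissible
  denominator, and the rational point pulls back along \<open>to_ac\<close> to a tuple in M.\<close>

theorem PAC_over_affineD: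
  fixes p q :: "nat \<Rightarrow> 'm::Fields.field mpoly"
  assumes PAC: "PAC_over R"
    and p: "\<And>i. i < r \<Longrightarrow> p i \<in> mpolys n" and q: "\<And>i. i < r \<Longrightarrow> q i \<in> mpolys n" "\<And>i. i < r \<Longrightarrow> q i \<noteq> 0"
    and g: "g \<in> mpolys r" "g \<noteq> 0"
    and dense: "\<And>y. y \<in> affine_space r \<Longrightarrow> mpoly_eval g y \<noteq> 0 \<Longrightarrow>
      \<exists>a. \<forall>i<r. mev to_ac a (q i) \<noteq> 0 \<and> mev to_ac a (p i) = y i * mev to_ac a (q i)"
    and sep: "\<And>E i. is_subfield E \<Longrightarrow> range (\<lambda>c. gen_const (to_ac c)) \<subseteq> E \<Longrightarrow>
      (\<And>i. i < r \<Longrightarrow> Fract (lift_mpoly (p i)) (lift_mpoly (q i)) \<in> E) \<Longrightarrow> i < n \<Longrightarrow> gen_var i \<in> sepgen E"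
  shows "\<exists>b. \<forall>i<r. \<exists>y\<in>R. mev (\<lambda>c. c) b (p i) = y * mev (\<lambda>c. c) b (q i)"
proof -
  interpret function_field_model "\<lambda>c::'m. gen_const (to_ac c)" n "affine_space n" gen_var
    by (rule function_field_model_affine)
  have q': "q i \<in> denoms" if "i < r" for i
    using q that by (simp add: denoms_def base_ideal_affine_space)
  have dense': "\<exists>a\<in>affine_space n. \<forall>i<r. mev to_ac a (q i) \<noteq> 0 \<and> mev to_ac a (p i) = y i * mev to_ac a (q i)"
    if y: "y \<in> affine_space r" "mpoly_eval g y \<noteq> 0" for y
  proof -
    obtain a where a: "\<And>i. i < r \<Longrightarrow> mev to_ac a (q i) \<noteq> 0 \<and> mev to_ac a (p i) = y i * mev to_ac a (q i)"
      using dense[OF y] by blast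
    have "restrict a {..<n} \<in> affine_space n" by (auto simp: affine_space_def)
    moreover have "mev to_ac (restrict a {..<n}) w = mev to_ac a w" if "w \<in> mpolys n" for w :: "'m mpoly"
      by (rule mev_cong[OF that]) simp
    ultimately show ?thesis using a p q(1) by (intro bexI[of _ "restrict a {..<n}"]) auto
  qed
  have Fract_div: "Fract x 1 / Fract y 1 = Fract x y" for x y :: "'m alg_closure mpoly" by simp
  have sep': "gen_var i \<in> sepgen E" if "is_subfield E" "range (\<lambda>c. gen_const (to_ac c)) \<subseteq> E"
    "\<And>i. i < r \<Longrightarrow> mev (\<lambda>c. gen_const (to_ac c)) gen_var (p i) / mev (\<lambda>c. gen_const (to_ac c)) gen_var (q i) \<in> E" "i < n" for E i
    by (rule sep[OF that(1,2) _ that(4)]) (use that(3) in \<open>simp only: mev_generic Fract_div\<close>)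
  from PAC_overD[OF PAC abs_irreducible_affine_space p q' g dense' sep']
  obtain a where a: "\<And>i. i < n \<Longrightarrow> a i \<in> range to_ac" "\<And>i. i < r \<Longrightarrow> \<exists>y\<in>R. mev to_ac a (p i) = to_ac y * mev to_ac a (q i)"
    by blast
  define b where "b i = of_ac (a i)" for i
  have ab: "mev to_ac a w = to_ac (mev (\<lambda>c. c) b w)" if "w \<in> mpolys n" for w
  proof -
    have "mev to_ac a w = mev to_ac (\<lambda>i. to_ac (b i)) w"
      by (rule mev_cong[OF that]) (use a(1) in \<open>simp add: b_def to_ac_of_ac\<close>)
    then show ?thesis by (simp only: mev_to_ac_rational)
  qed
  have "\<exists>y\<in>R. mev (\<lambda>c. c) b (p i) = y * mev (\<lambda>c. c) b (q i)" if "i < r" for i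
    using a(2)[OF that] ab[OF p[OF that]] ab[OF q(1)[OF that]] by (metis to_ac_mult to_ac_eq_iff)
  then show ?thesis by blast
qed

section \<open>Minimal polynomials and conjugates\<close>

definition min_poly_over :: "'a::Fields.field set \<Rightarrow> 'a \<Rightarrow> 'a poly \<Rightarrow> bool" where
  "min_poly_over E x m \<longleftrightarrow> m \<in> polys_over E \<and> Polynomial.lead_coeff m = 1 \<and> poly m x = 0 \<and>
     (\<forall>p\<in>polys_over E. poly p x = 0 \<longrightarrow> (\<exists>q\<in>polys_over E. p = m * q))"

lemma min_poly_over_dvd:
  "min_poly_over E x m \<Longrightarrow> p \<in> polys_over E \<Longrightarrow> poly p x = 0 \<Longrightarrow> \<exists>q\<in>polys_over E. p = m * q"
  unfolding min_poly_over_def by blast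

lemma min_poly_over_degree:
  assumes "min_poly_over E x m" "p \<in> polys_over E" "p \<noteq> 0" "poly p x = 0"
  shows "Polynomial.degree m \<le> Polynomial.degree p"
  using assms by (auto simp: min_poly_over_def degree_mult_eq)

lemma min_poly_over_nonzero: "min_poly_over E x m \<Longrightarrow> m \<noteq> 0"
  by (auto simp: min_poly_over_def)

lemma min_poly_over_ex:
  fixes E :: "'a::Fields.field set"
  assumes E: "is_subfield E" and p: "p \<in> polys_over E" "p \<noteq> 0" "poly p x = 0"
  shows "\<exists>m. min_poly_over E x m"
proof -
  note sr = is_subfield_imp_subring[OF E]
  note psr = is_subring_polys_over[OF sr]
  obtain m0 where m0: "m0 \<in> polys_over E" "m0 \<noteq> 0" "poly m0 x = 0"
    and mmin: "\<And>q. q \<in> polys_over E \<Longrightarrow> q \<noteq> 0 \<Longrightarrow> poly q x = 0 \<Longrightarrow> Polynomial.degree m0 \<le> Polynomial.degree q"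
    using ex_has_least_nat[of "\<lambda>m. m \<in> polys_over E \<and> m \<noteq> 0 \<and> poly m x = 0" p Polynomial.degree] p by metis
  define c where "c = Polynomial.lead_coeff m0"
  have c: "c \<noteq> 0" "c \<in> E" using m0 by (auto simp: c_def polys_over_def)
  define m where "m = smult (inverse c) m0"
  have mE: "m \<in> polys_over E" unfolding m_def by (rule polys_over_smult[OF sr subfield_inverse[OF E c(2)] m0(1)])
  have "Polynomial.lead_coeff m = 1" using c by (simp add: m_def c_def)
  moreover have "poly m x = 0" using m0 by (simp add: m_def)
  moreover have "\<exists>q\<in>polys_over E. p = m * q" if p: "p \<in> polys_over E" "poly p x = 0" for p
  proof -
    have m_nz: "m \<noteq> 0" using c m0 by (simp add: m_def)
    obtain s r where sr': "s \<in> polys_over E" "r \<in> polys_over E" "p = s * m + r" "r = 0 \<or> Polynomial.degree r < Polynomial.degree m"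
      using polys_over_division[OF E p(1) mE m_nz] by blast
    have "poly r x = 0" using sr'(3) p(2) \<open>poly m x = 0\<close> by simp
    then have "r = 0" using mmin[OF sr'(2)] sr'(4) c by (force simp: m_def)
    then show ?thesis using sr' by (auto simp: mult.commute)
  qed
  ultimately show ?thesis using mE unfolding min_poly_over_def by blast
qed

text \<open>The minimal polynomial of y divides m. One of the two factors vanishes at x and
  therefore has full degree; this leaves a constant cofactor, which is 1 by comparing leading
  coefficients.\<close>

lemma min_poly_over_conjugate:
  fixes E :: "'a::Fields.field set"
  assumes E: "is_subfield E" and m: "min_poly_over E x m" and y: "poly m y = 0"
  shows "min_poly_over E y m"
proof -
  have mE: "m \<in> polys_over E" using m by (simp add: min_poly_over_def)
  obtain m' where m': "min_poly_over E y m'" using min_poly_over_ex[OF E mE min_poly_over_nonzero[OF m] y] by blast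
  then obtain q where q: "q \<in> polys_over E" "m = m' * q" using min_poly_over_dvd[OF m' mE y] by blast
  have nz: "m' \<noteq> 0" "q \<noteq> 0" using q(2) min_poly_over_nonzero[OF m] by auto
  have deg: "Polynomial.degree m = Polynomial.degree m' + Polynomial.degree q" using nz by (simp add: q(2) degree_mult_eq)
  have "poly m' x = 0 \<or> poly q x = 0" using m q(2) by (auto simp: min_poly_over_def)
  then have "Polynomial.degree m \<le> Polynomial.degree m' \<or> Polynomial.degree m \<le> Polynomial.degree q"
    using min_poly_over_degree[OF m] nz q(1) m' by (auto simp: min_poly_over_def)
  moreover have "Polynomial.degree m' \<noteq> 0"
  proof
    assume "Polynomial.degree m' = 0"
    then obtain c where "m' = [:c:]" by (rule degree_eq_zeroE)
    then show False using m' nz by (auto simp: min_poly_over_def)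
  qed
  ultimately have "Polynomial.degree q = 0" using deg by linarith
  then obtain c where c: "q = [:c:]" by (rule degree_eq_zeroE)
  have "Polynomial.lead_coeff m = Polynomial.lead_coeff m' * Polynomial.lead_coeff q" by (simp only: q(2) lead_coeff_mult)
  then have "c = 1" using m m' c by (auto simp: min_poly_over_def)
  then show ?thesis using m' q(2) c by simp
qed

text \<open>If c(\<alpha>) is nonzero, a Bezout identity between m and c, evaluated at \<alpha>,
  exhibits its inverse as a polynomial in \<alpha>.\<close>

lemma is_subfield_adjoin:
  fixes K :: "'a::Fields.field set"
  assumes K: "is_subfield K" and m: "min_poly_over K \<alpha> m"
  shows "is_subfield ((\<lambda>c. poly c \<alpha>) ` polys_over K)" (is "is_subfield ?L")
  unfolding is_subfield_def
proof (intro conjI ballI)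
  note sr = is_subfield_imp_subring[OF K]
  note psr = is_subring_polys_over[OF sr]
  show "1 \<in> ?L" using subring_one[OF psr] by (metis image_eqI poly_1)
  fix u assume uL: "u \<in> ?L"
  then obtain c where c: "c \<in> polys_over K" "u = poly c \<alpha>" by auto
  show "inverse u \<in> ?L"
  proof (cases "u = 0")
    case True
    then show ?thesis using uL by simp
  next
    case False
    have mK: "m \<in> polys_over K" "poly m \<alpha> = 0" using m by (auto simp: min_poly_over_def)
    with polys_over_bezout[OF K _ min_poly_over_nonzero[OF m] _ min_poly_over_degree[OF m] c(1)] False c(2)
    obtain a b where ab: "b \<in> polys_over K" "a * m + b * c = 1" by blast
    have "poly (a * m + b * c) \<alpha> = 1" by (simp only: ab(2) poly_1)
    then have "poly b \<alpha> * u = 1" using mK(2) c(2) by simp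
    then have "inverse u = poly b \<alpha>" by (metis inverse_unique mult.commute)
    then show ?thesis using ab(1) by auto
  qed
  fix v assume "v \<in> ?L"
  then obtain d where d: "d \<in> polys_over K" "v = poly d \<alpha>" by auto
  have "u - v = poly (c - d) \<alpha>" "u * v = poly (c * d) \<alpha>" using c d by auto
  then show "u - v \<in> ?L" "u * v \<in> ?L"
    using subring_diff[OF psr c(1) d(1)] subring_mult[OF psr c(1) d(1)] by blast+
qed

lemma field_to_type_id: "field_to_type (ring_of_type_algebra :: 'a::Fields.field ring) (\<lambda>x. x)"
  by (intro field_to_type.intro field_to_type_axioms.intro field_from_type_algebra)
    (auto simp: Ring.ring_hom_def ring_of_type_algebra_def)

lemma subfield_ring_of_type: "subfield K (ring_of_type_algebra :: 'a::Fields.field ring) \<Longrightarrow> is_subfield K"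
  using field_to_type.is_subfield_image[OF field_to_type_id, of K] by simp

context
  fixes K :: "'a::Fields.field set"
  assumes galois: "galois_extension (ring_of_type_algebra :: 'a ring) K"
begin

lemma galois_subfield: "is_subfield K"
  using galois by (auto simp: galois_extension_def intro: subfield_ring_of_type)

text \<open>Normality enters in the form in which it is applied to greatest common divisors: not
  only the minimal polynomial but each of its nonconstant factors over the large field has a root
  there, as divisors of split polynomials split.\<close>

lemma galois_min_poly:
  "\<exists>m. min_poly_over K x m \<and> poly (pderiv m) x \<noteq> 0 \<and>
    (\<forall>g. g dvd m \<longrightarrow> Polynomial.degree g > 0 \<longrightarrow> (\<exists>y. poly g y = 0))"
proof -
  let ?F = "ring_of_type_algebra :: 'a ring"
  interpret F: field_to_type "?F" "\<lambda>x. x" by (rule field_to_type_id)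
  have K: "subfield K ?F" using galois by (simp add: galois_extension_def)
  have x: "x \<in> carrier ?F" by (simp add: ring_of_type_algebra_def)
  have sep: "separable_over ?F K x" using galois x by (auto simp: galois_extension_def separable_extension_def)
  then have alg: "\<not> F.transcendental K x" by (simp add: separable_over_def)
  define m where "m = F.min_poly K x"
  have mp: "min_poly_over K x m"
    unfolding min_poly_over_def m_def
    using F.min_poly_in[OF K x alg] F.min_poly_monic[OF K x alg] F.min_poly_root[OF K x alg] F.min_poly_dvd[OF K x alg]
    by simp
  have "sep_over K x" using F.separable_over_iff[OF K x] sep by simp
  then obtain p where p: "p \<in> polys_over K" "poly p x = 0" "poly (pderiv p) x \<noteq> 0" by (auto simp: sep_over_def)
  then obtain q where "p = m * q" using min_poly_over_dvd[OF mp] by blast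
  then have "poly (pderiv m) x \<noteq> 0" using p mp by (auto simp: pderiv_mult min_poly_over_def)
  moreover have "\<exists>y. poly g y = 0" if g: "g dvd m" "Polynomial.degree g > 0" for g
  proof -
    have U: "subfield (carrier ?F) ?F" by (rule F.carrier_is_subfield)
    have surj: "\<exists>l\<in>carrier (poly_ring ?F). F.poly_of l = w" for w
      using F.poly_of_surj[OF U, of w] by (simp add: polys_over_def ring_of_type_algebra_def)
    have I: "F.Irr K x \<in> carrier (poly_ring ?F)"
      using F.Irr_props(1)[OF K x alg] F.carrier_polynomial_shell[OF subfieldE(1)[OF K]] by blast
    have split: "F.splitted (F.Irr K x)"
      using galois x F.Irr_props[OF K x alg] by (auto simp: galois_extension_def normal_extension_def)
    obtain l where l: "l \<in> carrier (poly_ring ?F)" "F.poly_of l = g" using surj by blast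
    obtain k where k: "k \<in> carrier (poly_ring ?F)" "m = g * F.poly_of k" using g(1) surj by (metis dvdE)
    have "F.poly_of (F.Irr K x) = F.poly_of (l \<otimes>\<^bsub>poly_ring ?F\<^esub> k)"
      using F.poly_of_mult[OF U l(1) k(1)] l(2) k(2) by (simp add: m_def F.min_poly_def[OF K x alg])
    interpret UP: Ring.ring "poly_ring ?F" using F.univ_poly_is_ring[OF F.carrier_is_subring] .
    have "F.Irr K x = l \<otimes>\<^bsub>poly_ring ?F\<^esub> k"
      by (rule F.poly_of_inj[OF U I UP.m_closed[OF l(1) k(1)]]) fact
    then have "l pdivides\<^bsub>?F\<^esub> F.Irr K x" using k(1) by (auto simp: pdivides_def factor_def)
    then have "F.splitted l" using F.pdivides_imp_splitted[OF l(1) I F.Irr_nonempty[OF K x alg] split] by blast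
    then have "size (F.roots l) > 0" using g(2) l F.degree_poly_of[OF U l(1)] by (simp add: F.splitted_def)
    then obtain y where "y \<in># F.roots l" by (metis multiset_nonemptyE size_empty less_irrefl)
    then have "F.is_root l y" using F.roots_mem_iff_is_root[OF l(1)] by blast
    then have y: "y \<in> carrier ?F" "F.eval l y = \<zero>\<^bsub>?F\<^esub>" unfolding F.is_root_def by simp_all
    have "poly g y = F.eval l y"
      using F.poly_poly_of[OF F.poly_ring_set[OF U l(1)] y(1)] unfolding l(2) .
    also have "\<dots> = 0" unfolding y(2) by (simp only: ring_of_type_algebra_def ring.simps)
    finally show ?thesis by blast
  qed
  ultimately show ?thesis using mp by blast
qed

text \<open>Write m = (X - \<alpha>) g. As \<alpha> is outside K, g is not constant and has a root;
  this differs from \<alpha> because g(\<alpha>) = m'(\<alpha>) is nonzero.\<close>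

lemma galois_conjugate:
  assumes "\<alpha> \<notin> K"
  shows "\<exists>m \<alpha>'. min_poly_over K \<alpha> m \<and> poly m \<alpha>' = 0 \<and> \<alpha>' \<noteq> \<alpha>"
proof -
  from galois_min_poly[of \<alpha>] obtain m where m: "min_poly_over K \<alpha> m" "poly (pderiv m) \<alpha> \<noteq> 0"
    and root: "\<forall>g. g dvd m \<longrightarrow> Polynomial.degree g > 0 \<longrightarrow> (\<exists>y. poly g y = 0)"
    by (elim exE conjE)
  have m0: "poly m \<alpha> = 0" and mK: "m \<in> polys_over K" and lc: "Polynomial.lead_coeff m = 1"
    using m(1) by (auto simp: min_poly_over_def)
  then obtain g where g: "m = [:- \<alpha>, 1:] * g" by (metis poly_eq_0_iff_dvd dvdE)
  have "g \<noteq> 0" using g min_poly_over_nonzero[OF m(1)] by auto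
  have "Polynomial.degree g > 0"
  proof (rule ccontr)
    assume "\<not> Polynomial.degree g > 0"
    then obtain c where c: "g = [:c:]" by (metis degree_eq_zeroE neq0_conv)
    have "c = 1" using lc unfolding g lead_coeff_mult by (simp add: c)
    then have "Polynomial.coeff m 0 = - \<alpha>" using g c by simp
    then have "- \<alpha> \<in> K" using mK by (metis polys_over_def mem_Collect_eq)
    then show False using assms subring_uminus[OF is_subfield_imp_subring[OF galois_subfield]] by fastforce
  qed
  moreover have "g dvd m" unfolding g by (rule dvd_triv_right)
  ultimately obtain y where y: "poly g y = 0" using root by blast
  have "poly (pderiv m) \<alpha> = poly g \<alpha>" unfolding g pderiv_mult by (simp add: pderiv_pCons)
  then have "y \<noteq> \<alpha>" using m(2) y by auto
  moreover have "poly m y = 0" using y g by simp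
  ultimately show ?thesis using m(1) by blast
qed

text \<open>
  Replacing \<open>\<alpha>'\<close> by its conjugate \<open>\<alpha>\<close> in a polynomial relation satisfied by \<open>x\<close> gives a relation
  satisfied by some conjugate of \<open>x\<close>. No automorphism is needed: the polynomials \<open>G(\<alpha>, X)\<close> with
  \<open>G(\<alpha>', x) = 0\<close> form a proper ideal that contains the minimal polynomial of \<open>x\<close>.
\<close>

lemma galois_transfer_root:
  assumes m\<alpha>: "min_poly_over K \<alpha> m\<alpha>" and \<alpha>': "poly m\<alpha> \<alpha>' = 0"
    and U: "U \<in> polys_over K" and W: "W \<in> polys_over K"
    and x: "poly (U + smult \<alpha>' W) x = 0"
  shows "\<exists>y. poly (U + smult \<alpha> W) y = 0"
proof -
  note K = galois_subfield
  note sr = is_subfield_imp_subring[OF K]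
  note psr = is_subring_polys_over[OF sr]
  note ppsr = is_subring_polys_over[OF psr]
  note m\<alpha>' = min_poly_over_conjugate[OF K m\<alpha> \<alpha>']
  \<comment> \<open>An element of K[T][X] is read as G(T, X), and \<open>e t\<close> substitutes t
    for the inner variable T.\<close>
  define e where "e t = map_poly (\<lambda>c. poly c t)" for t :: 'a
  interpret p: comm_ring_hom "\<lambda>c. poly c t" for t :: 'a by standard auto
  interpret e: map_poly_comm_ring_hom "\<lambda>c. poly c t" for t :: 'a ..
  have e_coeff: "Polynomial.coeff (e t G) i = poly (Polynomial.coeff G i) t" for t G i
    by (simp add: e_def coeff_map_poly)
  have e_diff: "e t (G - H) = e t G - e t H" and e_mult: "e t (G * H) = e t G * e t H" for t G H
    by (simp_all add: e_def e.hom_minus e.hom_mult)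
  define I where "I = {G \<in> polys_over (polys_over K). poly (e \<alpha>' G) x = 0}"
  have I_mult: "S * G \<in> I" if "S \<in> polys_over (polys_over K)" "G \<in> I" for S G
    using that subring_mult[OF ppsr] by (auto simp: I_def e_mult)
  have I_diff: "G - H \<in> I" if "G \<in> I" "H \<in> I" for G H
    using that subring_diff[OF ppsr] by (auto simp: I_def e_diff)
  define L where "L = (\<lambda>c. poly c \<alpha>) ` polys_over K"
  have L: "is_subfield L" unfolding L_def by (rule is_subfield_adjoin[OF K m\<alpha>])
  have e_L: "e \<alpha> G \<in> polys_over L" if "G \<in> polys_over (polys_over K)" for G
    using that by (auto simp: polys_over_def e_coeff L_def)
  \<comment> \<open>Every polynomial over L = K(\<alpha>) is G(\<alpha>, X) for some G over K, so
    the image of I under \<open>e \<alpha>\<close> is closed under multiplication by L[X].\<close>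
  have lift: "\<exists>S\<in>polys_over (polys_over K). e \<alpha> S = s" if "s \<in> polys_over L" for s
  proof -
    define f where "f u = (if u = 0 then 0 else SOME c. c \<in> polys_over K \<and> poly c \<alpha> = u)" for u
    have f: "f u \<in> polys_over K \<and> poly (f u) \<alpha> = u" if "u \<in> L" for u
    proof (cases "u = 0")
      case False
      have "\<exists>c. c \<in> polys_over K \<and> poly c \<alpha> = u" using that by (auto simp: L_def)
      from someI_ex[OF this] show ?thesis using False by (simp add: f_def)
    qed (simp add: f_def subring_zero[OF psr])
    have f0: "f 0 = 0" by (simp add: f_def)
    have sL: "Polynomial.coeff s i \<in> L" for i using that by (simp add: polys_over_def)
    have "map_poly f s \<in> polys_over (polys_over K)"
      unfolding polys_over_def[of "polys_over K"] mem_Collect_eq by (simp only: coeff_map_poly[where f = f, OF f0]) (use f sL in blast)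
    moreover have "e \<alpha> (map_poly f s) = s"
      by (rule poly_eqI) (simp only: e_coeff coeff_map_poly[where f = f, OF f0], use f sL in blast)
    ultimately show ?thesis by blast
  qed
  from galois_min_poly[of x] obtain mx where mx: "min_poly_over K x mx"
    and root: "\<forall>g. g dvd mx \<longrightarrow> Polynomial.degree g > 0 \<longrightarrow> (\<exists>y. poly g y = 0)"
    by (elim exE conjE)
  define emb where "emb w = map_poly (\<lambda>c. [:c:]) w" for w :: "'a poly"
  have emb_e: "e t (emb w) = w" for t w
    by (rule poly_eqI) (simp add: e_coeff emb_def coeff_map_poly)
  have emb_in: "emb w \<in> polys_over (polys_over K)" if "w \<in> polys_over K" for w
    using that polys_over_const[OF sr] by (auto simp: polys_over_def[of "polys_over K"] emb_def coeff_map_poly) (auto simp: polys_over_def)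
  have mxI: "emb mx \<in> I" using mx emb_in[of mx] by (auto simp: I_def emb_e min_poly_over_def)
  define H where "H = emb U - (- (smult [:0, 1:] (emb W)))"
  have e_H: "e t H = U + smult t W" for t
    by (rule poly_eqI) (simp add: e_coeff H_def emb_def coeff_map_poly mult.commute)
  have HI: "H \<in> I"
    unfolding I_def H_def[symmetric] mem_Collect_eq e_H
    using x unfolding H_def
    by (intro conjI subring_diff[OF ppsr] subring_uminus[OF ppsr] emb_in U W polys_over_smult[OF psr] polys_over_X[OF sr])
  \<comment> \<open>A nonzero member of least degree divides all others, in particular the minimal
    polynomial of x and U + \<alpha> W; hence it has a root, and this root is the required
    y.\<close>
  obtain d where d: "d \<in> e \<alpha> ` I" "d \<noteq> 0"
    and dmin: "\<And>g. g \<in> e \<alpha> ` I \<Longrightarrow> g \<noteq> 0 \<Longrightarrow> Polynomial.degree d \<le> Polynomial.degree g"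
  proof -
    have "mx \<in> e \<alpha> ` I \<and> mx \<noteq> 0" using mxI emb_e[of \<alpha> mx] min_poly_over_nonzero[OF mx] by force
    then show ?thesis
      using ex_has_least_nat[of "\<lambda>g. g \<in> e \<alpha> ` I \<and> g \<noteq> 0" mx Polynomial.degree] that by metis
  qed
  obtain D where D: "D \<in> I" "d = e \<alpha> D" using d(1) by blast
  have dL: "d \<in> polys_over L" using D e_L by (auto simp: I_def)
  have d_dvd: "d dvd e \<alpha> G" if G: "G \<in> I" for G
  proof -
    have "e \<alpha> G \<in> polys_over L" using G e_L by (auto simp: I_def)
    from polys_over_division[OF L this dL d(2)] obtain s r where
      sr': "s \<in> polys_over L" "e \<alpha> G = s * d + r" "r = 0 \<or> Polynomial.degree r < Polynomial.degree d" by blast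
    obtain S where S: "S \<in> polys_over (polys_over K)" "e \<alpha> S = s" using lift sr'(1) by blast
    have "r = e \<alpha> (G - S * D)" using sr'(2) S(2) D(2) by (simp add: e_diff e_mult)
    then have "r \<in> e \<alpha> ` I" using I_diff[OF G I_mult[OF S(1) D(1)]] by blast
    then have "r = 0" using dmin sr'(3) by force
    then show ?thesis using sr'(2) by simp
  qed
  \<comment> \<open>If d were constant, some G in I would satisfy G(\<alpha>, X) = 1.
    Coefficientwise, G - 1 is then divisible by the minimal polynomial of \<alpha>, so G(\<alpha>',
    X) = 1 as well, contrary to G(\<alpha>', x) = 0.\<close>
  have "Polynomial.degree d > 0"
  proof (rule ccontr)
    assume "\<not> Polynomial.degree d > 0"
    then obtain c where c: "d = [:c:]" by (metis degree_eq_zeroE neq0_conv)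
    have "c \<noteq> 0" using d(2) c by auto
    have "Polynomial.coeff d 0 \<in> L" using dL unfolding polys_over_def by blast
    then have "c \<in> L" using c by simp
    then have "[:inverse c:] \<in> polys_over L"
      by (intro polys_over_const[OF is_subfield_imp_subring[OF L]] subfield_inverse[OF L])
    then obtain S where S: "S \<in> polys_over (polys_over K)" "e \<alpha> S = [:inverse c:]" using lift by blast
    define G where "G = S * D"
    have G: "G \<in> I" unfolding G_def by (rule I_mult[OF S(1) D(1)])
    have "e \<alpha> G = 1" using S(2) D(2)[symmetric] c \<open>c \<noteq> 0\<close> by (simp add: G_def e_mult)
    have "e \<alpha>' G = 1"
    proof (rule poly_eqI)
      fix i
      define q where "q = Polynomial.coeff G i - [:Polynomial.coeff (1 :: 'a poly) i:]"
      have GK: "Polynomial.coeff G i \<in> polys_over K" using G unfolding I_def polys_over_def[of "polys_over K"] by blast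
      have "Polynomial.coeff (1 :: 'a poly) i \<in> K"
        using subring_one[OF sr] subring_zero[OF sr] by (simp add: Polynomial.coeff_1)
      then have qK: "q \<in> polys_over K" unfolding q_def by (intro subring_diff[OF psr] GK polys_over_const[OF sr])
      have "poly q \<alpha> = Polynomial.coeff (e \<alpha> G) i - Polynomial.coeff 1 i" by (simp add: q_def e_coeff)
      also have "\<dots> = 0" using \<open>e \<alpha> G = 1\<close> by simp
      finally obtain k where "q = m\<alpha> * k" using min_poly_over_dvd[OF m\<alpha> qK] by blast
      then have "poly q \<alpha>' = 0" using \<alpha>' by simp
      then show "Polynomial.coeff (e \<alpha>' G) i = Polynomial.coeff 1 i" by (simp add: q_def e_coeff)
    qed
    then show False using G by (simp add: I_def)
  qed
  moreover have "d dvd mx" using d_dvd[OF mxI] by (simp add: emb_e)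
  ultimately obtain y where y: "poly d y = 0" using root by blast
  have "d dvd U + smult \<alpha> W" using d_dvd[OF HI] by (simp add: e_H)
  then have "poly (U + smult \<alpha> W) y = 0" using y by (metis dvdE poly_mult mult_zero_left)
  then show ?thesis by blast
qed

end

section \<open>A generic polynomial without rational roots\<close>

text \<open>The vector b is an eigenvector. It will be the powers of a root of f, and later a
  spanning family of a finite extension, so it is only required to be nonzero somewhere.\<close>

lemma char_poly_rootI:
  fixes A :: "'a::Fields.field mat"
  assumes A: "A \<in> carrier_mat n n" and b: "k0 < n" "b k0 \<noteq> 0"
    and eig: "\<And>k. k < n \<Longrightarrow> (\<Sum>l<n. A $$ (k, l) * b l) = w * b k"
  shows "poly (char_poly A) w = 0"
proof -
  have "eigenvector A (vec n b) w"
    unfolding eigenvector_def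
  proof (intro conjI)
    show "vec n b \<in> carrier_vec (dim_row A)" using A by simp
    show "vec n b \<noteq> 0\<^sub>v (dim_row A)"
    proof
      assume "vec n b = 0\<^sub>v (dim_row A)"
      then have "vec n b $ k0 = 0\<^sub>v (dim_row A) $ k0" by simp
      then show False using A b by simp
    qed
    show "A *\<^sub>v vec n b = w \<cdot>\<^sub>v vec n b"
      using A eig by (intro eq_vecI) (auto simp: scalar_prod_def lessThan_atLeast0)
  qed
  then show ?thesis using eigenvalue_root_char_poly[OF A] by (auto simp: eigenvalue_def)
qed

text \<open>Immediate from the Leibniz formula for the determinant of the characteristic
  matrix.\<close>

lemma char_poly_polys_over:
  fixes A :: "'a::comm_ring_1 mat"
  assumes R: "is_subring R" and A: "A \<in> carrier_mat n n" and AR: "\<And>k l. k < n \<Longrightarrow> l < n \<Longrightarrow> A $$ (k, l) \<in> R"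
  shows "char_poly A \<in> polys_over R"
proof -
  note pR = is_subring_polys_over[OF R]
  have sgn: "(signof p :: 'a poly) \<in> polys_over R" for p
    using subring_one[OF pR] subring_uminus[OF pR] by (cases p rule: sign_cases) auto
  show ?thesis
    unfolding char_poly_def det_def'[OF char_poly_matrix_closed[OF A]]
  proof (intro subring_sum[OF pR] subring_mult[OF pR] subring_prod[OF pR] sgn)
    fix p i assume p: "p \<in> {p. p permutes {0..<n}}" and i: "i \<in> {0..<n}"
    then have "p i < n" by (auto dest: permutes_in_image)
    moreover have "(if i = p i then [:0, 1:] else 0) \<in> polys_over R"
      using polys_over_X[OF R] subring_zero[OF pR] by auto
    ultimately show "char_poly_matrix A $$ (i, p i) \<in> polys_over R"
      using A i AR[of i "p i"] polys_over_const[OF R] subring_uminus[OF R] subring_add[OF pR] polys_over_X[OF R] subring_zero[OF pR]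
        polys_over_pCons[OF R] subring_one[OF pR]
      by (auto simp: char_poly_matrix_def)
  qed
qed

text \<open>Two monic polynomials of degree d differ by one of smaller degree, which cannot have d
  zeros unless it is 0; for d = 0 both are 1.\<close>

lemma monic_eq_prod_roots:
  fixes p :: "'a::Fields.field poly"
  assumes p: "Polynomial.lead_coeff p = 1" "Polynomial.degree p = d"
    and inj: "inj_on w {..<d}" and roots: "\<And>i. i < d \<Longrightarrow> poly p (w i) = 0"
  shows "p = (\<Prod>i<d. [:- w i, 1:])"
proof (rule ccontr)
  let ?q = "\<Prod>i<d. [:- w i, 1:]"
  assume "p \<noteq> ?q"
  then have nz: "p - ?q \<noteq> 0" by simp
  have degq: "Polynomial.degree ?q = d" by (subst degree_prod_sum_eq) auto
  have lcq: "Polynomial.lead_coeff ?q = 1" by (subst lead_coeff_prod) simp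
  have "Polynomial.degree (p - ?q) \<le> d" using p(2) degq by (metis degree_diff_le order_refl)
  moreover have "Polynomial.coeff (p - ?q) d = 0" using p lcq degq by simp
  ultimately have deg: "Polynomial.degree (p - ?q) < d \<or> d = 0"
    using nz by (metis leading_coeff_0_iff le_neq_implies_less)
  have "w ` {..<d} \<subseteq> {x. poly (p - ?q) x = 0}"
  proof
    fix x assume "x \<in> w ` {..<d}"
    then obtain i where i: "i < d" "x = w i" by auto
    have "poly ?q x = 0" using i by (simp add: poly_prod) (auto intro!: prod_zero)
    then show "x \<in> {x. poly (p - ?q) x = 0}" using roots i by simp
  qed
  then have "card (w ` {..<d}) \<le> card {x. poly (p - ?q) x = 0}"
    using poly_roots_finite[OF nz] by (intro card_mono) auto
  also have "\<dots> \<le> Polynomial.degree (p - ?q)" by (rule poly_roots_degree[OF nz])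
  finally have "d \<le> Polynomial.degree (p - ?q)" using inj by (simp add: card_image)
  with deg have "d = 0" by simp
  then have "Polynomial.degree p = 0" "p \<noteq> 1" using p nz by auto
  then show False using p by (metis degree_eq_zeroE one_pCons coeff_pCons_0 degree_pCons_0)
qed

lemma poly_eq_of_roots:
  fixes p q :: "'a::Fields.field poly"
  assumes inj: "inj_on \<theta> {..<d}" and deg: "Polynomial.degree p < d" "Polynomial.degree q < d"
    and eq: "\<And>i. i < d \<Longrightarrow> poly p (\<theta> i) = poly q (\<theta> i)"
  shows "p = q"
proof (rule ccontr)
  assume "p \<noteq> q"
  then have nz: "p - q \<noteq> 0" by simp
  have "\<theta> ` {..<d} \<subseteq> {x. poly (p - q) x = 0}" using eq by auto
  then have "card (\<theta> ` {..<d}) \<le> card {x. poly (p - q) x = 0}"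
    using poly_roots_finite[OF nz] by (intro card_mono) auto
  also have "\<dots> \<le> Polynomial.degree (p - q)" by (rule poly_roots_degree[OF nz])
  also have "\<dots> < d" by (rule degree_diff_less[OF deg])
  finally show False using inj by (simp add: card_image)
qed

definition poly_of_fun :: "nat \<Rightarrow> (nat \<Rightarrow> 'a::comm_ring_1) \<Rightarrow> 'a poly" where
  "poly_of_fun d z = (\<Sum>j<d. Polynomial.monom (z j) j)"

lemma coeff_poly_of_fun: "Polynomial.coeff (poly_of_fun d z) j = (if j < d then z j else 0)"
  by (simp add: poly_of_fun_def coeff_sum Polynomial.coeff_monom if_distrib cong: if_cong)

lemma degree_poly_of_fun: "d > 0 \<Longrightarrow> Polynomial.degree (poly_of_fun d z) < d"
  by (intro le_less_trans[OF degree_le[of "d - 1"]]) (auto simp: coeff_poly_of_fun)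

lemma poly_poly_of_fun: "poly (poly_of_fun d z) x = (\<Sum>j<d. z j * x ^ j)"
  by (simp add: poly_of_fun_def poly_sum poly_monom)

text \<open>Lagrange interpolation, with attention to where the coefficients lie: in every subfield
  that contains the nodes and the values.\<close>

lemma interpolation:
  fixes \<theta> w :: "nat \<Rightarrow> 'a::Fields.field"
  assumes inj: "inj_on \<theta> {..<d}" and d: "d > 0" and S: "is_subfield S"
    and \<theta>: "\<And>i. i < d \<Longrightarrow> \<theta> i \<in> S" and w: "\<And>i. i < d \<Longrightarrow> w i \<in> S"
  shows "\<exists>z. (\<forall>j. z j \<in> S) \<and> (\<forall>i<d. (\<Sum>j<d. z j * \<theta> i ^ j) = w i)"
proof -
  note sr = is_subfield_imp_subring[OF S]
  note psr = is_subring_polys_over[OF sr]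
  define L where "L i = (\<Prod>k\<in>{..<d} - {i}. [:- \<theta> k, 1:])" for i
  define p where "p = (\<Sum>i<d. smult (w i / poly (L i) (\<theta> i)) (L i))"
  have LS: "L i \<in> polys_over S" for i
    unfolding L_def by (intro subring_prod[OF psr] polys_over_pCons[OF sr] subring_uminus[OF sr] \<theta> subring_zero[OF psr] subring_one[OF sr]) auto
  have pS: "p \<in> polys_over S"
    unfolding p_def by (intro subring_sum[OF psr] polys_over_smult[OF sr] subfield_divide[OF S] poly_in_subring[OF sr] LS \<theta> w) auto
  have L0: "poly (L i) (\<theta> k) = 0" if "k < d" "k \<noteq> i" for i k
    unfolding L_def poly_prod using that by (intro prod_zero) auto
  have Li: "poly (L i) (\<theta> i) \<noteq> 0" if "i < d" for i
    unfolding L_def poly_prod using that inj by (auto simp: inj_on_def)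
  have "Polynomial.degree (L i) < d" if "i < d" for i
    unfolding L_def using that by (subst degree_prod_sum_eq) auto
  then have deg: "Polynomial.degree p < d"
    unfolding p_def using d by (intro degree_sum_less) (auto intro: le_less_trans[OF degree_smult_le])
  have "poly p (\<theta> k) = w k" if k: "k < d" for k
  proof -
    have "poly p (\<theta> k) = (\<Sum>i<d. w i / poly (L i) (\<theta> i) * poly (L i) (\<theta> k))" by (simp add: p_def poly_sum)
    also have "\<dots> = (\<Sum>i<d. if i = k then w k else 0)"
      using L0[OF k] Li[OF k] by (intro sum.cong) auto
    finally show ?thesis using k by simp
  qed
  moreover have "poly p x = (\<Sum>j<d. Polynomial.coeff p j * x ^ j)" for x
  proof -
    have "poly p x = (\<Sum>j\<le>Polynomial.degree p. Polynomial.coeff p j * x ^ j)" by (rule poly_altdef)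
    also have "\<dots> = (\<Sum>j<d. Polynomial.coeff p j * x ^ j)"
      using deg by (intro sum.mono_neutral_left) (auto simp: coeff_eq_0)
    finally show ?thesis .
  qed
  ultimately show ?thesis using pS by (intro exI[of _ "Polynomial.coeff p"]) (auto simp: polys_over_def)
qed

text \<open>
  \<open>f\<close> is the minimal polynomial of an element separable over the base field but not in it, and
  \<open>\<theta>\<close> lists its roots. The generic element \<open>\<Sum>j. zeta j * \<theta>\<^sup>j\<close> of the extension is normalised by
  \<open>zeta 1 = f(z\<^sub>1)\<close>, which has no rational zero; hence it never specialises into the base field.
\<close>

locale sep_poly =
  fixes f :: "'m::Fields.field poly" and d :: nat and \<theta> :: "nat \<Rightarrow> 'm alg_closure"
  assumes d: "d \<ge> 2" and monic: "Polynomial.lead_coeff f = 1" and degree_f: "Polynomial.degree f = d"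
    and factors: "map_poly to_ac f = (\<Prod>i<d. [:- \<theta> i, 1:])" and inj_\<theta>: "inj_on \<theta> {..<d}"
    and minimal: "\<And>i g. i < d \<Longrightarrow> g \<noteq> 0 \<Longrightarrow> poly (map_poly to_ac g) (\<theta> i) = 0 \<Longrightarrow> d \<le> Polynomial.degree g"
begin

lemma f_nonzero: "f \<noteq> 0" using monic by auto

lemma root_\<theta>: "i < d \<Longrightarrow> poly (map_poly to_ac f) (\<theta> i) = 0"
  unfolding factors by (auto simp: poly_prod intro!: prod_zero)

lemma no_root: "poly f x \<noteq> 0"
proof
  interpret t: comm_ring_hom "to_ac :: 'm \<Rightarrow> _" by (rule to_ac_hom)
  assume "poly f x = 0"
  then have "poly (map_poly to_ac f) (to_ac x) = 0"
    using t.poly_map_poly[of f x] by simp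
  then obtain i where i: "i < d" "to_ac x = \<theta> i" unfolding factors by (auto simp: poly_prod)
  have "poly (map_poly to_ac [:- x, 1:]) (\<theta> i) = 0" using i by (simp add: map_poly_pCons)
  then have "d \<le> Polynomial.degree [:- x, 1:]" by (intro minimal[OF i(1)]) auto
  then show False using d by simp
qed

text \<open>The coordinates use the variables from d to 2 * d - 1; those below d are reserved for
  \<open>tau'\<close>.\<close>

definition zeta :: "nat \<Rightarrow> 'm mpoly" where
  "zeta j = (if j = 1 then poly (map_poly const_mpoly f) (mvar (d + 1)) else mvar (d + j))"

text \<open>The coordinate of \<theta>^N at \<theta>^l in the power basis of the extension defined
  by f.\<close>

definition redc :: "nat \<Rightarrow> nat \<Rightarrow> 'm" where
  "redc N l = Polynomial.coeff (Polynomial.monom 1 N mod f) l"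

text \<open>The matrix of multiplication by the generic element: row k holds the coordinates of its
  product with \<theta>^k. Its characteristic polynomial \<open>gpoly\<close> is thus the \<tau> of
  the overview.\<close>

definition Wmat :: "'m mpoly mat" where
  "Wmat = mat d d (\<lambda>(k, l). \<Sum>j<d. zeta j * const_mpoly (redc (k + j) l))"

definition gpoly :: "'m mpoly poly" where
  "gpoly = char_poly Wmat"

lemma Wmat_carrier: "Wmat \<in> carrier_mat d d"
  by (simp add: Wmat_def)

lemma degree_gpoly: "Polynomial.degree gpoly = d" "Polynomial.coeff gpoly d = 1"
  using degree_monic_char_poly[OF Wmat_carrier] by (auto simp: gpoly_def)

lemma zeta_in: "j < d \<Longrightarrow> zeta j \<in> mpolys (2 * d)"
proof -
  assume j: "j < d"
  have "map_poly const_mpoly f \<in> polys_over (mpolys (2 * d) :: 'm mpoly set)"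
    by (auto simp: polys_over_def coeff_map_poly const_mpoly_in_mpolys const_mpoly_def)
      (auto simp: mpolys_def)
  then show ?thesis using j d by (auto simp: zeta_def intro!: mvar_in_mpolys poly_in_subring[OF is_subring_mpolys])
qed

lemma gpoly_in: "gpoly \<in> polys_over (mpolys (2 * d))"
  unfolding gpoly_def
  by (rule char_poly_polys_over[OF is_subring_mpolys Wmat_carrier])
    (auto simp: Wmat_def intro!: subring_sum[OF is_subring_mpolys] subring_mult[OF is_subring_mpolys] zeta_in const_mpoly_in_mpolys)

lemma redc_sum:
  fixes h :: "'m \<Rightarrow> 'e::Fields.field"
  assumes h: "comm_ring_hom h" and \<eta>: "poly (map_poly h f) \<eta> = 0"
  shows "(\<Sum>l<d. h (redc N l) * \<eta> ^ l) = \<eta> ^ N"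
proof -
  interpret h: comm_ring_hom h by fact
  interpret hp: map_poly_comm_ring_hom h ..
  let ?r = "Polynomial.monom 1 N mod f"
  have deg: "Polynomial.degree ?r < d"
    using degree_mod_less'[of f "Polynomial.monom 1 N"] f_nonzero d degree_f by (cases "?r = 0") auto
  have "Polynomial.monom 1 N = Polynomial.monom 1 N div f * f + ?r" by simp
  then have "map_poly h (Polynomial.monom 1 N) = map_poly h (Polynomial.monom 1 N div f * f + ?r)" by (rule arg_cong)
  then have "poly (map_poly h (Polynomial.monom 1 N)) \<eta> = poly (map_poly h (Polynomial.monom 1 N div f * f + ?r)) \<eta>"
    by (rule arg_cong)
  also have "\<dots> = poly (map_poly h ?r) \<eta>" unfolding hp.hom_add hp.hom_mult poly_add poly_mult \<eta> by simp
  finally have "\<eta> ^ N = poly (map_poly h ?r) \<eta>" by (simp add: map_poly_monom poly_monom)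
  also have "\<dots> = (\<Sum>l\<le>Polynomial.degree (map_poly h ?r). h (redc N l) * \<eta> ^ l)"
    by (simp add: poly_altdef redc_def)
  also have "\<dots> = (\<Sum>l<d. h (redc N l) * \<eta> ^ l)"
  proof (rule sum.mono_neutral_left)
    show "{..Polynomial.degree (map_poly h ?r)} \<subseteq> {..<d}"
      using deg degree_map_poly_le[of h ?r] by auto
    show "\<forall>l\<in>{..<d} - {..Polynomial.degree (map_poly h ?r)}. h (redc N l) * \<eta> ^ l = 0"
    proof
      fix l assume "l \<in> {..<d} - {..Polynomial.degree (map_poly h ?r)}"
      then have "Polynomial.coeff (map_poly h ?r) l = 0" by (intro coeff_eq_0) auto
      then show "h (redc N l) * \<eta> ^ l = 0" by (simp add: redc_def)
    qed
  qed simp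
  finally show ?thesis ..
qed

text \<open>At a zero \<eta> of f the vector of powers of \<eta> is an eigenvector of the
  specialised multiplication matrix, with the specialised generic element as eigenvalue.\<close>

lemma gpoly_root:
  fixes e :: "'m mpoly \<Rightarrow> 'e::Fields.field"
  assumes e: "comm_ring_hom e" and \<eta>: "poly (map_poly (\<lambda>c. e (const_mpoly c)) f) \<eta> = 0"
  shows "poly (map_poly e gpoly) (\<Sum>j<d. e (zeta j) * \<eta> ^ j) = 0"
proof -
  interpret e: comm_ring_hom e by fact
  have h: "comm_ring_hom (\<lambda>c. e (const_mpoly c))" by (rule comm_ring_hom_compose[OF e const_mpoly_hom])
  have eq: "map_poly e gpoly = char_poly (map_mat e Wmat)"
    unfolding gpoly_def by (rule e.char_poly_hom[OF Wmat_carrier, symmetric])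
  show ?thesis unfolding eq
  proof (rule char_poly_rootI[of _ d 0 "\<lambda>l. \<eta> ^ l"])
    show "map_mat e Wmat \<in> carrier_mat d d" using Wmat_carrier by simp
    fix k assume k: "k < d"
    have "(\<Sum>l<d. map_mat e Wmat $$ (k, l) * \<eta> ^ l) =
        (\<Sum>l<d. \<Sum>j<d. e (zeta j) * (e (const_mpoly (redc (k + j) l)) * \<eta> ^ l))"
      using k by (intro sum.cong refl) (simp add: Wmat_def e.hom_sum e.hom_mult sum_distrib_right mult.assoc)
    also have "\<dots> = (\<Sum>j<d. e (zeta j) * (\<Sum>l<d. e (const_mpoly (redc (k + j) l)) * \<eta> ^ l))"
      by (subst sum.swap) (simp add: sum_distrib_left)
    also have "\<dots> = (\<Sum>j<d. e (zeta j) * \<eta> ^ (k + j))"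
      by (simp add: redc_sum[OF h \<eta>])
    also have "\<dots> = (\<Sum>j<d. e (zeta j) * \<eta> ^ j) * \<eta> ^ k"
      unfolding sum_distrib_right power_add by (intro sum.cong refl) (simp only: mult_ac)
    finally show "(\<Sum>l<d. map_mat e Wmat $$ (k, l) * \<eta> ^ l) = (\<Sum>j<d. e (zeta j) * \<eta> ^ j) * \<eta> ^ k" .
  qed (use d in auto)
qed

definition gelem :: "nat \<Rightarrow> 'm alg_closure mpoly" where
  "gelem i = (\<Sum>j<d. lift_mpoly (zeta j) * const_mpoly (\<theta> i) ^ j)"

lemma mev_zeta_1: 
  assumes "comm_ring_hom h"
  shows "mev h a (zeta 1) = poly (map_poly h f) (a (d + 1))"
proof -
  interpret h: comm_ring_hom h by fact
  interpret e: comm_ring_hom "mev h a" by (rule h.comm_ring_hom_mev)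
  have "mev h a (zeta 1) = poly (map_poly (mev h a) (map_poly const_mpoly f)) (mev h a (mvar (d + 1)))"
    by (simp only: zeta_def if_True e.poly_map_poly simp_thms)
  also have "map_poly (mev h a) (map_poly const_mpoly f) = map_poly h f"
    by (rule poly_eqI) (simp add: coeff_map_poly const_mpoly_def h.mev_single)
  finally show ?thesis by simp
qed

lemma mev_gelem: "mev (\<lambda>c. c) a (gelem i) = (\<Sum>j<d. mev to_ac a (zeta j) * \<theta> i ^ j)"
proof -
  interpret t: comm_ring_hom "mev (\<lambda>c. c) a :: 'm alg_closure mpoly \<Rightarrow> _"
    by (rule comm_ring_hom.comm_ring_hom_mev[OF id_hom])
  have "mev (\<lambda>c. c) a (const_mpoly c) = c" for c :: "'m alg_closure"
    using comm_ring_hom.mev_const[OF id_hom, of a c] by simp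
  then show ?thesis by (simp only: gelem_def t.hom_sum t.hom_mult t.hom_power mev_lift)
qed

lemma inj_gelem: "inj_on gelem {..<d}"
proof (rule inj_onI)
  fix i k assume ik: "i \<in> {..<d}" "k \<in> {..<d}" and eq: "gelem i = gelem k"
  have "map_poly to_ac f \<noteq> 0" using f_nonzero by (simp add: poly_eq_iff coeff_map_poly)
  then have "finite {x. poly (map_poly to_ac f) x = 0}" by (rule poly_roots_finite)
  then obtain t where t: "poly (map_poly to_ac f) t \<noteq> 0"
    using infinite_alg_closure[where 'a = 'm] by (metis (mono_tags, lifting) UNIV_eq_I mem_Collect_eq)
  \<comment> \<open>Only the linear coordinate survives this specialisation, and
    \<open>gelem i\<close> becomes f(t) * \<theta> i, which separates the indices because f(t) is
    nonzero.\<close>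
  define a where "a n = (if n = d + 1 then t else 0)" for n
  have z: "mev to_ac a (zeta j) = (if j = 1 then poly (map_poly to_ac f) t else 0)" for j
    using mev_zeta_1[OF to_ac_hom, of a] comm_ring_hom.mev_var[OF to_ac_hom, of a "d + j"] by (auto simp: zeta_def a_def)
  have "mev (\<lambda>c. c) a (gelem i) = poly (map_poly to_ac f) t * \<theta> i" for i
  proof -
    have "mev (\<lambda>c. c) a (gelem i) = (\<Sum>j<d. if j = 1 then poly (map_poly to_ac f) t * \<theta> i else 0)"
      unfolding mev_gelem z by (intro sum.cong) auto
    also have "\<dots> = poly (map_poly to_ac f) t * \<theta> i" using d by simp
    finally show ?thesis .
  qed
  with eq t have "\<theta> i = \<theta> k" by (metis mult_left_cancel)
  then show "i = k" using inj_\<theta> ik by (auto simp: inj_on_def)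
qed

text \<open>The conjugates of the generic element are roots of \<open>gpoly\<close>, and, being
  distinct, they are all of them. The argument runs in the fraction field and is carried back by
  injectivity.\<close>

lemma lift_gpoly: "map_poly lift_mpoly gpoly = (\<Prod>i<d. [:- gelem i, 1:])"
proof -
  interpret F: inj_comm_ring_hom "\<lambda>x :: 'm alg_closure mpoly. Fract x 1"
    using Fract_one_hom by (intro inj_comm_ring_hom.intro) (unfold_locales, auto simp: comm_ring_hom_def Fract_one_eq_iff injective_def eq_fract Zero_fract_def One_fract_def)
  interpret Fp: map_poly_inj_comm_ring_hom "\<lambda>x :: 'm alg_closure mpoly. Fract x 1" ..
  interpret l: comm_ring_hom "lift_mpoly :: 'm mpoly \<Rightarrow> _" by (rule lift_mpoly_hom)
  define G where "G p = Fract (lift_mpoly p) 1" for p :: "'m mpoly"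
  have G: "comm_ring_hom G" unfolding G_def[abs_def] by (rule comm_ring_hom_compose[OF Fract_one_hom lift_mpoly_hom])
  have Gc: "G (const_mpoly c) = gen_const (to_ac c)" for c
  proof -
    have "lift_mpoly (const_mpoly c) = const_mpoly (to_ac c)"
      by (rule poly_mapping_eqI) (simp add: lookup_lift_mpoly const_mpoly_def lookup_single when_def)
    then show ?thesis by (simp add: G_def gen_const_def)
  qed
  have G0: "G 0 = 0" by (simp only: G_def l.hom_zero F.hom_zero)
  have map_G: "map_poly G p = map_poly (\<lambda>x. Fract x 1) (map_poly lift_mpoly p)" for p
    by (rule poly_eqI) (simp only: coeff_map_poly[where f = G, OF G0] coeff_map_poly[where f = "\<lambda>x. Fract x 1", OF F.hom_zero]
      coeff_map_poly[where f = lift_mpoly, OF l.hom_zero] G_def)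
  have "map_poly G gpoly = (\<Prod>i<d. [:- Fract (gelem i) 1, 1:])"
  proof (rule monic_eq_prod_roots)
    interpret G: comm_ring_hom G by (rule G)
    have c: "Polynomial.coeff (map_poly G gpoly) d = 1" by (simp add: degree_gpoly)
    show deg: "Polynomial.degree (map_poly G gpoly) = d"
      using degree_map_poly_le[of G gpoly] le_degree[of "map_poly G gpoly" d] c degree_gpoly by simp
    show "Polynomial.lead_coeff (map_poly G gpoly) = 1" by (simp only: deg c)
    show "inj_on (\<lambda>i. Fract (gelem i) 1) {..<d}" using inj_gelem by (auto simp: inj_on_def eq_fract)
    fix i assume i: "i < d"
    interpret gc: comm_ring_hom "gen_const :: 'm alg_closure \<Rightarrow> _" by (rule gen_const_hom)
    have "map_poly (\<lambda>c. G (const_mpoly c)) f = map_poly gen_const (map_poly to_ac f)"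
      by (rule poly_eqI) (simp add: coeff_map_poly Gc)
    then have "poly (map_poly (\<lambda>c. G (const_mpoly c)) f) (gen_const (\<theta> i)) = gen_const (poly (map_poly to_ac f) (\<theta> i))"
      by (simp only: gc.poly_map_poly)
    then have "poly (map_poly (\<lambda>c. G (const_mpoly c)) f) (gen_const (\<theta> i)) = 0" by (simp add: root_\<theta>[OF i])
    from gpoly_root[OF G this] have "poly (map_poly G gpoly) (\<Sum>j<d. G (zeta j) * gen_const (\<theta> i) ^ j) = 0" .
    moreover have "(\<Sum>j<d. G (zeta j) * gen_const (\<theta> i) ^ j) = Fract (gelem i) 1"
      by (simp only: gelem_def F.hom_sum F.hom_mult F.hom_power G_def gen_const_def)
    ultimately show "poly (map_poly G gpoly) (Fract (gelem i) 1) = 0" by simp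
  qed
  also have "\<dots> = map_poly (\<lambda>x. Fract x 1) (\<Prod>i<d. [:- gelem i, 1:])"
    unfolding Fp.hom_prod
  proof (intro prod.cong refl)
    fix i
    show "[:- Fract (gelem i) 1, 1:] = map_poly (\<lambda>x. Fract x 1) [:- gelem i, 1:]"
      by (rule poly_eqI) (auto simp: coeff_map_poly[where f = "\<lambda>x. Fract x 1", OF F.hom_zero] coeff_pCons F.hom_zero F.hom_one split: nat.split)
  qed
  finally show ?thesis unfolding map_G by (rule Fp.injectivity)
qed

text \<open>Obtained by specialising the generic identity \<open>lift_gpoly\<close>, hence valid
  also at points where several roots coincide.\<close>

lemma map_gpoly: "map_poly (mev to_ac a) gpoly = (\<Prod>i<d. [:- (\<Sum>j<d. mev to_ac a (zeta j) * \<theta> i ^ j), 1:])"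
proof -
  interpret t: comm_ring_hom "mev (\<lambda>c. c) a :: 'm alg_closure mpoly \<Rightarrow> _"
    by (rule comm_ring_hom.comm_ring_hom_mev[OF id_hom])
  interpret tp: map_poly_comm_ring_hom "mev (\<lambda>c. c) a :: 'm alg_closure mpoly \<Rightarrow> _" ..
  have "map_poly (mev to_ac a) gpoly = map_poly (mev (\<lambda>c. c) a) (map_poly lift_mpoly gpoly)"
    by (rule poly_eqI) (simp add: coeff_map_poly mev_lift lift_mpoly_eq_0_iff comm_ring_hom.mev_zero[OF to_ac_hom])
  also have "\<dots> = (\<Prod>i<d. [:- mev (\<lambda>c. c) a (gelem i), 1:])"
    by (simp add: lift_gpoly tp.hom_prod map_poly_pCons t.hom_uminus)
  finally show ?thesis by (simp only: mev_gelem)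
qed

end

section \<open>Existence of the polynomial f, and generic elements\<close>

lemma Fract_one_eq_0_iff: "Fract x 1 = 0 \<longleftrightarrow> x = 0"
  unfolding Zero_fract_def by (rule Fract_one_eq_iff)

lemma gen_const_eq_iff [simp]: "gen_const x = gen_const y \<longleftrightarrow> x = y"
  by (auto simp: gen_const_def eq_fract const_mpoly_def dest: injD[OF inj_single])

lemma gen_const_eq_0_iff [simp]: "gen_const x = 0 \<longleftrightarrow> x = 0"
proof -
  interpret comm_ring_hom "gen_const :: 'a \<Rightarrow> _" by (rule gen_const_hom)
  show ?thesis using gen_const_eq_iff[of x 0] by (simp only: hom_zero)
qed

lemma poly_pderiv_linear_mult:
  fixes q :: "'a::idom poly"
  shows "poly (pderiv ([:- x, 1:] * q)) x = poly q x"
  by (subst pderiv_mult) (simp add: pderiv_pCons)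

text \<open>A repeated root would give a square factor, at whose root the derivative vanishes
  too.\<close>

lemma monic_simple_roots_factor:
  fixes p :: "'a::alg_closed_field poly"
  assumes lc: "Polynomial.lead_coeff p = 1" and simple: "\<And>x. poly p x = 0 \<Longrightarrow> poly (pderiv p) x \<noteq> 0"
  obtains \<theta> where "inj_on \<theta> {..<Polynomial.degree p}" "p = (\<Prod>i<Polynomial.degree p. [:- \<theta> i, 1:])"
proof -
  have "p \<noteq> 0" using lc by auto
  from alg_closed_imp_factorization[OF this] obtain A where
    A: "size A = Polynomial.degree p" "p = (\<Prod>x\<in>#A. [:- x, 1:])" using lc by auto
  obtain xs where xs: "mset xs = A" using ex_mset by blast
  have p_xs: "p = prod_list (map (\<lambda>x. [:- x, 1:]) xs)"
    using A(2) unfolding xs[symmetric] by (simp add: prod_mset_prod_list flip: mset_map)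
  have "distinct xs"
  proof (rule ccontr)
    assume "\<not> distinct xs"
    then obtain us vs ws y where "xs = us @ [y] @ vs @ [y] @ ws" by (auto dest: not_distinct_decomp)
    then have "p = [:- y, 1:] * ([:- y, 1:] * prod_list (map (\<lambda>x. [:- x, 1:]) (us @ vs @ ws)))"
      unfolding p_xs by (simp only: map_append prod_list.append list.map prod_list.Cons prod_list.Nil mult_1_right mult_1_left mult_ac)
    then obtain w where w: "p = [:- y, 1:] * ([:- y, 1:] * w)" by blast
    have "poly p y = 0" unfolding w by simp
    moreover have "poly (pderiv p) y = 0" unfolding w poly_pderiv_linear_mult by simp
    ultimately show False using simple by blast
  qed
  moreover have len: "length xs = Polynomial.degree p" using A(1) xs by auto
  moreover have "prod_list (map (\<lambda>x. [:- x, 1:]) xs) = (\<Prod>i<length xs. [:- (xs ! i), 1:])"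
    by (simp add: prod.list_conv_set_nth lessThan_atLeast0)
  ultimately show ?thesis
    using that[of "\<lambda>i. xs ! i"] p_xs by (auto simp: inj_on_def nth_eq_iff_index_eq)
qed

text \<open>Setting all variables to some t with q(t) nonzero, which exists in an infinite field,
  shows that the value is not 0.\<close>

lemma gen_var_transcendental:
  fixes q :: "'c::Fields.field alg_closure poly"
  assumes "q \<noteq> 0"
  shows "poly (map_poly gen_const q) (gen_var i) \<noteq> 0"
proof -
  interpret F: comm_ring_hom "\<lambda>x :: 'c alg_closure mpoly. Fract x 1" by (rule Fract_one_hom)
  have "finite {x. poly q x = 0}" using assms by (rule poly_roots_finite)
  then obtain t where t: "poly q t \<noteq> 0"
    using infinite_alg_closure[where 'a = 'c] by (metis (mono_tags, lifting) UNIV_eq_I mem_Collect_eq)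
  have "poly (map_poly const_mpoly q) (mvar i) \<noteq> 0"
  proof
    interpret i: comm_ring_hom "mev (\<lambda>c. c) (\<lambda>_. t) :: 'c alg_closure mpoly \<Rightarrow> _"
      by (rule comm_ring_hom.comm_ring_hom_mev[OF id_hom])
    have ic: "mev (\<lambda>c. c) (\<lambda>_. t) (const_mpoly c) = c" for c :: "'c alg_closure"
      using comm_ring_hom.mev_const[OF id_hom, of "\<lambda>_. t" c] by simp
    have iv: "mev (\<lambda>c. c) (\<lambda>_. t) (mvar i :: 'c alg_closure mpoly) = t"
      using comm_ring_hom.mev_var[OF id_hom, of "\<lambda>_. t" i] by simp
    assume "poly (map_poly const_mpoly q) (mvar i) = 0"
    then have "mev (\<lambda>c. c) (\<lambda>_. t) (poly (map_poly const_mpoly q) (mvar i)) = 0" by (simp only: i.hom_zero)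
    then have "poly (map_poly (mev (\<lambda>c. c) (\<lambda>_. t)) (map_poly const_mpoly q)) t = 0"
      by (simp only: i.poly_map_poly[symmetric] iv)
    moreover have "map_poly (mev (\<lambda>c. c) (\<lambda>_. t)) (map_poly const_mpoly q) = q"
      by (rule poly_eqI) (simp add: coeff_map_poly ic const_mpoly_def[of 0] flip: const_mpoly_def)
    ultimately show False using t by simp
  qed
  moreover have "poly (map_poly gen_const q) (gen_var i) = Fract (poly (map_poly const_mpoly q) (mvar i)) 1"
  proof -
    have "map_poly gen_const q = map_poly (\<lambda>x. Fract x 1) (map_poly const_mpoly q)"
      by (rule poly_eqI) (simp add: coeff_map_poly gen_const_def const_mpoly_def F.hom_zero)
    then show ?thesis by (simp only: F.poly_map_poly gen_var_def)
  qed
  ultimately show ?thesis by (simp only: Fract_one_eq_0_iff not_False_eq_True)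
qed

lemma is_subfield_imp_subfield:
  fixes E :: "'a::Fields.field set"
  assumes E: "is_subfield E"
  shows "subfield E (ring_of_type_algebra :: 'a ring)"
proof -
  interpret F: Ring.field "ring_of_type_algebra :: 'a ring" by (rule field_from_type_algebra)
  note sr = is_subfield_imp_subring[OF E]
  show ?thesis
  proof (rule F.subfieldI')
    show "subring E (ring_of_type_algebra :: 'a ring)"
      by (rule F.subringI)
        (use subring_one[OF sr] subring_uminus[OF sr] subring_mult[OF sr] subring_add[OF sr] in \<open>auto simp: rota_simps rota_uminus\<close>)
    fix k :: 'a assume k: "k \<in> E - {\<zero>\<^bsub>ring_of_type_algebra\<^esub>}"
    then have "k \<noteq> 0" by (simp add: rota_simps)
    then have "inv\<^bsub>ring_of_type_algebra\<^esub> k = inverse k"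
      by (intro F.comm_inv_char) (auto simp: rota_simps)
    then show "inv\<^bsub>ring_of_type_algebra\<^esub> k \<in> E" using k subfield_inverse[OF E] by simp
  qed
qed

lemma is_subfield_range_to_ac: "is_subfield (range (to_ac :: 'm::Fields.field \<Rightarrow> _))"
  unfolding is_subfield_def
  by (auto simp flip: to_ac_diff to_ac_mult to_ac_inverse intro: range_eqI[of _ _ 1])

text \<open>Elements of the base field are separable over it, so \<open>separable_closure\<close>
  can differ from the base field only by being larger.\<close>

lemma not_separably_closedE:
  assumes "\<not> separably_closed TYPE('m::Fields.field)"
  obtains \<theta> :: "'m::Fields.field alg_closure" where "\<theta> \<notin> range to_ac" "sep_over (range to_ac) \<theta>"
proof -
  let ?F = "ring_of_type_algebra :: 'm alg_closure ring"
  interpret F: field_to_type ?F "\<lambda>x. x" by (rule field_to_type_id)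
  note sf = is_subfield_imp_subfield[OF is_subfield_range_to_ac[where 'm = 'm]]
  have iff: "separable_over ?F (range to_ac) x \<longleftrightarrow> sep_over (range to_ac) x" for x
    using F.separable_over_iff[OF sf, of x] by (simp add: rota_simps)
  have "sep_over (range to_ac) (to_ac c)" for c :: 'm
  proof -
    have "[:- to_ac c, 1:] \<in> polys_over (range (to_ac :: 'm \<Rightarrow> _))"
      using is_subfield_range_to_ac[where 'm = 'm, THEN is_subfield_imp_subring]
      by (auto simp: polys_over_def coeff_pCons simp flip: to_ac_minus intro: subring_zero subring_one split: nat.split)
    then show ?thesis unfolding sep_over_def by (rule bexI[rotated]) (simp add: pderiv_pCons)
  qed
  then have "range to_ac \<subseteq> separable_closure TYPE('m)"
    unfolding separable_closure_def iff by auto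
  then have "\<not> separable_closure TYPE('m) \<subseteq> range to_ac"
    using assms unfolding separably_closed_def by auto
  then show ?thesis using that unfolding separable_closure_def iff by auto
qed

text \<open>Take the minimal polynomial of a separable element outside the base field; it cannot be
  linear, as its root would then lie in the base field.\<close>

lemma sep_poly_exists:
  assumes "\<not> separably_closed TYPE('m::Fields.field)"
  shows "\<exists>(f :: 'm::Fields.field poly) d \<theta>. sep_poly f d \<theta>"
proof -
  let ?R = "range (to_ac :: 'm \<Rightarrow> _)"
  obtain \<theta>0 :: "'m alg_closure" where \<theta>0: "\<theta>0 \<notin> ?R" "sep_over ?R \<theta>0" using not_separably_closedE[OF assms] by blast
  note R = is_subfield_range_to_ac[where 'm = 'm]
  note sr = is_subfield_imp_subring[OF R]
  obtain p where p: "p \<in> polys_over ?R" "poly p \<theta>0 = 0" "poly (pderiv p) \<theta>0 \<noteq> 0" using \<theta>0(2) by (auto simp: sep_over_def)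
  then have "p \<noteq> 0" by auto
  then obtain m where m: "min_poly_over ?R \<theta>0 m" using min_poly_over_ex[OF R p(1) _ p(2)] by blast
  have mR: "m \<in> polys_over ?R" and lc: "Polynomial.lead_coeff m = 1" and m\<theta>: "poly m \<theta>0 = 0"
    using m by (simp_all add: min_poly_over_def)
  have m0: "m \<noteq> 0" using lc by auto
  define f where "f = map_poly of_ac m"
  have fm: "map_poly to_ac f = m"
  proof (rule poly_eqI)
    fix i
    have "Polynomial.coeff m i \<in> ?R" using mR unfolding polys_over_def by blast
    then show "Polynomial.coeff (map_poly to_ac f) i = Polynomial.coeff m i"
      by (simp add: f_def coeff_map_poly to_ac_of_ac)
  qed
  define d where "d = Polynomial.degree m"
  have deg_f: "Polynomial.degree f = d"
    unfolding d_def fm[symmetric] by (rule degree_map_poly[symmetric]) simp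
  have "to_ac (Polynomial.lead_coeff f) = 1"
  proof -
    have "to_ac (Polynomial.coeff f d) = Polynomial.coeff m d" by (simp add: fm[symmetric] coeff_map_poly)
    then show ?thesis using lc by (simp add: deg_f d_def)
  qed
  then have lcf: "Polynomial.lead_coeff f = 1" by simp
  obtain q where q: "p = m * q" using min_poly_over_dvd[OF m p(1,2)] by blast
  have "pderiv m \<noteq> 0" using p(3) m\<theta> by (auto simp: q pderiv_mult)
  \<comment> \<open>m is the minimal polynomial of each of its roots, and its nonzero derivative has
    smaller degree.\<close>
  have simple: "poly (pderiv m) \<eta> \<noteq> 0" if \<eta>: "poly m \<eta> = 0" for \<eta>
  proof
    assume "poly (pderiv m) \<eta> = 0"
    from min_poly_over_degree[OF min_poly_over_conjugate[OF R m \<eta>] polys_over_pderiv[OF sr mR] \<open>pderiv m \<noteq> 0\<close> this]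
    have le: "Polynomial.degree m \<le> Polynomial.degree (pderiv m)" .
    also have "\<dots> \<le> Polynomial.degree m - 1" by (rule degree_pderiv_le)
    finally have "Polynomial.degree m = 0" by simp
    then show False using \<open>pderiv m \<noteq> 0\<close> by (metis degree_eq_zeroE pderiv_pCons pderiv_0 mult_zero_right add_0 pCons_0_0)
  qed
  obtain \<theta> where \<theta>: "inj_on \<theta> {..<d}" "m = (\<Prod>i<d. [:- \<theta> i, 1:])"
    using monic_simple_roots_factor[OF lc] simple unfolding d_def by blast
  have root: "poly m (\<theta> i) = 0" if "i < d" for i
    unfolding \<theta>(2) poly_prod using that by (intro prod_zero) auto
  have "sep_poly f d \<theta>"
  proof
    show "Polynomial.lead_coeff f = 1" by (rule lcf)
    show "Polynomial.degree f = d" by (rule deg_f)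
    show "map_poly to_ac f = (\<Prod>i<d. [:- \<theta> i, 1:])" using fm \<theta>(2) by simp
    show "inj_on \<theta> {..<d}" by (rule \<theta>(1))
    fix i and g :: "'m poly" assume i: "i < d" and g: "g \<noteq> 0" "poly (map_poly to_ac g) (\<theta> i) = 0"
    have "map_poly to_ac g \<in> polys_over ?R" by (auto simp: polys_over_def coeff_map_poly)
    moreover have "map_poly to_ac g \<noteq> 0" using g(1) by (simp add: poly_eq_iff coeff_map_poly)
    ultimately have "d \<le> Polynomial.degree (map_poly to_ac g)"
      unfolding d_def using min_poly_over_degree[OF min_poly_over_conjugate[OF R m root[OF i]]] g(2) by blast
    also have "\<dots> \<le> Polynomial.degree g" by (rule degree_map_poly_le)
    finally show "d \<le> Polynomial.degree g" .
  next
    show "2 \<le> d"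
    proof (rule ccontr)
      assume "\<not> 2 \<le> d"
      moreover have "d \<noteq> 0"
      proof
        assume "d = 0"
        then have "m = 1" using \<theta>(2) by simp
        then show False using m\<theta> by simp
      qed
      ultimately have "d = 1" by simp
      then have m1: "m = [:- \<theta> 0, 1:]" using \<theta>(2) by simp
      then have "\<theta>0 = \<theta> 0" using m\<theta> by simp
      have "Polynomial.coeff m 0 \<in> ?R" using mR unfolding polys_over_def by blast
      then have "- \<theta> 0 \<in> ?R" using m1 by simp
      then have "- (- \<theta> 0) \<in> ?R" by (rule subring_uminus[OF sr])
      then show False using \<theta>0(1) \<open>\<theta>0 = \<theta> 0\<close> by simp
    qed
  qed
  then show ?thesis by blast
qed

lemma lift_mpoly_var: "lift_mpoly (mvar i) = mvar i"
  by (rule poly_mapping_eqI) (simp add: lookup_lift_mpoly mvar_def lookup_single when_def)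

lemma lift_mpoly_const: "lift_mpoly (const_mpoly c) = const_mpoly (to_ac c)"
  by (rule poly_mapping_eqI) (simp add: lookup_lift_mpoly const_mpoly_def lookup_single when_def)

section \<open>Parameters of the two generic polynomials: rational roots and separability\<close>

context sep_poly
begin

text \<open>\<open>tau'\<close> are the coefficients of the generic polynomial with the root \<open>mvar 0\<close>.\<close>

definition tau :: "nat \<Rightarrow> 'm mpoly" where "tau j = Polynomial.coeff gpoly j"

definition tau' :: "nat \<Rightarrow> 'm mpoly" where
  "tau' j = (if j = 0 then - (mvar 0 ^ d + (\<Sum>i\<in>{1..<d}. mvar i * mvar 0 ^ i)) else mvar j)"

lemma tau_in: "tau j \<in> mpolys (2 * d)"
  using gpoly_in by (simp add: tau_def polys_over_def)

lemma tau'_in: "j < d \<Longrightarrow> tau' j \<in> mpolys (2 * d)"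
  unfolding tau'_def
  by (auto intro!: subring_diff[OF is_subring_mpolys] subring_uminus[OF is_subring_mpolys] subring_add[OF is_subring_mpolys] subring_sum[OF is_subring_mpolys]
      subring_mult[OF is_subring_mpolys] subring_power[OF is_subring_mpolys] mvar_in_mpolys)

lemma gpoly_eq: "gpoly = Polynomial.monom 1 d + poly_of_fun d tau"
proof (rule poly_eqI)
  fix j
  show "Polynomial.coeff gpoly j = Polynomial.coeff (Polynomial.monom 1 d + poly_of_fun d tau) j"
  proof (cases j d rule: linorder_cases)
    case greater
    then show ?thesis using degree_gpoly(1) by (simp add: coeff_poly_of_fun coeff_eq_0)
  qed (auto simp: coeff_poly_of_fun degree_gpoly(2) tau_def)
qed

lemma tau'_root:
  assumes "comm_ring_hom e"
  shows "poly (Polynomial.monom 1 d + poly_of_fun d (\<lambda>j. e (tau' j))) (e (mvar 0)) = 0"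
proof -
  interpret e: comm_ring_hom e by fact
  let ?x = "e (mvar 0)"
  have "{..<d} = insert 0 {1..<d}" using d by auto
  then have "(\<Sum>j<d. e (tau' j) * ?x ^ j) = e (tau' 0) + (\<Sum>j\<in>{1..<d}. e (tau' j) * ?x ^ j)" by simp
  also have "\<dots> = - (?x ^ d)"
    by (simp add: tau'_def e.hom_uminus e.hom_minus e.hom_add e.hom_sum e.hom_mult e.hom_power)
  finally show ?thesis by (simp add: poly_monom poly_poly_of_fun)
qed

lemma map_poly_of_gpoly:
  assumes "comm_ring_hom e"
  shows "map_poly e gpoly = Polynomial.monom 1 d + poly_of_fun d (\<lambda>j. e (tau j))"
proof -
  interpret e: comm_ring_hom e by fact
  show ?thesis by (rule poly_eqI) (auto simp: gpoly_eq coeff_map_poly coeff_poly_of_fun e.hom_add)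
qed

text \<open>A root s in M would be a conjugate of the specialised generic element, so \<theta> i
  would satisfy an equation over M of degree below d. All coefficients of this equation vanish by
  minimality, among them f(b (d + 1)) at exponent 1, but f has no zero in M.\<close>

lemma gpoly_no_rational_root: "poly (map_poly (mev (\<lambda>c. c) b) gpoly) s \<noteq> 0"
proof
  interpret t: comm_ring_hom "to_ac :: 'm \<Rightarrow> _" by (rule to_ac_hom)
  let ?a = "\<lambda>i. to_ac (b i)"
  assume root: "poly (map_poly (mev (\<lambda>c. c) b) gpoly) s = 0"
  have b0: "mev (\<lambda>c. c) b (0 :: 'm mpoly) = 0" by (simp add: mev_def)
  have "map_poly (mev to_ac ?a) gpoly = map_poly to_ac (map_poly (mev (\<lambda>c. c) b) gpoly)"
    by (rule poly_eqI) (simp add: coeff_map_poly mev_to_ac_rational b0)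
  then have "poly (map_poly (mev to_ac ?a) gpoly) (to_ac s) = 0" using root t.poly_map_poly by simp
  then obtain i where i: "i < d" "to_ac s = (\<Sum>j<d. mev to_ac ?a (zeta j) * \<theta> i ^ j)"
    unfolding map_gpoly by (auto simp: poly_prod)
  define z where "z j = mev (\<lambda>c. c) b (zeta j)" for j
  define g where "g = poly_of_fun d z - [:s:]"
  have "poly (map_poly to_ac g) (\<theta> i) = 0"
  proof -
    have "map_poly to_ac g = poly_of_fun d (\<lambda>j. to_ac (z j)) - [:to_ac s:]"
      by (rule poly_eqI) (auto simp: g_def coeff_map_poly coeff_poly_of_fun coeff_pCons split: nat.split)
    then show ?thesis using i(2) by (simp add: poly_poly_of_fun mev_to_ac_rational z_def)
  qed
  moreover have "Polynomial.degree g < d"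
    unfolding g_def using d degree_poly_of_fun[of d z] by (intro degree_diff_less) auto
  ultimately have "g = 0" using minimal[OF i(1), of g] by linarith
  then have "Polynomial.coeff g 1 = 0" by simp
  then have "z 1 = 0" using d by (simp add: g_def coeff_poly_of_fun)
  moreover have "map_poly (\<lambda>c. c) f = f" by (rule poly_eqI) (simp add: coeff_map_poly)
  ultimately have "poly f (b (d + 1)) = 0"
    unfolding z_def mev_zeta_1[OF id_hom] by simp
  then show False using no_root by blast
qed

text \<open>The \<theta> i need not lie in E, but they are simple roots of f, whose coefficients
  come from M.\<close>

lemma gen_const_\<theta>_sepgen:
  assumes "range (\<lambda>c. gen_const (to_ac c)) \<subseteq> E" "i < d"
  shows "gen_const (\<theta> i) \<in> sepgen E"
proof (rule sepgen_root)
  interpret gc: comm_ring_hom "gen_const :: 'm alg_closure \<Rightarrow> _" by (rule gen_const_hom)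
  let ?p = "map_poly gen_const (map_poly to_ac f)"
  show "Polynomial.coeff ?p k \<in> sepgen E" for k
    using assms(1) by (auto simp: coeff_map_poly intro: sepgen_base)
  show "poly ?p (gen_const (\<theta> i)) = 0" by (simp add: gc.poly_map_poly root_\<theta>[OF assms(2)])
  have "map_poly to_ac f = [:- \<theta> i, 1:] * (\<Prod>k\<in>{..<d} - {i}. [:- \<theta> k, 1:])"
    unfolding factors using assms(2) by (subst prod.remove[of _ i]) auto
  then have "poly (pderiv (map_poly to_ac f)) (\<theta> i) = (\<Prod>k\<in>{..<d} - {i}. \<theta> i - \<theta> k)"
    by (simp only: poly_pderiv_linear_mult poly_prod) simp
  also have "\<dots> \<noteq> 0" using inj_\<theta> assms(2) by (auto simp: inj_on_def)
  finally have "gen_const (poly (pderiv (map_poly to_ac f)) (\<theta> i)) \<noteq> 0"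
    by simp
  moreover have "pderiv ?p = map_poly gen_const (pderiv (map_poly to_ac f))"
    by (rule poly_eqI) (simp add: coeff_pderiv coeff_map_poly gc.hom_mult gc.hom_add gc.hom_of_nat)
  ultimately show "poly (pderiv ?p) (gen_const (\<theta> i)) \<noteq> 0" by (simp add: gc.poly_map_poly)
qed

text \<open>The \<open>zeta j\<close> are the coordinates of the separable roots of \<open>gpoly\<close> with respect to the powers
  of \<open>\<theta>\<close>.\<close>

lemma gen_var_sepgen_zeta:
  assumes E: "is_subfield E" and cE: "range (\<lambda>c. gen_const (to_ac c)) \<subseteq> E"
    and tE: "\<And>j. j < d \<Longrightarrow> Fract (lift_mpoly (tau j)) 1 \<in> E" and j: "j < d"
  shows "gen_var (d + j) \<in> sepgen E"
proof -
  note sg = is_subfield_sepgen[OF E]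
  note sr = is_subfield_imp_subring[OF sg]
  interpret F: comm_ring_hom "\<lambda>x :: 'm alg_closure mpoly. Fract x 1" by (rule Fract_one_hom)
  interpret l: comm_ring_hom "lift_mpoly :: 'm mpoly \<Rightarrow> _" by (rule lift_mpoly_hom)
  define G where "G p = Fract (lift_mpoly p) 1" for p :: "'m mpoly"
  have G: "comm_ring_hom G" unfolding G_def[abs_def] by (rule comm_ring_hom_compose[OF Fract_one_hom lift_mpoly_hom])
  interpret G: comm_ring_hom G by (rule G)
  define w where "w i = Fract (gelem i) 1" for i
  have w_eq: "w i = (\<Sum>j<d. G (zeta j) * gen_const (\<theta> i) ^ j)" for i
    by (simp only: w_def gelem_def F.hom_sum F.hom_mult F.hom_power G_def gen_const_def)
  have prod: "map_poly G gpoly = (\<Prod>i<d. [:- w i, 1:])"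
  proof -
    interpret Fp: map_poly_comm_ring_hom "\<lambda>x :: 'm alg_closure mpoly. Fract x 1" ..
    have "map_poly G gpoly = map_poly (\<lambda>x. Fract x 1) (map_poly lift_mpoly gpoly)"
      by (rule poly_eqI) (simp only: coeff_map_poly[where f = G, OF G.hom_zero] coeff_map_poly[where f = "\<lambda>x. Fract x 1", OF F.hom_zero]
        coeff_map_poly[where f = lift_mpoly, OF l.hom_zero] G_def)
    also have "\<dots> = (\<Prod>i<d. [:- w i, 1:])"
      unfolding lift_gpoly Fp.hom_prod
    proof (intro prod.cong refl)
      fix i
      show "map_poly (\<lambda>x. Fract x 1) [:- gelem i, 1:] = [:- w i, 1:]"
        by (rule poly_eqI) (auto simp: w_def coeff_map_poly[where f = "\<lambda>x. Fract x 1", OF F.hom_zero] coeff_pCons F.hom_zero F.hom_one split: nat.split)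
    qed
    finally show ?thesis .
  qed
  have inj_w: "inj_on w {..<d}" using inj_gelem by (auto simp: inj_on_def w_def eq_fract)
  have w: "w i \<in> sepgen E" if i: "i < d" for i
  proof (rule sepgen_root)
    show "Polynomial.coeff (map_poly G gpoly) k \<in> sepgen E" for k
      unfolding map_poly_of_gpoly[OF G] using tE subring_one[OF sr] subring_zero[OF sr]
      by (auto simp: coeff_poly_of_fun Polynomial.coeff_monom G_def intro: sepgen_base)
    show "poly (map_poly G gpoly) (w i) = 0" unfolding prod poly_prod using i by (intro prod_zero) auto
    have "map_poly G gpoly = [:- w i, 1:] * (\<Prod>k\<in>{..<d} - {i}. [:- w k, 1:])"
      unfolding prod using i by (subst prod.remove[of _ i]) auto
    then have "poly (pderiv (map_poly G gpoly)) (w i) = (\<Prod>k\<in>{..<d} - {i}. w i - w k)"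
      by (simp only: poly_pderiv_linear_mult poly_prod) simp
    also have "\<dots> \<noteq> 0" using inj_w i by (auto simp: inj_on_def)
    finally show "poly (pderiv (map_poly G gpoly)) (w i) \<noteq> 0" .
  qed
  note \<theta> = gen_const_\<theta>_sepgen[OF cE]
  have inj_c: "inj_on (\<lambda>i. gen_const (\<theta> i)) {..<d}"
    using inj_\<theta> by (auto simp: inj_on_def)
  have "d > 0" using d by simp
  from interpolation[where w = w, OF inj_c this sg \<theta> w] obtain z where
    z: "\<And>j. z j \<in> sepgen E" "\<And>i. i < d \<Longrightarrow> (\<Sum>j<d. z j * gen_const (\<theta> i) ^ j) = w i" by blast
  \<comment> \<open>Two polynomials of degree below d agree at d distinct nodes, so the interpolated
    coordinates, which lie in \<open>sepgen E\<close>, are the generic ones.\<close>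
  have "poly_of_fun d z = poly_of_fun d (\<lambda>j. G (zeta j))"
    by (rule poly_eq_of_roots[OF inj_c]) (use d z(2) w_eq in \<open>auto simp: degree_poly_of_fun poly_poly_of_fun\<close>)
  then have "z j = G (zeta j)" if "j < d" for j
    using that by (metis coeff_poly_of_fun)
  then have zeta: "G (zeta j) \<in> sepgen E" if "j < d" for j using z(1) that by metis
  have Gvar: "G (mvar i) = gen_var i" for i by (simp add: G_def gen_var_def lift_mpoly_var)
  show ?thesis
  proof (cases "j = 1")
    case False
    then show ?thesis using zeta[OF j] by (simp add: zeta_def Gvar)
  next
    case True
    \<comment> \<open>So far only the value of f at this variable has been reached. The variable is
      a simple root of f(X) - \<open>G (zeta 1)\<close>, since f' is nonzero and the variable is
      transcendental.\<close>
    let ?p = "map_poly (\<lambda>c. gen_const (to_ac c)) f"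
    have Gz: "G (zeta 1) = poly ?p (gen_var (d + 1))"
    proof -
      have "G (zeta 1) = poly (map_poly G (map_poly const_mpoly f)) (G (mvar (d + 1)))"
        by (simp only: zeta_def if_True G.poly_map_poly simp_thms)
      also have "map_poly G (map_poly const_mpoly f) = ?p"
        by (rule poly_eqI) (simp add: coeff_map_poly G_def lift_mpoly_const gen_const_def const_mpoly_def[of 0] comm_ring_hom_def F.hom_zero l.hom_zero)
      finally show ?thesis by (simp add: Gvar)
    qed
    have p_gc: "?p = map_poly gen_const (map_poly to_ac f)"
      by (rule poly_eqI) (simp add: coeff_map_poly gen_const_def const_mpoly_def F.hom_zero)
    show ?thesis unfolding True
    proof (rule sepgen_root)
      show "Polynomial.coeff (?p - [:G (zeta 1):]) k \<in> sepgen E" for k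
        using cE zeta[of 1] d subring_zero[OF sr]
        by (intro subring_diff[OF sr, of "Polynomial.coeff ?p k" "Polynomial.coeff [:G (zeta 1):] k", folded coeff_diff])
          (auto simp: coeff_map_poly gen_const_def const_mpoly_def[of 0] F.hom_zero coeff_pCons intro: sepgen_base split: nat.split)
      show "poly (?p - [:G (zeta 1):]) (gen_var (d + 1)) = 0"
        by (simp only: poly_diff Gz poly_pCons poly_0 mult_zero_right add_0_right diff_self)
      interpret gc: comm_ring_hom "gen_const :: 'm alg_closure \<Rightarrow> _" by (rule gen_const_hom)
      let ?q = "pderiv (map_poly to_ac f)"
      have "?q \<noteq> 0"
      proof
        assume "?q = 0"
        have "map_poly to_ac f = [:- \<theta> 0, 1:] * (\<Prod>k\<in>{..<d} - {0}. [:- \<theta> k, 1:])"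
          unfolding factors using d by (subst prod.remove[of _ 0]) auto
        then have "poly ?q (\<theta> 0) = (\<Prod>k\<in>{..<d} - {0}. \<theta> 0 - \<theta> k)"
          by (simp only: poly_pderiv_linear_mult poly_prod) simp
        also have "\<dots> \<noteq> 0" using inj_\<theta> d by (auto simp: inj_on_def)
        finally show False using \<open>?q = 0\<close> by simp
      qed
      then have "poly (map_poly gen_const ?q) (gen_var (d + 1)) \<noteq> 0" by (rule gen_var_transcendental)
      moreover have "pderiv ?p = map_poly gen_const ?q"
        unfolding p_gc by (rule poly_eqI) (simp add: coeff_pderiv coeff_map_poly gc.hom_mult gc.hom_add gc.hom_of_nat)
      ultimately show "poly (pderiv (?p - [:G (zeta 1):])) (gen_var (d + 1)) \<noteq> 0"
        by (simp only: pderiv_diff pderiv_singleton diff_0_right not_False_eq_True)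
    qed
  qed
qed

end

text \<open>Variables 1 to d - 1 are themselves coefficients; variable 0 is a simple root of the
  monic polynomial whose lower coefficients are the \<open>tau' j\<close>.\<close>

lemma (in sep_poly) gen_var_sepgen_root:
  assumes E: "is_subfield E"
    and tE: "\<And>j. j < d \<Longrightarrow> Fract (lift_mpoly (tau' j)) 1 \<in> E" and j: "j < d"
  shows "gen_var j \<in> sepgen E"
proof -
  note sr = is_subfield_imp_subring[OF E]
  define G where "G p = Fract (lift_mpoly p) 1" for p :: "'m mpoly"
  have G: "comm_ring_hom G" unfolding G_def[abs_def] by (rule comm_ring_hom_compose[OF Fract_one_hom lift_mpoly_hom])
  interpret G: comm_ring_hom G by (rule G)
  have Gvar: "G (mvar i) = gen_var i" for i by (simp add: G_def gen_var_def lift_mpoly_var)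
  have var: "gen_var j \<in> E" if "j < d" "j \<noteq> 0" for j
    using tE[OF that(1)] that(2) by (simp add: tau'_def lift_mpoly_var gen_var_def)
  show ?thesis
  proof (cases "j = 0")
    case False
    then show ?thesis using var[OF j] by (intro sepgen_base) auto
  next
    case True
    let ?p = "Polynomial.monom 1 d + poly_of_fun d (\<lambda>j. G (tau' j))"
    show ?thesis unfolding True
    proof (rule sepgen_root)
      show "Polynomial.coeff ?p k \<in> sepgen E" for k
        using tE subring_one[OF sr] subring_zero[OF sr]
        by (intro sepgen_base) (auto simp: coeff_poly_of_fun Polynomial.coeff_monom G_def)
      show "poly ?p (gen_var 0) = 0" using tau'_root[OF G] by (simp add: Gvar)
      define q where "q = of_nat d * mvar 0 ^ (d - 1) + (\<Sum>j\<in>{1..<d}. of_nat j * mvar j * mvar 0 ^ (j - 1) :: 'm mpoly)"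
      have "poly (pderiv ?p) (gen_var 0) = of_nat d * gen_var 0 ^ (d - 1) + (\<Sum>j<d. of_nat j * G (tau' j) * gen_var 0 ^ (j - 1))"
        by (simp add: pderiv_add pderiv_monom poly_monom poly_of_fun_def pderiv_sum poly_sum mult.assoc)
      also have "(\<Sum>j<d. of_nat j * G (tau' j) * gen_var 0 ^ (j - 1)) = (\<Sum>j\<in>{1..<d}. of_nat j * gen_var j * gen_var 0 ^ (j - 1))"
      proof (rule sum.mono_neutral_cong_right)
        show "\<forall>i\<in>{..<d} - {1..<d}. of_nat i * G (tau' i) * gen_var 0 ^ (i - 1) = 0"
        proof
          fix i assume "i \<in> {..<d} - {1..<d}"
          then have "i = 0" by auto
          then show "of_nat i * G (tau' i) * gen_var 0 ^ (i - 1) = 0" by simp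
        qed
        show "of_nat x * G (tau' x) * gen_var 0 ^ (x - 1) = of_nat x * gen_var x * gen_var 0 ^ (x - 1)" if "x \<in> {1..<d}" for x
          using that by (simp add: tau'_def Gvar)
      qed auto
      also have "of_nat d * gen_var 0 ^ (d - 1) + (\<Sum>j\<in>{1..<d}. of_nat j * gen_var j * gen_var 0 ^ (j - 1)) = G q"
        by (simp only: q_def G.hom_add G.hom_sum G.hom_mult G.hom_power G.hom_of_nat Gvar)
      finally have "poly (pderiv ?p) (gen_var 0) = G q" .
      moreover have "q \<noteq> 0"
      proof
        \<comment> \<open>At this point the derivative takes the value 1 in every characteristic; d
          is at least 2, so variable 1 is a coefficient and the leading term vanishes.\<close>
        define a where "a i = (if i = 1 then 1 else 0 :: 'm)" for i :: nat
        interpret e: comm_ring_hom "mev (\<lambda>c. c) a :: 'm mpoly \<Rightarrow> 'm" by (rule comm_ring_hom.comm_ring_hom_mev[OF id_hom])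
        have ev: "mev (\<lambda>c. c) a (mvar i :: 'm mpoly) = a i" for i
          using comm_ring_hom.mev_var[OF id_hom, of a i] by simp
        assume "q = 0"
        then have "mev (\<lambda>c. c) a q = 0" by (simp only: e.hom_zero)
        moreover have "mev (\<lambda>c. c) a q = of_nat d * a 0 ^ (d - 1) + (\<Sum>j\<in>{1..<d}. of_nat j * a j * a 0 ^ (j - 1))"
          by (simp only: q_def e.hom_add e.hom_sum e.hom_mult e.hom_power e.hom_of_nat ev)
        moreover have "a 0 ^ (d - 1) = 0" using d by (simp add: a_def)
        moreover have "(\<Sum>j\<in>{1..<d}. of_nat j * a j * a 0 ^ (j - 1)) = (\<Sum>j\<in>{1..<d}. if j = 1 then 1 else 0)"
          by (intro sum.cong) (auto simp: a_def)
        moreover have "(\<Sum>j\<in>{1..<d}. if j = 1 then 1 else 0 :: 'm) = 1" using d by simp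
        ultimately show False using d by (simp add: power_0_left)
      qed
      ultimately show "poly (pderiv ?p) (gen_var 0) \<noteq> 0"
        by (simp only: G_def Fract_one_eq_0_iff lift_mpoly_eq_0_iff not_False_eq_True)
    qed
  qed
qed

text \<open>Dominance in the strong form of surjectivity over the algebraic closure. The roots of
  the first prescribed polynomial are interpolated on the \<theta> i by coordinates z, the equation
  f(y) = z 1 is solvable, and a root of the second polynomial provides variable 0.\<close>

lemma (in sep_poly) gpoly_surj:
  fixes t t' :: "nat \<Rightarrow> 'm alg_closure"
  shows "\<exists>a. \<forall>j<d. mev to_ac a (tau j) = t j \<and> mev to_ac a (tau' j) = t' j"
proof -
  let ?P = "Polynomial.monom 1 d + poly_of_fun d t" and ?P' = "Polynomial.monom 1 d + poly_of_fun d t'"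
  have coeff_P: "Polynomial.coeff (Polynomial.monom 1 d + poly_of_fun d s) j = (if j < d then s j else if j = d then 1 else 0)"
    for s :: "nat \<Rightarrow> 'm alg_closure" and j
    by (auto simp: coeff_poly_of_fun)
  have deg: "Polynomial.degree (Polynomial.monom 1 d + poly_of_fun d s) = d" for s :: "nat \<Rightarrow> 'm alg_closure"
    by (intro antisym degree_le le_degree) (auto simp: coeff_P coeff_poly_of_fun)
  have lc: "Polynomial.coeff ?P d = 1" unfolding coeff_P by simp
  have "?P \<noteq> 0" using coeff_P[of t d] by (metis Polynomial.coeff_0 less_irrefl zero_neq_one)
  from alg_closed_imp_factorization[OF this] obtain A where
    A0: "size A = Polynomial.degree ?P \<and> ?P = smult (Polynomial.lead_coeff ?P) (\<Prod>x\<in>#A. [:- x, 1:])" ..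
  have A: "size A = d" "?P = (\<Prod>x\<in>#A. [:- x, 1:])"
    using conjunct1[OF A0] conjunct2[OF A0] by (simp_all only: deg lc smult_1_left)
  obtain xs where xs: "mset xs = A" using ex_mset by blast
  define w where "w i = xs ! i" for i
  have len: "length xs = d" using A(1) xs by auto
  have "(\<Prod>x\<in>#A. [:- x, 1:]) = (\<Prod>i<d. [:- w i, 1:])"
    unfolding xs[symmetric] w_def len[symmetric] lessThan_atLeast0
    by (simp add: prod_mset_prod_list prod.list_conv_set_nth flip: mset_map)
  with A(2) have P: "?P = (\<Prod>i<d. [:- w i, 1:])" by (rule trans)
  have "d > 0" using d by simp
  have "is_subfield (UNIV :: 'm alg_closure set)" by (simp add: is_subfield_def)
  from interpolation[where w = w, OF inj_\<theta> \<open>d > 0\<close> this UNIV_I UNIV_I] obtain z where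
    z: "\<And>i. i < d \<Longrightarrow> (\<Sum>j<d. z j * \<theta> i ^ j) = w i" by blast
  have "Polynomial.degree ?P' > 0" using deg \<open>d > 0\<close> by simp
  then obtain x where x: "poly ?P' x = 0" using alg_closed_imp_poly_has_root by blast
  have "Polynomial.degree (map_poly to_ac f - [:z 1:]) > 0"
  proof -
    have "Polynomial.coeff (map_poly to_ac f - [:z 1:]) d = 1"
      using d monic degree_f by (simp add: coeff_map_poly coeff_pCons split: nat.split)
    then have "d \<le> Polynomial.degree (map_poly to_ac f - [:z 1:])" by (intro le_degree) simp
    then show ?thesis using d by simp
  qed
  then obtain y where y: "poly (map_poly to_ac f - [:z 1:]) y = 0" using alg_closed_imp_poly_has_root by blast
  \<comment> \<open>Variable 0 is the root x of the second polynomial and 1 to d - 1 are its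
    coefficients; d + j carries coordinate j of the generic element, except that d + 1 carries the
    solution y of f(y) = z 1.\<close>
  define a where "a i = (if i = 0 then x else if i < d then t' i else if i = d + 1 then y else z (i - d))" for i
  interpret e: comm_ring_hom "mev to_ac a :: 'm mpoly \<Rightarrow> _" by (rule comm_ring_hom.comm_ring_hom_mev[OF to_ac_hom])
  have ev: "mev to_ac a (mvar i) = a i" for i by (rule comm_ring_hom.mev_var[OF to_ac_hom])
  have zeta: "mev to_ac a (zeta j) = z j" if "j < d" for j
  proof (cases "j = 1")
    case True
    have "mev to_ac a (zeta 1) = poly (map_poly to_ac f) y" unfolding mev_zeta_1[OF to_ac_hom] by (simp add: a_def)
    then show ?thesis using y True by simp
  next
    case False
    then have "zeta j = mvar (d + j)" by (simp add: zeta_def)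
    then show ?thesis using False d by (simp add: ev a_def)
  qed
  have "map_poly (mev to_ac a) gpoly = (\<Prod>i<d. [:- w i, 1:])"
    unfolding map_gpoly using zeta z by (intro prod.cong refl) simp
  then have "map_poly (mev to_ac a) gpoly = ?P" using P by simp
  then have "Polynomial.monom 1 d + poly_of_fun d (\<lambda>j. mev to_ac a (tau j)) = ?P"
    using map_poly_of_gpoly[OF e.comm_ring_hom_axioms] by simp
  then have tau: "mev to_ac a (tau j) = t j" if "j < d" for j
    using that coeff_P by metis
  have nz: "mev to_ac a (tau' j) = t' j" if "j < d" "j \<noteq> 0" for j
    using that by (simp add: tau'_def ev a_def)
  have "poly (Polynomial.monom 1 d + poly_of_fun d (\<lambda>j. mev to_ac a (tau' j))) x = 0"
    using tau'_root[OF e.comm_ring_hom_axioms] by (simp add: ev a_def)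
  moreover have "{..<d} = insert 0 {1..<d}" using d by auto
  ultimately have eq0: "x ^ d + (mev to_ac a (tau' 0) + (\<Sum>j\<in>{1..<d}. t' j * x ^ j)) = 0"
    and eq1: "x ^ d + (t' 0 + (\<Sum>j\<in>{1..<d}. t' j * x ^ j)) = 0"
    using x nz by (simp_all add: poly_monom poly_poly_of_fun)
  \<comment> \<open>The root x and the higher coefficients determine the constant
    coefficient.\<close>
  from trans[OF eq0 eq1[symmetric]] have "mev to_ac a (tau' 0) = t' 0" by (simp only: add_left_cancel add_right_cancel)
  then have "mev to_ac a (tau' j) = t' j" if "j < d" for j using nz[OF that] by (cases "j = 0") auto
  with tau show ?thesis by blast
qed

theorem not_PAC_over_proper_galois:
  fixes K :: "'m::Fields.field set"
  assumes galois: "galois_extension (ring_of_type_algebra :: 'm ring) K"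
    and nsc: "\<not> separably_closed TYPE('m)" and \<alpha>: "\<alpha> \<notin> K"
  shows "\<not> PAC_over K"
proof
  assume PAC: "PAC_over K"
  obtain f d and \<theta> :: "nat \<Rightarrow> 'm alg_closure" where "sep_poly f d \<theta>" using sep_poly_exists[OF nsc] by blast
  then interpret sep_poly f d \<theta> .
  from galois_conjugate[OF galois \<alpha>] obtain m \<alpha>' where
    m: "min_poly_over K \<alpha> m" "poly m \<alpha>' = 0" "\<alpha>' \<noteq> \<alpha>" by blast
  note K = is_subfield_imp_subring[OF galois_subfield[OF galois]]
  \<comment> \<open>The system tau = u + \<alpha> v, tau' = u + \<alpha>' v is solved for u and v;
    its determinant is nonzero because the conjugates are distinct.\<close>
  define v where "v j = const_mpoly (1 / (\<alpha> - \<alpha>')) * (tau j - tau' j)" for j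
  define u where "u j = tau j - const_mpoly \<alpha> * v j" for j
  define p where "p i = (if i < d then u i else v (i - d))" for i
  have \<alpha>\<alpha>': "\<alpha> - \<alpha>' \<noteq> 0" using m(3) by simp
  have v_in: "v j \<in> mpolys (2 * d)" if "j < d" for j
    unfolding v_def using that by (intro subring_mult[OF is_subring_mpolys] subring_diff[OF is_subring_mpolys] const_mpoly_in_mpolys tau_in tau'_in)
  have u_in: "u j \<in> mpolys (2 * d)" if "j < d" for j
    unfolding u_def using that by (intro subring_mult[OF is_subring_mpolys] subring_diff[OF is_subring_mpolys] const_mpoly_in_mpolys tau_in v_in)
  interpret c: comm_ring_hom "const_mpoly :: 'm \<Rightarrow> _" by (rule const_mpoly_hom)
  have tau_uv: "tau j = u j + const_mpoly \<alpha> * v j" for j by (simp add: u_def)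
  have tau'_uv: "tau' j = u j + const_mpoly \<alpha>' * v j" for j
  proof -
    have "const_mpoly (\<alpha> - \<alpha>') * v j = (const_mpoly (\<alpha> - \<alpha>') * const_mpoly (1 / (\<alpha> - \<alpha>'))) * (tau j - tau' j)"
      by (simp only: v_def mult.assoc)
    also have "const_mpoly (\<alpha> - \<alpha>') * const_mpoly (1 / (\<alpha> - \<alpha>')) = (1 :: 'm mpoly)"
      using \<alpha>\<alpha>' by (simp flip: c.hom_mult)
    finally have "(const_mpoly \<alpha> - const_mpoly \<alpha>') * v j = tau j - tau' j" by (simp add: c.hom_minus)
    then show ?thesis by (simp add: u_def algebra_simps)
  qed
  have p_uv: "p j = u j" "p (d + j) = v j" if "j < d" for j using that by (simp_all add: p_def)
  have "\<exists>b. \<forall>i<2 * d. \<exists>y\<in>K. mev (\<lambda>c. c) b (p i) = y * mev (\<lambda>c. c) b 1"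
  \<comment> \<open>The map is onto over the algebraic closure, so there is no exceptional locus and
    \<open>g = 1\<close>.\<close>
  proof (rule PAC_over_affineD[OF PAC, where n = "2 * d" and g = 1])
    fix i assume i: "i < 2 * d"
    show "p i \<in> mpolys (2 * d)"
      using i u_in[of i] v_in[of "i - d"] by (auto simp: p_def)
    show "(1 :: 'm mpoly) \<in> mpolys (2 * d)" by (rule subring_one[OF is_subring_mpolys])
    show "(1 :: 'm mpoly) \<noteq> 0" by simp
  next
    show "(1 :: 'm alg_closure mpoly) \<in> mpolys (2 * d)" by (rule subring_one[OF is_subring_mpolys])
    show "(1 :: 'm alg_closure mpoly) \<noteq> 0" by simp
  next
    fix y :: "nat \<Rightarrow> 'm alg_closure"
    obtain a where a: "\<And>j. j < d \<Longrightarrow> mev to_ac a (tau j) = y j + to_ac \<alpha> * y (d + j) \<and> mev to_ac a (tau' j) = y j + to_ac \<alpha>' * y (d + j)"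
      using gpoly_surj[of "\<lambda>j. y j + to_ac \<alpha> * y (d + j)" "\<lambda>j. y j + to_ac \<alpha>' * y (d + j)"] by blast
    interpret e: comm_ring_hom "mev to_ac a :: 'm mpoly \<Rightarrow> _" by (rule comm_ring_hom.comm_ring_hom_mev[OF to_ac_hom])
    have ec: "mev to_ac a (const_mpoly c) = to_ac c" for c by (rule comm_ring_hom.mev_const[OF to_ac_hom])
    have v: "mev to_ac a (v j) = y (d + j)" if "j < d" for j
    proof -
      have "mev to_ac a (v j) = to_ac (1 / (\<alpha> - \<alpha>')) * ((to_ac \<alpha> - to_ac \<alpha>') * y (d + j))"
        using a[OF that] by (simp add: v_def e.hom_mult e.hom_minus ec algebra_simps)
      also have "\<dots> = to_ac (1 / (\<alpha> - \<alpha>') * (\<alpha> - \<alpha>')) * y (d + j)" by (simp only: to_ac_mult to_ac_diff mult.assoc)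
      also have "\<dots> = y (d + j)" using \<alpha>\<alpha>' by simp
      finally show ?thesis .
    qed
    have u: "mev to_ac a (u j) = y j" if "j < d" for j
      using a[OF that] v[OF that] by (simp add: u_def e.hom_mult e.hom_minus ec)
    have "mev to_ac a (p i) = y i" if "i < 2 * d" for i
      using u[of i] v[of "i - d"] that by (auto simp: p_def)
    then show "\<exists>a. \<forall>i<2 * d. mev to_ac a (1 :: 'm mpoly) \<noteq> 0 \<and> mev to_ac a (p i) = y i * mev to_ac a 1"
      by (intro exI[of _ a]) (simp add: e.hom_one)
  next
    fix E and i :: nat assume E: "is_subfield E" "range (\<lambda>c. gen_const (to_ac c)) \<subseteq> E"
      and pE: "\<And>i. i < 2 * d \<Longrightarrow> Fract (lift_mpoly (p i)) (lift_mpoly 1) \<in> E" and i: "i < 2 * d"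
    note sr = is_subfield_imp_subring[OF E(1)]
    define G where "G p = Fract (lift_mpoly p) 1" for p :: "'m mpoly"
    have G: "comm_ring_hom G" unfolding G_def[abs_def] by (rule comm_ring_hom_compose[OF Fract_one_hom lift_mpoly_hom])
    interpret G: comm_ring_hom G by (rule G)
    interpret l: comm_ring_hom "lift_mpoly :: 'm mpoly \<Rightarrow> _" by (rule lift_mpoly_hom)
    have Gc: "G (const_mpoly c) \<in> E" for c using E(2) by (auto simp: G_def lift_mpoly_const gen_const_def)
    have uE: "G (u j) \<in> E" and vE: "G (v j) \<in> E" if "j < d" for j
      using pE[of j] pE[of "d + j"] p_uv[OF that] that by (simp_all add: G_def l.hom_one)
    have t: "G (tau j) \<in> E" if "j < d" for j
      unfolding tau_uv G.hom_add G.hom_mult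
      by (intro subring_add[OF sr] subring_mult[OF sr] uE[OF that] vE[OF that] Gc)
    have t': "G (tau' j) \<in> E" if "j < d" for j
      unfolding tau'_uv G.hom_add G.hom_mult
      by (intro subring_add[OF sr] subring_mult[OF sr] uE[OF that] vE[OF that] Gc)
    show "gen_var i \<in> sepgen E"
    proof (cases "i < d")
      case True
      show ?thesis by (rule gen_var_sepgen_root[OF E(1) _ True]) (use t' in \<open>simp add: G_def\<close>)
    next
      case False
      have "gen_var (d + (i - d)) \<in> sepgen E"
        by (rule gen_var_sepgen_zeta[OF E]) (use t i in \<open>auto simp: G_def\<close>)
      then show ?thesis using False by simp
    qed
  qed
  then obtain b where b: "\<And>i. i < 2 * d \<Longrightarrow> \<exists>y\<in>K. mev (\<lambda>c. c) b (p i) = y * mev (\<lambda>c. c) b 1" by blast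
  let ?e = "mev (\<lambda>c. c) b :: 'm mpoly \<Rightarrow> 'm"
  have e: "comm_ring_hom ?e" by (rule comm_ring_hom.comm_ring_hom_mev[OF id_hom])
  interpret e: comm_ring_hom ?e by (rule e)
  have ec: "?e (const_mpoly c) = c" for c using comm_ring_hom.mev_const[OF id_hom, of b c] by simp
  have bK: "?e (p i) \<in> K" if "i < 2 * d" for i using b[OF that] by (auto simp: e.hom_one)
  have uK: "?e (u j) \<in> K" and vK: "?e (v j) \<in> K" if "j < d" for j
    using bK[of j] bK[of "d + j"] p_uv[OF that] that by simp_all
  define U where "U = Polynomial.monom 1 d + poly_of_fun d (\<lambda>j. ?e (u j))"
  define W where "W = poly_of_fun d (\<lambda>j. ?e (v j))"
  have UK: "U \<in> polys_over K" and WK: "W \<in> polys_over K"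
    using uK vK subring_one[OF K] subring_zero[OF K] subring_add[OF K]
    by (auto simp: U_def W_def polys_over_def coeff_poly_of_fun Polynomial.coeff_monom)
  have "U + smult \<alpha>' W = Polynomial.monom 1 d + poly_of_fun d (\<lambda>j. ?e (tau' j))"
    by (rule poly_eqI) (auto simp: U_def W_def coeff_poly_of_fun tau'_uv e.hom_add e.hom_mult ec)
  then have "poly (U + smult \<alpha>' W) (?e (mvar 0)) = 0" using tau'_root[OF e] by simp
  from galois_transfer_root[OF galois m(1,2) UK WK this] obtain s where "poly (U + smult \<alpha> W) s = 0" by blast
  moreover have "U + smult \<alpha> W = map_poly ?e gpoly"
    unfolding map_poly_of_gpoly[OF e]
    by (rule poly_eqI) (auto simp: U_def W_def coeff_poly_of_fun tau_uv e.hom_add e.hom_mult ec)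
  ultimately show False using gpoly_no_rational_root by metis
qed

section \<open>Discrete valuation rings in finitely generated fields\<close>

text \<open>D is a discrete valuation ring of E with uniformiser \<pi>, described without a
  valuation map: k is minus the order of x.\<close>

definition dvr :: "'a::Fields.field set \<Rightarrow> 'a set \<Rightarrow> 'a \<Rightarrow> bool" where
  "dvr E D \<pi> \<longleftrightarrow> is_subfield E \<and> is_subring D \<and> D \<subseteq> E \<and> \<pi> \<in> D \<and> \<pi> \<noteq> 0 \<and> inverse \<pi> \<notin> D \<and>
     (\<forall>x\<in>E. x \<noteq> 0 \<longrightarrow> (\<exists>k::int. x * \<pi> powi k \<in> D \<and> inverse (x * \<pi> powi k) \<in> D))"

text \<open>Localisation at the prime ideal generated by \<pi>, applied below to the image of the
  integers with the prime 2 and to F[a] with the prime a. Finite divisibility by \<pi>, in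
  \<open>decomp\<close>, makes the valuation discrete.\<close>

lemma dvr_localization:
  fixes A :: "'a::Fields.field set"
  assumes A: "is_subring A" and \<pi>: "\<pi> \<in> A" "\<pi> \<noteq> 0"
    and prime: "\<And>a b. a \<in> A \<Longrightarrow> b \<in> A \<Longrightarrow> \<exists>c\<in>A. a * b = \<pi> * c \<Longrightarrow> (\<exists>c\<in>A. a = \<pi> * c) \<or> (\<exists>c\<in>A. b = \<pi> * c)"
    and nonunit: "\<not> (\<exists>c\<in>A. 1 = \<pi> * c)"
    and decomp: "\<And>a. a \<in> A \<Longrightarrow> a \<noteq> 0 \<Longrightarrow> \<exists>k. \<exists>a'\<in>A. a = \<pi> ^ k * a' \<and> \<not> (\<exists>c\<in>A. a' = \<pi> * c)"
  shows "dvr {a / b |a b. a \<in> A \<and> b \<in> A \<and> b \<noteq> 0} {a / b |a b. a \<in> A \<and> b \<in> A \<and> \<not> (\<exists>c\<in>A. b = \<pi> * c)} \<pi>"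
    (is "dvr ?E ?D \<pi>")
proof -
  note A_simps = subring_one[OF A] subring_mult[OF A] subring_diff[OF A] subring_zero[OF A]
  have nz: "b \<noteq> 0" if "\<not> (\<exists>c\<in>A. b = \<pi> * c)" for b using that A_simps(4) by fastforce
  have E: "is_subfield ?E"
    unfolding is_subfield_def
  proof (intro conjI ballI)
    show "1 \<in> ?E" using A_simps by (intro CollectI exI[of _ 1]) auto
    fix x assume "x \<in> ?E"
    then obtain a b where x: "a \<in> A" "b \<in> A" "b \<noteq> 0" "x = a / b" by blast
    show "inverse x \<in> ?E"
    proof (cases "a = 0")
      case True
      then show ?thesis using x A_simps by (intro CollectI exI[of _ 0] exI[of _ 1]) auto
    next
      case False
      then show ?thesis using x by (intro CollectI exI[of _ b] exI[of _ a]) auto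
    qed
    fix y assume "y \<in> ?E"
    then obtain c d where y: "c \<in> A" "d \<in> A" "d \<noteq> 0" "y = c / d" by blast
    have "x - y = (a * d - c * b) / (b * d)" "x * y = (a * c) / (b * d)" using x y by (simp_all add: field_simps)
    moreover have "a * d - c * b \<in> A" "a * c \<in> A" "b * d \<in> A" "b * d \<noteq> 0" using x y A_simps by auto
    ultimately show "x - y \<in> ?E" "x * y \<in> ?E" by blast+
  qed
  have D: "is_subring ?D"
    unfolding is_subring_def
  proof (intro conjI ballI)
    show "1 \<in> ?D" using A_simps nonunit by (intro CollectI exI[of _ 1]) auto
    fix x y assume "x \<in> ?D" "y \<in> ?D"
    then obtain a b c d where x: "a \<in> A" "b \<in> A" "\<not> (\<exists>c\<in>A. b = \<pi> * c)" "x = a / b"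
      and y: "c \<in> A" "d \<in> A" "\<not> (\<exists>c\<in>A. d = \<pi> * c)" "y = c / d" by blast
    have "x - y = (a * d - c * b) / (b * d)" "x * y = (a * c) / (b * d)"
      using x(4) y(4) nz[OF x(3)] nz[OF y(3)] by (simp_all add: field_simps)
    moreover have "a * d - c * b \<in> A" "a * c \<in> A" "b * d \<in> A" using x y A_simps by auto
    moreover have "\<not> (\<exists>c\<in>A. b * d = \<pi> * c)" using prime[OF x(2) y(2)] x(3) y(3) by blast
    ultimately show "x - y \<in> ?D" "x * y \<in> ?D" by blast+
  qed
  have sub: "?D \<subseteq> ?E" using nz by blast
  have \<pi>D: "\<pi> \<in> ?D" using \<pi> A_simps nonunit by (intro CollectI exI[of _ \<pi>] exI[of _ 1]) auto
  have inv: "inverse \<pi> \<notin> ?D"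
  proof
    assume "inverse \<pi> \<in> ?D"
    then obtain a b where ab: "a \<in> A" "b \<in> A" "\<not> (\<exists>c\<in>A. b = \<pi> * c)" "inverse \<pi> = a / b" by blast
    have "b = \<pi> * a" using ab(4) nz[OF ab(3)] \<pi>(2) by (simp add: field_simps)
    then show False using ab(1,3) by blast
  qed
  have "\<exists>k::int. x * \<pi> powi k \<in> ?D \<and> inverse (x * \<pi> powi k) \<in> ?D" if xE: "x \<in> ?E" and x0: "x \<noteq> 0" for x
  proof -
    obtain a b where x: "a \<in> A" "b \<in> A" "b \<noteq> 0" "x = a / b" using xE by blast
    have "a \<noteq> 0" using x x0 by auto
    obtain k a' where a': "a' \<in> A" "a = \<pi> ^ k * a'" "\<not> (\<exists>c\<in>A. a' = \<pi> * c)" using decomp[OF x(1) \<open>a \<noteq> 0\<close>] by blast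
    obtain l b' where b': "b' \<in> A" "b = \<pi> ^ l * b'" "\<not> (\<exists>c\<in>A. b' = \<pi> * c)" using decomp[OF x(2,3)] by blast
    \<comment> \<open>The orders of a and b are k and l, so x has order k - l, and this exponent
      cancels it.\<close>
    have eq: "x * \<pi> powi (int l - int k) = a' / b'"
      using \<pi>(2) nz[OF a'(3)] nz[OF b'(3)] unfolding x(4) a'(2) b'(2) by (simp add: power_int_diff field_simps)
    show ?thesis
    proof (intro exI[of _ "int l - int k"] conjI)
      show "x * \<pi> powi (int l - int k) \<in> ?D" unfolding eq using a'(1) b'(1,3) by blast
      have "inverse (x * \<pi> powi (int l - int k)) = b' / a'" unfolding eq by simp
      then show "inverse (x * \<pi> powi (int l - int k)) \<in> ?D" using b'(1) a'(1,3) by (simp only: mem_Collect_eq) blast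
    qed
  qed
  with E D sub \<pi>D inv \<pi>(2) show ?thesis unfolding dvr_def by blast
qed

text \<open>A valuation ring dominating a given local ring is a maximal subring in which \<open>\<pi>\<close> stays a nonunit.\<close>

lemma valuation_ring_exists:
  fixes D :: "'a::Fields.field set"
  assumes D: "is_subring D" "\<pi> \<in> D" "\<pi> \<noteq> 0" "inverse \<pi> \<notin> D"
  shows "\<exists>R. is_subring R \<and> D \<subseteq> R \<and> inverse \<pi> \<notin> R \<and> (\<forall>x. x \<in> R \<or> inverse x \<in> R)"
proof -
  define A where "A = {R. is_subring R \<and> D \<subseteq> R \<and> inverse \<pi> \<notin> R}"
  have "\<exists>M\<in>A. \<forall>Y\<in>A. M \<subseteq> Y \<longrightarrow> Y = M"
  proof (rule subset_Zorn_nonempty)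
    show "A \<noteq> {}" using D by (auto simp: A_def)
    fix C assume C: "C \<noteq> {}" "subset.chain A C"
    have CA: "C \<subseteq> A" using C(2) by (simp add: subset.chain_def)
    have common: "\<exists>R\<in>C. x \<in> R \<and> y \<in> R" if "x \<in> \<Union>C" "y \<in> \<Union>C" for x y
      using that C(2) unfolding subset.chain_def by blast
    have sr: "is_subring R" if "R \<in> C" for R using CA that by (auto simp: A_def)
    have "is_subring (\<Union>C)"
      unfolding is_subring_def
    proof (intro conjI ballI)
      show "1 \<in> \<Union>C" using C(1) sr subring_one by blast
      fix x y assume "x \<in> \<Union>C" "y \<in> \<Union>C"
      then obtain R where R: "R \<in> C" "x \<in> R" "y \<in> R" using common by blast
      show "x - y \<in> \<Union>C" using subring_diff[OF sr[OF R(1)] R(2,3)] R(1) by blast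
      show "x * y \<in> \<Union>C" using subring_mult[OF sr[OF R(1)] R(2,3)] R(1) by blast
    qed
    moreover have "D \<subseteq> \<Union>C" using C(1) CA unfolding A_def by blast
    moreover have "inverse \<pi> \<notin> \<Union>C" using CA unfolding A_def by blast
    ultimately show "\<Union>C \<in> A" by (simp add: A_def)
  qed
  then obtain R where RA: "R \<in> A" and Rm: "\<forall>Y\<in>A. R \<subseteq> Y \<longrightarrow> Y = R" by (rule bexE)
  have R: "is_subring R" "D \<subseteq> R" "inverse \<pi> \<notin> R" using RA by (simp_all add: A_def)
  have max: "Y = R" if "is_subring Y" "R \<subseteq> Y" "inverse \<pi> \<notin> Y" for Y
    using Rm that R(2) by (simp add: A_def)
  have \<pi>R: "\<pi> \<in> R" using D R by blast
  note Rs = subring_one[OF R(1)] subring_mult[OF R(1)] subring_diff[OF R(1)] subring_add[OF R(1)] subring_zero[OF R(1)]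
  have no_inv: False if "c \<in> R" "\<pi> * c = 1" for c
  proof -
    have "c = inverse \<pi>" using that(2) by (metis inverse_unique)
    then show False using that(1) R(3) by simp
  qed
  \<comment> \<open>Every power of u = 1 - \<pi> b is 1 minus a multiple of \<pi>. Hence \<pi> stays
    a nonunit after inverting u, and maximality puts the inverse of u into R.\<close>
  have unit: "1 - \<pi> * b \<noteq> 0 \<and> inverse (1 - \<pi> * b) \<in> R" if b: "b \<in> R" for b
  proof -
    define u where "u = 1 - \<pi> * b"
    have uR: "u \<in> R" unfolding u_def by (intro Rs(1,2,3) b \<pi>R)
    have u0: "u \<noteq> 0" using no_inv[OF b] by (auto simp: u_def)
    have upow: "\<exists>c\<in>R. u ^ k = 1 - \<pi> * c" for k
    proof (induction k)
      case 0
      show ?case using Rs(5) by (intro bexI[of _ 0]) auto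
    next
      case (Suc k)
      then obtain c where c: "c \<in> R" "u ^ k = 1 - \<pi> * c" by blast
      have "u ^ Suc k = 1 - \<pi> * (b + c - \<pi> * b * c)" unfolding power_Suc c(2) by (simp add: u_def algebra_simps)
      moreover have "b + c - \<pi> * b * c \<in> R" by (intro Rs(2,3,4) b c(1) \<pi>R)
      ultimately show ?case by blast
    qed
    define Y where "Y = {r / u ^ k |r k. r \<in> R}"
    have YI: "r / u ^ k \<in> Y" if "r \<in> R" for r k using that by (auto simp: Y_def)
    have "is_subring Y"
      unfolding is_subring_def
    proof (intro conjI ballI)
      show "1 \<in> Y" using YI[OF Rs(1), of 0] by simp
      fix x y assume "x \<in> Y" "y \<in> Y"
      then obtain r k s l where x: "r \<in> R" "x = r / u ^ k" and y: "s \<in> R" "y = s / u ^ l" by (auto simp: Y_def)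
      have "x - y = (r * u ^ l - s * u ^ k) / u ^ (k + l)" "x * y = (r * s) / u ^ (k + l)"
        using u0 by (simp_all add: x y field_simps power_add)
      moreover have "r * u ^ l - s * u ^ k \<in> R" "r * s \<in> R"
        by (intro Rs(2,3) x(1) y(1) subring_power[OF R(1)] uR)+
      ultimately show "x - y \<in> Y" "x * y \<in> Y" using YI by simp_all
    qed
    moreover have "R \<subseteq> Y" using YI[of _ 0] by force
    moreover have "inverse \<pi> \<notin> Y"
    proof
      assume "inverse \<pi> \<in> Y"
      then obtain r k where r: "r \<in> R" "inverse \<pi> = r / u ^ k" by (auto simp: Y_def)
      obtain c where c: "c \<in> R" "u ^ k = 1 - \<pi> * c" using upow by blast
      have "u ^ k = \<pi> * r" using r(2) D(3) u0 by (simp add: field_simps)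
      then have "\<pi> * (r + c) = 1" using c(2) by (simp add: algebra_simps)
      then show False by (rule no_inv[rotated]) (intro Rs(4) r(1) c(1))
    qed
    ultimately have "Y = R" by (rule max)
    then show ?thesis using YI[OF Rs(1), of 1] u0 by (simp add: u_def inverse_eq_divide)
  qed
  \<comment> \<open>By maximality, adjoining an element outside R must make \<pi>
    invertible.\<close>
  have adjoin: "\<exists>p\<in>polys_over R. \<pi> * poly p x = 1" if x: "x \<notin> R" for x
  proof -
    note pR = is_subring_polys_over[OF R(1)]
    define Y where "Y = (\<lambda>p. poly p x) ` polys_over R"
    have "is_subring Y"
      unfolding is_subring_def
    proof (intro conjI ballI)
      show "1 \<in> Y" unfolding Y_def using subring_one[OF pR] by (metis image_eqI poly_1)
      fix u v assume "u \<in> Y" "v \<in> Y"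
      then obtain p q where "p \<in> polys_over R" "u = poly p x" "q \<in> polys_over R" "v = poly q x" by (auto simp: Y_def)
      then have "u - v = poly (p - q) x" "u * v = poly (p * q) x" "p - q \<in> polys_over R" "p * q \<in> polys_over R"
        using subring_diff[OF pR] subring_mult[OF pR] by auto
      then show "u - v \<in> Y" "u * v \<in> Y" unfolding Y_def by blast+
    qed
    moreover have "R \<subseteq> Y"
    proof
      fix r assume "r \<in> R"
      then have "[:r:] \<in> polys_over R" by (rule polys_over_const[OF R(1)])
      moreover have "r = poly [:r:] x" by simp
      ultimately show "r \<in> Y" unfolding Y_def by blast
    qed
    moreover have "x \<in> Y"
    proof -
      have "x = poly [:0, 1:] x" by simp
      then show ?thesis unfolding Y_def using polys_over_X[OF R(1)] by blast
    qed
    ultimately have "inverse \<pi> \<in> Y" using max[of Y] x by blast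
    then obtain p where "p \<in> polys_over R" "poly p x = inverse \<pi>" by (auto simp: Y_def)
    then show ?thesis using D(3) by (intro bexI[of _ p]) auto
  qed
  define P where "P x p \<longleftrightarrow> p \<in> polys_over R \<and> \<pi> * poly p x = 1" for x p
  text \<open>If the degrees of both relations are minimal, the shorter one can be used to reduce the longer one.\<close>
  have reduce: False if p: "P x p" and q: "P (inverse x) q" and x0: "x \<noteq> 0"
    and pmin: "\<And>p'. P x p' \<Longrightarrow> Polynomial.degree p \<le> Polynomial.degree p'" and le: "Polynomial.degree q \<le> Polynomial.degree p" for x p q
  proof -
    note pR = is_subring_polys_over[OF R(1)]
    define s where "s = Polynomial.degree p"
    define t where "t = Polynomial.degree q"
    have pRin: "p \<in> polys_over R" and pc: "\<And>i. Polynomial.coeff p i \<in> R" and qc: "\<And>i. Polynomial.coeff q i \<in> R"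
      using p q by (auto simp: P_def polys_over_def)
    have s0: "s > 0"
    proof (rule ccontr)
      assume "\<not> s > 0"
      then obtain c where c: "p = [:c:]" by (metis s_def degree_eq_zeroE neq0_conv)
      then have "c \<in> R" using pc[of 0] by simp
      moreover have "\<pi> * c = 1" using p c by (simp add: P_def)
      ultimately show False by (rule no_inv)
    qed
    define b0 where "b0 = Polynomial.coeff q 0"
    define v where "v = inverse (1 - \<pi> * b0)"
    have v: "1 - \<pi> * b0 \<noteq> 0" "v \<in> R" using unit[OF qc[of 0]] by (auto simp: v_def b0_def)
    \<comment> \<open>The relation for the inverse of x, multiplied by x^s and divided by the unit 1
      - \<pi> b0, becomes x^s = \<pi> w(x) with w of degree below s. The exponents s - j are genuine
      differences because q has degree at most s.\<close>
    define w where "w = (\<Sum>j\<in>{1..t}. Polynomial.monom (v * Polynomial.coeff q j) (s - j))"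
    have wR: "w \<in> polys_over R"
      unfolding w_def using v(2) qc Rs(2) by (intro subring_sum[OF pR] polys_over_monom[OF R(1)]) auto
    have "{..t} = insert 0 {1..t}" by auto
    then have "poly q (inverse x) = b0 + (\<Sum>j\<in>{1..t}. Polynomial.coeff q j * inverse x ^ j)"
      by (simp add: poly_altdef t_def b0_def)
    then have "\<pi> * (\<Sum>j\<in>{1..t}. Polynomial.coeff q j * inverse x ^ j) = 1 - \<pi> * b0"
      using q by (simp add: P_def algebra_simps)
    then have "x ^ s * (v * (1 - \<pi> * b0)) = x ^ s * (v * (\<pi> * (\<Sum>j\<in>{1..t}. Polynomial.coeff q j * inverse x ^ j)))" by simp
    also have "\<dots> = \<pi> * (\<Sum>j\<in>{1..t}. v * Polynomial.coeff q j * (x ^ s * inverse x ^ j))"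
      by (simp add: sum_distrib_left mult_ac)
    also have "(\<Sum>j\<in>{1..t}. v * Polynomial.coeff q j * (x ^ s * inverse x ^ j)) = poly w x"
    proof -
      have "x ^ s * inverse x ^ j = x ^ (s - j)" if "j \<in> {1..t}" for j
        using that le x0 by (simp add: s_def t_def power_diff field_simps power_inverse)
      then show ?thesis by (simp add: w_def poly_sum poly_monom)
    qed
    also have "x ^ s * (v * (1 - \<pi> * b0)) = x ^ s" using v(1) by (simp add: v_def)
    finally have xs: "x ^ s = \<pi> * poly w x" .
    define p' where "p' = (p - Polynomial.monom (Polynomial.coeff p s) s) + smult (Polynomial.coeff p s * \<pi>) w"
    have "p' \<in> polys_over R"
      unfolding p'_def using pRin pc \<pi>R Rs(2) wR
      by (intro subring_add[OF pR] subring_diff[OF pR] polys_over_monom[OF R(1)] polys_over_smult[OF R(1)]) auto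
    moreover have "poly p' x = poly p x"
      by (simp add: p'_def poly_monom xs mult_ac)
    ultimately have "P x p'" using p by (simp add: P_def)
    then have "s \<le> Polynomial.degree p'" using pmin by (simp add: s_def)
    moreover have "Polynomial.degree p' \<le> s - 1"
    proof (rule degree_le, intro allI impI)
      fix i assume i: "s - 1 < i"
      have "Polynomial.coeff w i = 0" using i s0 by (auto simp: w_def coeff_sum Polynomial.coeff_monom intro!: sum.neutral)
      moreover have "Polynomial.coeff (p - Polynomial.monom (Polynomial.coeff p s) s) i = 0"
        using i by (cases "i = s") (auto simp: s_def coeff_eq_0)
      ultimately show "Polynomial.coeff p' i = 0" by (simp add: p'_def)
    qed
    ultimately show False using s0 by simp
  qed
  have "x \<in> R \<or> inverse x \<in> R" for x
  proof (rule ccontr)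
    assume n: "\<not> (x \<in> R \<or> inverse x \<in> R)"
    then have x0: "x \<noteq> 0" using Rs(5) by auto
    have ex: "\<exists>p. P x p" "\<exists>q. P (inverse x) q" using adjoin n unfolding P_def by blast+
    obtain p where p: "P x p" "\<And>p'. P x p' \<Longrightarrow> Polynomial.degree p \<le> Polynomial.degree p'"
      using ex_has_least_nat[of "P x" _ Polynomial.degree] ex(1) by metis
    obtain q where q: "P (inverse x) q" "\<And>q'. P (inverse x) q' \<Longrightarrow> Polynomial.degree q \<le> Polynomial.degree q'"
      using ex_has_least_nat[of "P (inverse x)" _ Polynomial.degree] ex(2) by metis
    show False
    proof (cases "Polynomial.degree q \<le> Polynomial.degree p")
      case True
      then show False using reduce[OF p(1) q(1) x0 p(2)] by blast
    next
      case False
      have "P (inverse (inverse x)) p" using p(1) by simp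
      from reduce[OF q(1) this _ q(2)] False x0 show False by simp
    qed
  qed
  with R show ?thesis by blast
qed

text \<open>Two nonzero elements have the same value when their quotient is a \<open>vunit\<close>;
  no value group is constructed.\<close>

definition vunit :: "'a::Fields.field set \<Rightarrow> 'a \<Rightarrow> bool" where
  "vunit R z \<longleftrightarrow> z \<noteq> 0 \<and> z \<in> R \<and> inverse z \<in> R"

lemma vunit_mult: "is_subring R \<Longrightarrow> vunit R x \<Longrightarrow> vunit R y \<Longrightarrow> vunit R (x * y)"
  by (auto simp: vunit_def subring_mult)

lemma vunit_inverse: "vunit R x \<Longrightarrow> vunit R (inverse x)"
  by (auto simp: vunit_def)

lemma vunit_power: "is_subring R \<Longrightarrow> vunit R x \<Longrightarrow> vunit R (x ^ k)"
  by (induction k) (simp_all add: vunit_mult, simp add: vunit_def subring_one)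

lemma vunit_divide: "is_subring R \<Longrightarrow> vunit R x \<Longrightarrow> vunit R y \<Longrightarrow> vunit R (x / y)"
  using vunit_mult[of R x "inverse y"] vunit_inverse[of R y] by (simp add: field_class.field_divide_inverse)

text \<open>The least value in a vanishing sum is attained at least twice. Otherwise, after division
  by a term of least value, all other terms would be nonunits of R, and their sum could not be the
  unit -1.\<close>

lemma sum_zero_equal_values:
  fixes T :: "'i \<Rightarrow> 'a::Fields.field"
  assumes R: "is_subring R" and val: "\<And>x. x \<in> R \<or> inverse x \<in> R"
    and I: "finite I" and nz: "\<And>i. i \<in> I \<Longrightarrow> T i \<noteq> 0" and ne: "I \<noteq> {}" and sum0: "sum T I = 0"
  shows "\<exists>i\<in>I. \<exists>j\<in>I. i \<noteq> j \<and> vunit R (T i / T j)"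
proof -
  have nonunit_add: "a + b \<in> R \<and> \<not> vunit R (a + b)" if "a \<in> R" "\<not> vunit R a" "b \<in> R" "\<not> vunit R b" for a b
  proof (intro conjI notI)
    show "a + b \<in> R" using that subring_add[OF R] by blast
    assume u: "vunit R (a + b)"
    \<comment> \<open>In a valuation ring one of a and b divides the other. If b divides a, then a +
      b is a multiple of b, and a unit only if b is.\<close>
    have *: False if ab: "a \<in> R" "b \<in> R" "\<not> vunit R b" "a / b \<in> R" "vunit R (a + b)" "b \<noteq> 0" for a b
    proof -
      have "inverse b = (a / b + 1) * inverse (a + b)" using ab(5,6) by (simp add: field_simps vunit_def)
      also have "\<dots> \<in> R" using ab(4,5) by (intro subring_mult[OF R] subring_add[OF R] subring_one[OF R]) (auto simp: vunit_def)
      finally show False using ab by (auto simp: vunit_def)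
    qed
    show False
    proof (cases "a = 0 \<or> b = 0")
      case True
      then show ?thesis using u that by auto
    next
      case False
      have "a / b \<in> R \<or> b / a \<in> R" using val[of "a / b"] by simp
      then show ?thesis using *[of a b] *[of b a] that u False by (auto simp: add.commute)
    qed
  qed
  \<comment> \<open>Divisibility in R is total, so in every finite nonempty family some term divides
    all the others.\<close>
  have min: "\<exists>j\<in>J. \<forall>i\<in>J. T i / T j \<in> R" if "finite J" "J \<noteq> {}" "J \<subseteq> I" for J
    using that
  proof (induction J rule: finite_ne_induct)
    case (singleton x)
    then show ?case using subring_one[OF R] nz by auto
  next
    case (insert x J)
    then obtain j where j: "j \<in> J" "\<forall>i\<in>J. T i / T j \<in> R" by blast
    have xj: "T x \<noteq> 0" "T j \<noteq> 0" using insert j nz by auto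
    show ?case
    proof (cases "T x / T j \<in> R")
      case True
      then show ?thesis using j by auto
    next
      case False
      then have jx: "T j / T x \<in> R" using val[of "T x / T j"] by simp
      have "T i / T x \<in> R" if "i \<in> J" for i
      proof -
        have "T i / T x = (T i / T j) * (T j / T x)" using xj by simp
        then show ?thesis using subring_mult[OF R] j(2) that jx by metis
      qed
      then show ?thesis using xj subring_one[OF R] by (intro bexI[of _ x]) auto
    qed
  qed
  obtain j where j: "j \<in> I" "\<And>i. i \<in> I \<Longrightarrow> T i / T j \<in> R" using min[OF I ne] by blast
  show ?thesis
  proof (rule ccontr)
    assume n: "\<not> ?thesis"
    have "(\<Sum>i\<in>J. T i / T j) \<in> R \<and> \<not> vunit R (\<Sum>i\<in>J. T i / T j)" if "finite J" "J \<subseteq> I - {j}" for J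
      using that
    proof (induction J)
      case empty
      then show ?case using subring_zero[OF R] by (simp add: vunit_def)
    next
      case (insert x J)
      then have "T x / T j \<in> R" "\<not> vunit R (T x / T j)" using j n by auto
      then show ?case using insert nonunit_add by simp
    qed
    from this[of "I - {j}"] have "\<not> vunit R (\<Sum>i\<in>I - {j}. T i / T j)" using I by blast
    moreover have "(\<Sum>i\<in>I - {j}. T i / T j) = - 1"
    proof -
      have "0 = (\<Sum>i\<in>I. T i / T j)" using sum0 by (simp flip: sum_divide_distrib)
      also have "\<dots> = T j / T j + (\<Sum>i\<in>I - {j}. T i / T j)" by (rule sum.remove[OF I j(1)])
      finally show ?thesis using nz[OF j(1)] by (simp add: eq_neg_iff_add_eq_0 add.commute)
    qed
    moreover have "vunit R (- 1)" using subring_uminus[OF R subring_one[OF R]] by (simp add: vunit_def)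
    ultimately show False by simp
  qed
qed

section \<open>Values on a field of bounded degree over a discretely valued subfield\<close>

context
  fixes E D R :: "'a::Fields.field set" and \<pi> :: 'a and N :: nat
  assumes dvr: "dvr E D \<pi>" and R: "is_subring R" "D \<subseteq> R" "inverse \<pi> \<notin> R" and val: "\<And>x. x \<in> R \<or> inverse x \<in> R"
    and bounded: "\<And>x. \<exists>p\<in>polys_over E. p \<noteq> 0 \<and> poly p x = 0 \<and> Polynomial.degree p \<le> N"
begin

lemma pi_nonzero: "\<pi> \<noteq> 0" and pi_in: "\<pi> \<in> R"
  using dvr R by (auto simp: dvr_def)

text \<open>For either sign of k, the inverse of some \<pi>^(l + 1) would lie in R, and multiplying
  by \<pi>^l would give the inverse of \<pi> itself.\<close>

lemma vunit_pi_powi: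
  assumes "vunit R (\<pi> powi k)"
  shows "k = 0"
proof (rule ccontr)
  assume k: "k \<noteq> 0"
  have "\<exists>l. inverse (\<pi> ^ Suc l) \<in> R"
  proof (cases "k > 0")
    case True
    then obtain l where "k = int (Suc l)" by (metis gr0_implies_Suc pos_int_cases)
    then show ?thesis using assms by (auto simp: vunit_def simp del: power_Suc of_nat_Suc)
  next
    case False
    then obtain l where "k = - int (Suc l)" using k by (metis gr0_implies_Suc pos_int_cases linorder_neqE neg_0_less_iff_less minus_minus)
    then show ?thesis using assms by (auto simp: vunit_def power_int_minus simp del: power_Suc of_nat_Suc)
  qed
  then obtain l where "inverse (\<pi> ^ Suc l) \<in> R" ..
  then have "\<pi> ^ l * inverse (\<pi> ^ Suc l) \<in> R" using subring_mult[OF R(1)] subring_power[OF R(1) pi_in] by blast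
  moreover have "\<pi> ^ l * inverse (\<pi> ^ Suc l) = inverse \<pi>" using pi_nonzero by (simp add: field_simps)
  ultimately have "inverse \<pi> \<in> R" by (simp only:)
  then show False using R(3) by contradiction
qed

lemma dvr_decomp: "x \<in> E \<Longrightarrow> x \<noteq> 0 \<Longrightarrow> \<exists>k. x * \<pi> powi k \<in> D \<and> inverse (x * \<pi> powi k) \<in> D"
  using dvr unfolding dvr_def by blast

text \<open>Bounds the ramification. Two terms of an algebraic equation of z over E have equal
  value, so a power of z, with exponent the difference of the two, has the value of an element of E,
  which is that of a power of \<pi>.\<close>

lemma value_denominator:
  assumes z: "z \<noteq> 0"
  shows "\<exists>i k. 1 \<le> i \<and> i \<le> N \<and> vunit R (z ^ i * \<pi> powi k)"
proof -
  obtain p where p: "p \<in> polys_over E" "p \<noteq> 0" "poly p z = 0" "Polynomial.degree p \<le> N" using bounded by blast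
  define I where "I = {i. i \<le> Polynomial.degree p \<and> Polynomial.coeff p i \<noteq> 0}"
  define T where "T i = Polynomial.coeff p i * z ^ i" for i
  have fin: "finite I" by (auto simp: I_def)
  have ne: "I \<noteq> {}" using p(2) by (auto simp: I_def intro!: exI[of _ "Polynomial.degree p"])
  have nz: "T i \<noteq> 0" if "i \<in> I" for i using that z by (auto simp: T_def I_def)
  have "sum T I = (\<Sum>i\<le>Polynomial.degree p. T i)"
    by (rule sum.mono_neutral_left) (auto simp: I_def T_def)
  also have "\<dots> = 0" using p(3) by (simp add: poly_altdef T_def)
  finally have sum0: "sum T I = 0" .
  obtain i j where ij: "i \<in> I" "j \<in> I" "i \<noteq> j" "vunit R (T i / T j)"
    using sum_zero_equal_values[OF R(1) val fin nz ne sum0] by blast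
  have *: "\<exists>i k. 1 \<le> i \<and> i \<le> N \<and> vunit R (z ^ i * \<pi> powi k)"
    if ij: "i \<in> I" "j \<in> I" "j < i" "vunit R (T i / T j)" for i j
  proof -
    let ?c = "Polynomial.coeff p i / Polynomial.coeff p j"
    have "is_subfield E" using dvr by (simp add: dvr_def)
    then have "?c \<in> E" using p(1) by (intro subfield_divide) (auto simp: polys_over_def)
    moreover have c0: "?c \<noteq> 0" using ij by (simp add: I_def)
    ultimately obtain k where k: "?c * \<pi> powi k \<in> D" "inverse (?c * \<pi> powi k) \<in> D"
      using dvr_decomp by blast
    have "?c * \<pi> powi k \<noteq> 0" using c0 pi_nonzero by simp
    then have u: "vunit R (?c * \<pi> powi k)" unfolding vunit_def using k R(2) by blast
    have "(T i / T j) / (?c * \<pi> powi k) = z ^ (i - j) * \<pi> powi (- k)"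
      using ij z pi_nonzero c0 by (simp add: T_def I_def power_diff power_int_minus field_simps)
    then have "vunit R (z ^ (i - j) * \<pi> powi (- k))" using vunit_divide[OF R(1) ij(4) u] by simp
    moreover have "1 \<le> i - j" "i - j \<le> N" using ij p(4) by (auto simp: I_def)
    ultimately show ?thesis by blast
  qed
  show ?thesis
  proof (cases "j < i")
    case True
    then show ?thesis using * ij by blast
  next
    case False
    then have "i < j" using ij by simp
    moreover have "vunit R (T j / T i)" using vunit_inverse[OF ij(4)] by simp
    ultimately show ?thesis using * ij by blast
  qed
qed

text \<open>By \<open>value_denominator\<close>, m would divide e * i for some i between 1 and N,
  although 0 < - e * i <= 2 * N < m. The two possible e come from the differences of the exponents
  of \<pi> in the three terms of the curve.\<close>

lemma no_value:
  assumes m: "m > 2 * N" and z: "z \<noteq> 0" and e: "e = - 1 \<or> e = - 2"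
  shows "\<not> vunit R (z ^ m * \<pi> powi e)"
proof
  assume u: "vunit R (z ^ m * \<pi> powi e)"
  obtain i k where ik: "1 \<le> i" "i \<le> N" "vunit R (z ^ i * \<pi> powi k)" using value_denominator[OF z] by blast
  have "vunit R ((z ^ m * \<pi> powi e) ^ i / (z ^ i * \<pi> powi k) ^ m)"
    by (intro vunit_divide vunit_power R u ik)
  also have "(z ^ m * \<pi> powi e) ^ i / (z ^ i * \<pi> powi k) ^ m = \<pi> powi (e * int i - k * int m)"
  proof -
    have "(\<pi> powi e) ^ i = \<pi> powi (e * int i)" "(\<pi> powi k) ^ m = \<pi> powi (k * int m)"
      by (simp_all only: power_int_mult power_int_of_nat)
    then show ?thesis using z pi_nonzero
      by (simp add: power_mult_distrib power_int_diff mult.commute[of i m] flip: power_mult)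
  qed
  finally have "e * int i - k * int m = 0" by (rule vunit_pi_powi)
  then have "int m dvd e * int i" by (metis dvd_triv_right eq_iff_diff_eq_0)
  then have "int m dvd - (e * int i)" by simp
  moreover have "- (e * int i) > 0" using e ik(1) by auto
  ultimately have "int m \<le> - (e * int i)" by (rule zdvd_imp_le)
  then show False using e ik m by auto
qed

theorem fermat_no_points:
  assumes m: "m > 2 * N" "m > 0"
  shows "x ^ m + \<pi> * y ^ m + \<pi>\<^sup>2 \<noteq> 0"
proof
  assume eq: "x ^ m + \<pi> * y ^ m + \<pi>\<^sup>2 = 0"
  define T where "T i = (if i = 0 then x ^ m else if i = 1 then \<pi> * y ^ m else \<pi>\<^sup>2)" for i :: nat
  \<comment> \<open>One of x and y may be 0, so vanishing terms are dropped before values are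
    compared.\<close>
  define I where "I = {i \<in> {0, 1, 2}. T i \<noteq> 0}"
  have "sum T I = sum T {0, 1, 2}" by (rule sum.mono_neutral_left) (auto simp: I_def)
  also have "\<dots> = 0" using eq by (simp add: T_def add.assoc)
  finally have sum0: "sum T I = 0" .
  have "2 \<in> I" using pi_nonzero by (simp add: I_def T_def)
  then have ne: "I \<noteq> {}" by blast
  have "finite I" by (simp add: I_def)
  from sum_zero_equal_values[OF R(1) val this _ ne sum0] obtain i j where
    ij: "i \<in> I" "j \<in> I" "i \<noteq> j" "vunit R (T i / T j)" by (auto simp: I_def)
  have *: False if ij: "i \<in> I" "j \<in> I" "i < j" "vunit R (T i / T j)" for i j
  proof -
    have powi: "\<pi> powi (- 1) = inverse \<pi>" "\<pi> powi (- 2) = inverse (\<pi>\<^sup>2)" by (simp_all add: power_int_minus)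
    consider "i = 0 \<and> j = 1" | "i = 0 \<and> j = 2" | "i = 1 \<and> j = 2" using ij by (auto simp: I_def)
    then show False
    proof cases
      case 1
      then have "x \<noteq> 0" "y \<noteq> 0" using ij m(2) by (auto simp: I_def T_def)
      moreover have "T i / T j = (x / y) ^ m * \<pi> powi (- 1)"
        using 1 by (simp add: T_def powi power_divide field_simps)
      ultimately show ?thesis using no_value[OF m(1), of "x / y" "- 1"] ij(4) by simp
    next
      case 2
      then have "x \<noteq> 0" using ij m(2) by (auto simp: I_def T_def)
      moreover have "T i / T j = x ^ m * \<pi> powi (- 2)"
        using 2 by (simp add: T_def powi field_simps)
      ultimately show ?thesis using no_value[OF m(1), of x "- 2"] ij(4) by simp
    next
      case 3
      then have "y \<noteq> 0" using ij m(2) by (auto simp: I_def T_def)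
      moreover have "T i / T j = y ^ m * \<pi> powi (- 1)"
        using 3 pi_nonzero by (simp add: T_def powi field_simps power2_eq_square)
      ultimately show ?thesis using no_value[OF m(1), of y "- 1"] ij(4) by simp
    qed
  qed
  show False
  proof (cases "i < j")
    case True
    then show ?thesis using * ij by blast
  next
    case False
    then have "j < i" using ij by simp
    moreover have "vunit R (T j / T i)" using vunit_inverse[OF ij(4)] by simp
    ultimately show ?thesis using * ij by blast
  qed
qed

end

section \<open>Finite spans and their towers\<close>

definition lspan :: "'a::Fields.field set \<Rightarrow> 'a set \<Rightarrow> 'a set" where
  "lspan E B = {\<Sum>b\<in>B. c b * b |c. \<forall>b\<in>B. c b \<in> E}"

lemma lspanI: "(\<And>b. b \<in> B \<Longrightarrow> c b \<in> E) \<Longrightarrow> x = (\<Sum>b\<in>B. c b * b) \<Longrightarrow> x \<in> lspan E B"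
  unfolding lspan_def by (intro CollectI exI[of _ c]) simp

lemma lspanE:
  assumes "x \<in> lspan E B"
  obtains c where "\<forall>b\<in>B. c b \<in> E" "x = (\<Sum>b\<in>B. c b * b)"
  using assms unfolding lspan_def by (elim CollectE exE conjE)

lemma lspan_add:
  assumes "is_subring E" "x \<in> lspan E B" "y \<in> lspan E B"
  shows "x + y \<in> lspan E B"
proof -
  obtain c where c: "\<forall>b\<in>B. c b \<in> E" "x = (\<Sum>b\<in>B. c b * b)" using assms(2) by (rule lspanE)
  obtain d where d: "\<forall>b\<in>B. d b \<in> E" "y = (\<Sum>b\<in>B. d b * b)" using assms(3) by (rule lspanE)
  have "x + y = (\<Sum>b\<in>B. (c b + d b) * b)" by (simp add: c d sum.distrib distrib_right)
  then show ?thesis using c d subring_add[OF assms(1)] by (intro lspanI[of B "\<lambda>b. c b + d b"]) auto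
qed

lemma lspan_scaled_base:
  assumes "is_subring E" "finite B" "b \<in> B" "e \<in> E"
  shows "e * b \<in> lspan E B"
proof -
  have "(\<Sum>b'\<in>B. (if b' = b then e else 0) * b') = (\<Sum>b'\<in>B. if b' = b then e * b else 0)"
    by (intro sum.cong) auto
  also have "\<dots> = e * b" using assms by simp
  finally show ?thesis
    using subring_zero[OF assms(1)] assms(4) by (intro lspanI[of B "\<lambda>b'. if b' = b then e else 0"]) auto
qed

lemma lspan_sum:
  assumes "is_subring E" "finite B" "\<And>i. i \<in> I \<Longrightarrow> f i \<in> lspan E B"
  shows "sum f I \<in> lspan E B"
proof -
  have "0 \<in> lspan E B" using subring_zero[OF assms(1)] by (intro lspanI[of B "\<lambda>_. 0"]) auto
  with assms(3) show ?thesis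
    by (induction I rule: infinite_finite_induct) (auto intro: lspan_add[OF assms(1)])
qed

lemma finite_lspan:
  assumes "finite E" "finite B"
  shows "finite (lspan E B)"
proof -
  have "lspan E B \<subseteq> (\<lambda>c. \<Sum>b\<in>B. c b * b) ` (B \<rightarrow>\<^sub>E E)"
  proof
    fix x assume "x \<in> lspan E B"
    then obtain c where c: "\<forall>b\<in>B. c b \<in> E" "x = (\<Sum>b\<in>B. c b * b)" by (rule lspanE)
    have "x = (\<Sum>b\<in>B. restrict c B b * b)" unfolding c(2) by (intro sum.cong) auto
    moreover have "restrict c B \<in> B \<rightarrow>\<^sub>E E" using c(1) by auto
    ultimately show "x \<in> (\<lambda>c. \<Sum>b\<in>B. c b * b) ` (B \<rightarrow>\<^sub>E E)" by blast
  qed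
  then show ?thesis using finite_PiE[OF assms(2)] assms(1) by (meson finite_imageI finite_subset)
qed

text \<open>Products b * c may coincide for different pairs, so the sum is assembled from members of
  the span instead of from one coefficient family on the products.\<close>

lemma lspan_tower:
  assumes E: "is_subring E" and B: "finite B" "F \<subseteq> lspan E B" and C: "finite C"
  shows "lspan F C \<subseteq> lspan E ((\<lambda>(b, c). b * c) ` (B \<times> C))"
proof
  let ?BC = "(\<lambda>(b, c). b * c) ` (B \<times> C)"
  fix x assume "x \<in> lspan F C"
  then obtain f where f: "\<forall>c\<in>C. f c \<in> F" "x = (\<Sum>c\<in>C. f c * c)" by (rule lspanE)
  have "f c * c \<in> lspan E ?BC" if c: "c \<in> C" for c
  proof -
    have "f c \<in> lspan E B" using f(1) B(2) c by blast
    then obtain e where e: "\<forall>b\<in>B. e b \<in> E" "f c = (\<Sum>b\<in>B. e b * b)" by (rule lspanE)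
    have "f c * c = (\<Sum>b\<in>B. e b * (b * c))" by (simp add: e(2) sum_distrib_right mult.assoc)
    also have "\<dots> \<in> lspan E ?BC"
      using B(1) C e(1) c by (intro lspan_sum[OF E] lspan_scaled_base[OF E]) auto
    finally show ?thesis .
  qed
  then show "x \<in> lspan E ?BC" unfolding f(2) using B(1) C by (intro lspan_sum[OF E]) auto
qed

text \<open>Cayley--Hamilton for the multiplication by \<open>x\<close>.\<close>

lemma lspan_bounded_degree:
  fixes E :: "'a::Fields.field set"
  assumes E: "is_subfield E" and B: "finite B" "UNIV \<subseteq> lspan E B"
  shows "\<exists>p\<in>polys_over E. p \<noteq> 0 \<and> poly p x = 0 \<and> Polynomial.degree p \<le> card B"
proof -
  note sr = is_subfield_imp_subring[OF E]
  obtain h where h: "bij_betw h {0..<card B} B" using ex_bij_betw_nat_finite[OF B(1)] by blast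
  have "\<forall>y. \<exists>c. (\<forall>b\<in>B. c b \<in> E) \<and> y = (\<Sum>b\<in>B. c b * b)"
  proof
    fix y
    from subsetD[OF B(2) UNIV_I, of y] obtain c where "\<forall>b\<in>B. c b \<in> E" "y = (\<Sum>b\<in>B. c b * b)" by (rule lspanE)
    then show "\<exists>c. (\<forall>b\<in>B. c b \<in> E) \<and> y = (\<Sum>b\<in>B. c b * b)" by (intro exI conjI)
  qed
  from choice[OF this] obtain C where C: "\<forall>y. (\<forall>b\<in>B. C y b \<in> E) \<and> y = (\<Sum>b\<in>B. C y b * b)" by (rule exE)
  define c where "c k = C (x * h k)" for k
  have c: "c k b \<in> E" if "b \<in> B" for k b using spec[OF C, of "x * h k"] that by (simp add: c_def)
  have xh: "x * h k = (\<Sum>b\<in>B. c k b * b)" for k unfolding c_def by (rule conjunct2[OF spec[OF C]])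
  define A where "A = mat (card B) (card B) (\<lambda>(k, l). c k (h l))"
  have A: "A \<in> carrier_mat (card B) (card B)" by (simp add: A_def)
  have hB: "h l \<in> B" if "l < card B" for l using h that by (auto simp: bij_betw_def)
  \<comment> \<open>Ensures that the family is nonzero as an eigenvector: otherwise 1 would not be
    in the span.\<close>
  have "\<exists>k<card B. h k \<noteq> 0"
  proof (rule ccontr)
    assume "\<not> (\<exists>k<card B. h k \<noteq> 0)"
    then have "\<forall>b\<in>B. b = 0" using h by (auto simp: bij_betw_def)
    from subsetD[OF B(2) UNIV_I, of 1] obtain e where "(1 :: 'a) = (\<Sum>b\<in>B. e b * b)" by (rule lspanE)
    also have "\<dots> = 0" using \<open>\<forall>b\<in>B. b = 0\<close> by (intro sum.neutral) simp
    finally show False by simp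
  qed
  then obtain k0 where k0: "k0 < card B" "h k0 \<noteq> 0" by blast
  have "poly (char_poly A) x = 0"
  proof (rule char_poly_rootI[where b = h, OF A k0])
    fix k assume k: "k < card B"
    have "(\<Sum>l<card B. A $$ (k, l) * h l) = (\<Sum>l\<in>{0..<card B}. c k (h l) * h l)"
      using k by (intro sum.cong) (auto simp: A_def)
    also have "\<dots> = (\<Sum>b\<in>B. c k b * b)" by (rule sum.reindex_bij_betw[OF h])
    finally show "(\<Sum>l<card B. A $$ (k, l) * h l) = x * h k" by (simp only: xh)
  qed
  moreover have "char_poly A \<in> polys_over E"
    using c hB by (intro char_poly_polys_over[OF sr A]) (auto simp: A_def)
  moreover have "Polynomial.degree (char_poly A) = card B" "Polynomial.coeff (char_poly A) (card B) = 1"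
    using degree_monic_char_poly[OF A] by auto
  moreover have "char_poly A \<noteq> 0" using calculation(4) by auto
  ultimately show ?thesis by (intro bexI[of _ "char_poly A"]) auto
qed

text \<open>The invariant of adjoining one generator at a time. Mere inclusion in a finite span over
  E lets an algebraic step keep E and D and only enlarge B.\<close>

definition finite_or_valued :: "'a::Fields.field set \<Rightarrow> bool" where
  "finite_or_valued F \<longleftrightarrow> is_subfield F \<and>
     (finite F \<or> (\<exists>E D \<pi> B. dvr E D \<pi> \<and> finite B \<and> F \<subseteq> lspan E B))"

lemma dvr_finite_or_valued:
  assumes "dvr E D \<pi>"
  shows "finite_or_valued E"
proof -
  have E: "is_subfield E" using assms by (simp add: dvr_def)
  have "E \<subseteq> lspan E {1}"
    using lspan_scaled_base[OF is_subfield_imp_subring[OF E], of "{1}" 1] by auto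
  then show ?thesis unfolding finite_or_valued_def using E assms by blast
qed

text \<open>The image of the integers, if finite, is a finite domain and hence a field; otherwise
  the characteristic is 0 and the rationals carry the 2-adic valuation.\<close>

lemma finite_or_valued_prime: "\<exists>F :: 'a::Fields.field set. finite_or_valued F"
proof -
  define A where "A = range (of_int :: int \<Rightarrow> 'a)"
  have A: "is_subring A"
    unfolding is_subring_def A_def
    by (auto simp flip: of_int_diff of_int_mult intro: range_eqI[of _ _ 1])
  show ?thesis
  proof (cases "finite A")
    case True
    have "inverse x \<in> A" if x: "x \<in> A" for x
    proof (cases "x = 0")
      case True
      then show ?thesis using x by simp
    next
      case False
      have "inj_on ((*) x) A" using False by (auto simp: inj_on_def)
      moreover have "(*) x ` A \<subseteq> A" using subring_mult[OF A x] by auto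
      ultimately have "(*) x ` A = A" using True by (simp add: endo_inj_surj)
      then obtain y where "y \<in> A" "x * y = 1" using subring_one[OF A] by (metis image_iff)
      then show ?thesis by (metis inverse_unique)
    qed
    then have "is_subfield A" using A by (auto simp: is_subfield_def is_subring_def)
    then show ?thesis using True unfolding finite_or_valued_def by blast
  next
    case False
    \<comment> \<open>If a nonzero i vanished in the field, division with remainder by i would leave
      only finitely many images.\<close>
    have zero: "i = 0" if "(of_int i :: 'a) = 0" for i
    proof (rule ccontr)
      assume i: "i \<noteq> 0"
      have "of_int n \<in> (of_int ` {- \<bar>i\<bar>..\<bar>i\<bar>} :: 'a set)" for n
      proof -
        have "of_int n = (of_int (n div i) * of_int i + of_int (n mod i) :: 'a)"
          unfolding of_int_mult[symmetric] of_int_add[symmetric] by simp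
        then have "of_int n = (of_int (n mod i) :: 'a)" using that by simp
        moreover have "n mod i \<in> {- \<bar>i\<bar>..\<bar>i\<bar>}" using abs_mod_less[OF i, of n] by auto
        ultimately show ?thesis by blast
      qed
      then have "A \<subseteq> of_int ` {- \<bar>i\<bar>..\<bar>i\<bar>}" by (auto simp: A_def)
      then show False using False finite_subset by blast
    qed
    have inj: "i = j" if "(of_int i :: 'a) = of_int j" for i j
      using zero[of "i - j"] that by simp
    have dvd: "(\<exists>c\<in>A. of_int i = 2 * c) \<longleftrightarrow> even i" for i
    proof
      assume "\<exists>c\<in>A. of_int i = 2 * c"
      then obtain j where "(of_int i :: 'a) = of_int (2 * j)" by (auto simp: A_def)
      then have "i = 2 * j" by (rule inj)
      then show "even i" by simp
    next
      assume "even i"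
      then obtain j where "i = 2 * j" by (rule evenE)
      then have "of_int i = (2 * of_int j :: 'a)" by simp
      moreover have "of_int j \<in> A" by (simp add: A_def)
      ultimately show "\<exists>c\<in>A. of_int i = 2 * c" by blast
    qed
    have "dvr {a / b |a b. a \<in> A \<and> b \<in> A \<and> b \<noteq> 0} {a / b |a b. a \<in> A \<and> b \<in> A \<and> \<not> (\<exists>c\<in>A. b = 2 * c)} 2"
    proof (rule dvr_localization[OF A])
      show "2 \<in> A" unfolding A_def by (rule range_eqI[of _ _ 2]) simp
      show "(2 :: 'a) \<noteq> 0" using zero[of 2] by auto
      show "(\<exists>c\<in>A. a = 2 * c) \<or> (\<exists>c\<in>A. b = 2 * c)" if ab: "a \<in> A" "b \<in> A" "\<exists>c\<in>A. a * b = 2 * c" for a b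
      proof -
        obtain i j where ij: "a = of_int i" "b = of_int j" using ab(1,2) by (auto simp: A_def)
        have "\<exists>c\<in>A. of_int (i * j) = 2 * c" using ab(3) ij by simp
        then have "even (i * j)" using dvd by blast
        then show ?thesis unfolding ij dvd by simp
      qed
      have "\<not> (\<exists>c\<in>A. of_int 1 = 2 * c)" unfolding dvd by simp
      then show "\<not> (\<exists>c\<in>A. 1 = 2 * c)" by simp
      show "\<exists>k. \<exists>a'\<in>A. a = 2 ^ k * a' \<and> \<not> (\<exists>c\<in>A. a' = 2 * c)" if a: "a \<in> A" "a \<noteq> 0" for a
      proof -
        obtain i where i: "a = of_int i" using a by (auto simp: A_def)
        then have "i \<noteq> 0" using a(2) by auto
        then have "\<exists>k j. i = 2 ^ k * j \<and> odd j"
        proof (induction "nat \<bar>i\<bar>" arbitrary: i rule: less_induct)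
          case less
          show ?case
          proof (cases "even i")
            case True
            then obtain j where j: "i = 2 * j" by (rule evenE)
            then have "nat \<bar>j\<bar> < nat \<bar>i\<bar>" "j \<noteq> 0" using less.prems by auto
            from less.hyps[OF this] obtain k l where "j = 2 ^ k * l" "odd l" by blast
            then show ?thesis using j by (intro exI[of _ "Suc k"] exI[of _ l]) simp
          next
            case False
            then show ?thesis by (intro exI[of _ 0] exI[of _ i]) simp
          qed
        qed
        then obtain k j where kj: "i = 2 ^ k * j" "odd j" by blast
        have "of_int j \<in> A" "a = 2 ^ k * of_int j" by (auto simp: A_def i kj(1))
        moreover have "\<not> (\<exists>c\<in>A. of_int j = 2 * c)" unfolding dvd by (rule kj(2))
        ultimately show ?thesis by blast
      qed
    qed
    then show ?thesis using dvr_finite_or_valued by blast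
  qed
qed

text \<open>An algebraic a keeps the valuation and multiplies the spanning set by powers of a. A
  transcendental a replaces whatever was there by the a-adic valuation of F(a), which also covers
  the passage from a finite field to an infinite one.\<close>

lemma finite_or_valued_adjoin:
  fixes F :: "'a::Fields.field set"
  assumes F: "finite_or_valued F"
  shows "\<exists>F'. finite_or_valued F' \<and> F \<subseteq> F' \<and> a \<in> F'"
proof -
  have sf: "is_subfield F" using F by (simp add: finite_or_valued_def)
  note sr = is_subfield_imp_subring[OF sf]
  note psr = is_subring_polys_over[OF sr]
  define A where "A = (\<lambda>p. poly p a) ` polys_over F"
  have FA: "F \<subseteq> A"
  proof
    fix x assume "x \<in> F"
    then have "[:x:] \<in> polys_over F" by (rule polys_over_const[OF sr])
    moreover have "x = poly [:x:] a" by simp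
    ultimately show "x \<in> A" unfolding A_def by blast
  qed
  have "a = poly [:0, 1:] a" by simp
  then have aA: "a \<in> A" unfolding A_def using polys_over_X[OF sr] by blast
  show ?thesis
  proof (cases "\<exists>p\<in>polys_over F. p \<noteq> 0 \<and> poly p a = 0")
    case True
    then obtain m where m: "min_poly_over F a m" using min_poly_over_ex[OF sf] by blast
    define B where "B = (\<lambda>j. a ^ j) ` {..<Polynomial.degree m}"
    have "A \<subseteq> lspan F B"
    proof
      fix x assume "x \<in> A"
      then obtain p where p: "p \<in> polys_over F" "x = poly p a" by (auto simp: A_def)
      have mF: "m \<in> polys_over F" "poly m a = 0" using m by (auto simp: min_poly_over_def)
      obtain s r where sr': "r \<in> polys_over F" "p = s * m + r" "r = 0 \<or> Polynomial.degree r < Polynomial.degree m"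
        using polys_over_division[OF sf p(1) mF(1) min_poly_over_nonzero[OF m]] by blast
      have "x = poly r a" using p(2) sr'(2) mF(2) by simp
      also have "\<dots> = (\<Sum>j\<le>Polynomial.degree r. Polynomial.coeff r j * a ^ j)" by (rule poly_altdef)
      also have "\<dots> \<in> lspan F B"
      proof (cases "r = 0")
        case True
        then show ?thesis using lspan_sum[OF sr, of B "{}"] by (simp add: B_def)
      next
        case False
        then show ?thesis using sr' 
          by (intro lspan_sum[OF sr] lspan_scaled_base[OF sr]) (auto simp: B_def polys_over_def)
      qed
      finally show "x \<in> lspan F B" .
    qed
    moreover have fB: "finite B" by (simp add: B_def)
    ultimately have "finite A \<or> (\<exists>E D \<pi> C. dvr E D \<pi> \<and> finite C \<and> A \<subseteq> lspan E C)"
    proof (cases "finite F")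
      case True
      then show ?thesis using \<open>A \<subseteq> lspan F B\<close> finite_lspan[OF True fB] finite_subset by blast
    next
      case False
      then obtain E D \<pi> C where C: "dvr E D \<pi>" "finite C" "F \<subseteq> lspan E C"
        using F unfolding finite_or_valued_def by blast
      then have "is_subring E" by (auto simp: dvr_def intro: is_subfield_imp_subring)
      from lspan_tower[OF this C(2,3) fB] \<open>A \<subseteq> lspan F B\<close>
      have "A \<subseteq> lspan E ((\<lambda>(b, c). b * c) ` (C \<times> B))" by blast
      moreover have "finite ((\<lambda>(b, c). b * c) ` (C \<times> B))" using C(2) fB by simp
      ultimately show ?thesis using C(1) by blast
    qed
    moreover have "is_subfield A" unfolding A_def by (rule is_subfield_adjoin[OF sf m])
    ultimately have "finite_or_valued A" unfolding finite_or_valued_def by blast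
    then show ?thesis using FA aA by blast
  next
    case False
    then have trans: "p = 0" if "p \<in> polys_over F" "poly p a = 0" for p using that by blast
    have inj: "p = q" if "p \<in> polys_over F" "q \<in> polys_over F" "poly p a = poly q a" for p q
      using trans[of "p - q"] subring_diff[OF psr that(1,2)] that(3) by simp
    have A: "is_subring A"
      unfolding is_subring_def
    proof (intro conjI ballI)
      show "1 \<in> A" using FA subring_one[OF sr] by blast
      fix u v assume "u \<in> A" "v \<in> A"
      then obtain p q where "p \<in> polys_over F" "u = poly p a" "q \<in> polys_over F" "v = poly q a" by (auto simp: A_def)
      then have "u - v = poly (p - q) a" "u * v = poly (p * q) a" "p - q \<in> polys_over F" "p * q \<in> polys_over F"
        using subring_diff[OF psr] subring_mult[OF psr] by auto
      then show "u - v \<in> A" "u * v \<in> A" unfolding A_def by blast+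
    qed
    \<comment> \<open>As a is transcendental, A is a polynomial ring in a, and divisibility by a is
      read off the constant coefficient.\<close>
    have dvd: "(\<exists>c\<in>A. poly p a = a * c) \<longleftrightarrow> Polynomial.coeff p 0 = 0" if p: "p \<in> polys_over F" for p
    proof
      assume "\<exists>c\<in>A. poly p a = a * c"
      then obtain q where q: "q \<in> polys_over F" "poly p a = poly (pCons 0 q) a" by (auto simp: A_def)
      have "p = pCons 0 q" by (rule inj[OF p polys_over_pCons[OF sr subring_zero[OF sr] q(1)] q(2)])
      then show "Polynomial.coeff p 0 = 0" by simp
    next
      assume p0: "Polynomial.coeff p 0 = 0"
      obtain c q where cq: "p = pCons c q" by (cases p)
      have "q \<in> polys_over F" unfolding polys_over_def
      proof (intro CollectI allI)
        fix i
        have "Polynomial.coeff q i = Polynomial.coeff p (Suc i)" by (simp add: cq)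
        then show "Polynomial.coeff q i \<in> F" using p by (simp add: polys_over_def)
      qed
      moreover have "poly p a = a * poly q a" using p0 cq by simp
      ultimately show "\<exists>c\<in>A. poly p a = a * c" unfolding A_def by blast
    qed
    have "dvr {x / y |x y. x \<in> A \<and> y \<in> A \<and> y \<noteq> 0} {x / y |x y. x \<in> A \<and> y \<in> A \<and> \<not> (\<exists>c\<in>A. y = a * c)} a"
    proof (rule dvr_localization[OF A aA])
      show "a \<noteq> 0"
      proof
        assume "a = 0"
        then have "[:0, 1:] = (0 :: 'a poly)" by (intro trans polys_over_X[OF sr]) simp
        then show False by simp
      qed
      show "(\<exists>c\<in>A. x = a * c) \<or> (\<exists>c\<in>A. y = a * c)" if xy: "x \<in> A" "y \<in> A" "\<exists>c\<in>A. x * y = a * c" for x y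
      proof -
        obtain p q where pq: "p \<in> polys_over F" "x = poly p a" "q \<in> polys_over F" "y = poly q a"
          using xy(1,2) by (auto simp: A_def)
        have "\<exists>c\<in>A. poly (p * q) a = a * c" using xy(3) pq by simp
        then have "Polynomial.coeff (p * q) 0 = 0" using dvd[OF subring_mult[OF psr pq(1,3)]] by simp
        then show ?thesis unfolding pq(2,4) dvd[OF pq(1)] dvd[OF pq(3)] by (simp add: coeff_mult)
      qed
      show "\<not> (\<exists>c\<in>A. 1 = a * c)" using dvd[OF subring_one[OF psr]] by simp
      show "\<exists>k. \<exists>x'\<in>A. x = a ^ k * x' \<and> \<not> (\<exists>c\<in>A. x' = a * c)" if x: "x \<in> A" "x \<noteq> 0" for x
      proof -
        obtain p where p: "p \<in> polys_over F" "x = poly p a" using x by (auto simp: A_def)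
        then have "p \<noteq> 0" using x(2) by auto
        with p(1) have "\<exists>k. \<exists>q\<in>polys_over F. poly p a = a ^ k * poly q a \<and> Polynomial.coeff q 0 \<noteq> 0"
        proof (induction p)
          case (pCons c q)
          show ?case
          proof (cases "c = 0")
            case True
            have "q \<in> polys_over F" unfolding polys_over_def
            proof (intro CollectI allI)
              fix i
              have "Polynomial.coeff q i = Polynomial.coeff (pCons c q) (Suc i)" by simp
              moreover have "Polynomial.coeff (pCons c q) (Suc i) \<in> F"
                using pCons.prems(1) unfolding polys_over_def mem_Collect_eq by (rule spec)
              ultimately show "Polynomial.coeff q i \<in> F" by simp
            qed
            moreover have "q \<noteq> 0" using True pCons.prems(2) by auto
            ultimately obtain k q' where "q' \<in> polys_over F" "poly q a = a ^ k * poly q' a" "Polynomial.coeff q' 0 \<noteq> 0"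
              using pCons.IH by blast
            then show ?thesis using True by (intro exI[of _ "Suc k"] bexI[of _ q']) auto
          next
            case False
            then show ?thesis using pCons.prems by (intro exI[of _ 0] bexI[of _ "pCons c q"]) auto
          qed
        qed simp
        then obtain k q where q: "q \<in> polys_over F" "poly p a = a ^ k * poly q a" "Polynomial.coeff q 0 \<noteq> 0" by blast
        have "poly q a \<in> A" using q(1) by (auto simp: A_def)
        moreover have "\<not> (\<exists>c\<in>A. poly q a = a * c)" unfolding dvd[OF q(1)] by (rule q(3))
        ultimately show ?thesis using p(2) q(2) by blast
      qed
    qed
    note fv = dvr_finite_or_valued[OF this]
    have "A \<subseteq> {x / y |x y. x \<in> A \<and> y \<in> A \<and> y \<noteq> 0}"
    proof
      fix x assume "x \<in> A"
      then show "x \<in> {x / y |x y. x \<in> A \<and> y \<in> A \<and> y \<noteq> 0}"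
        using subring_one[OF A] by (intro CollectI exI[of _ x] exI[of _ 1]) simp
    qed
    then show ?thesis using fv FA aA by blast
  qed
qed

text \<open>Induction on the generators leads from the prime field to a subfield that contains all
  of them and is therefore everything. The size of the spanning set bounds the degrees, and twice
  this size is the bound on m.\<close>

theorem finitely_generated_field_cases:
  assumes "finitely_generated_field (ring_of_type_algebra :: 'a::Fields.field ring) UNIV"
  shows "finite (UNIV :: 'a set) \<or>
    (\<exists>(\<pi> :: 'a) N. \<pi> \<noteq> 0 \<and> (\<forall>m>N. \<forall>x y. x ^ m + \<pi> * y ^ m + \<pi>\<^sup>2 \<noteq> 0))"
proof -
  interpret F: Ring.field "ring_of_type_algebra :: 'a ring" by (rule field_from_type_algebra)
  obtain S where S: "finite S" "UNIV = generate_field (ring_of_type_algebra :: 'a ring) S"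
    using assms by (auto simp: finitely_generated_field_def)
  have "\<exists>F. finite_or_valued F \<and> S \<subseteq> F" using S(1)
  proof induction
    case empty
    then show ?case using finite_or_valued_prime by auto
  next
    case (insert x S)
    then show ?case using finite_or_valued_adjoin by (metis insert_subset subset_trans)
  qed
  then obtain F where F: "finite_or_valued F" "S \<subseteq> F" by blast
  have "is_subfield F" using F(1) by (simp add: finite_or_valued_def)
  then have "generate_field (ring_of_type_algebra :: 'a ring) S \<subseteq> F"
    by (intro F.generate_field_min_subfield1 is_subfield_imp_subfield F(2)) (simp_all add: rota_simps)
  then have "F = UNIV" using S(2) by blast
  show ?thesis
  proof (cases "finite (UNIV :: 'a set)")
    case False
    then obtain E D \<pi> and B :: "'a set" where B: "dvr E D \<pi>" "finite B" "UNIV \<subseteq> lspan E B"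
      using F(1) \<open>F = UNIV\<close> unfolding finite_or_valued_def by blast
    have D: "is_subfield E" "is_subring D" "\<pi> \<in> D" "\<pi> \<noteq> 0" "inverse \<pi> \<notin> D" using B(1) by (simp_all add: dvr_def)
    obtain R where R: "is_subring R" "D \<subseteq> R" "inverse \<pi> \<notin> R" "\<And>x. x \<in> R \<or> inverse x \<in> R"
      using valuation_ring_exists[OF D(2-5)] by blast
    have "x ^ m + \<pi> * y ^ m + \<pi>\<^sup>2 \<noteq> 0" if "m > 2 * card B" for m x y
      using that by (intro fermat_no_points[OF B(1) R lspan_bounded_degree[OF D(1) B(2,3)]]) auto
    then show ?thesis using D(4) by blast
  qed simp
qed

section \<open>Finite fields\<close>

text \<open>The reciprocal of w, undefined at all rational points, is still dominating and
  separable: over the algebraic closure w takes every value, and its derivative is not 0 because its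
  zeros are simple.\<close>

theorem not_PAC_over_finite:
  assumes fin: "finite (UNIV :: 'm::Fields.field set)"
  shows "\<not> PAC_over (R :: 'm set)"
proof
  assume PAC: "PAC_over R"
  interpret c: comm_ring_hom "const_mpoly :: 'm \<Rightarrow> _" by (rule const_mpoly_hom)
  define w :: "'m mpoly" where "w = (\<Prod>s\<in>UNIV. mvar 0 - const_mpoly s)"
  define P :: "'m alg_closure poly" where "P = (\<Prod>s\<in>(UNIV :: 'm set). [:- to_ac s, 1:])"
  have degP: "Polynomial.degree P = card (UNIV :: 'm set)"
    unfolding P_def by (subst degree_prod_sum_eq) auto
  have card0: "card (UNIV :: 'm set) > 0" using fin by (simp add: card_gt_0_iff)
  have ev_w: "h_ev w = (\<Prod>s\<in>UNIV. h_ev (mvar 0) - h_ev (const_mpoly s))" if "comm_ring_hom h_ev" for h_ev :: "'m mpoly \<Rightarrow> 'e::comm_ring_1"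
  proof -
    interpret h: comm_ring_hom h_ev by fact
    show ?thesis by (simp add: w_def h.hom_prod h.hom_minus)
  qed
  have w0: "w \<noteq> 0"
  proof -
    have "mvar 0 - const_mpoly s \<noteq> 0" for s :: 'm
    proof
      assume "mvar 0 - const_mpoly s = 0"
      then have "Poly_Mapping.lookup (mvar 0 - const_mpoly s) (Poly_Mapping.single 0 1) = 0" by simp
      moreover have "Poly_Mapping.single (0 :: nat) (1 :: nat) \<noteq> 0"
        by (metis lookup_single_eq lookup_zero one_neq_zero)
      ultimately show False by (simp add: mvar_def const_mpoly_def lookup_minus lookup_single when_def)
    qed
    then show ?thesis using fin by (simp add: w_def)
  qed
  have w_in: "w \<in> mpolys 1"
    unfolding w_def by (intro subring_prod[OF is_subring_mpolys] subring_diff[OF is_subring_mpolys] mvar_in_mpolys const_mpoly_in_mpolys) simp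
  have "\<exists>b. \<forall>i<1::nat. \<exists>y\<in>R. mev (\<lambda>c. c) b (1 :: 'm mpoly) = y * mev (\<lambda>c. c) b w"
  \<comment> \<open>The reciprocal omits only the value 0, hence \<open>g = mvar 0\<close>.\<close>
  proof (rule PAC_over_affineD[OF PAC, where n = 1 and g = "mvar 0" and p = "\<lambda>_. 1" and q = "\<lambda>_. w"])
    show "(1 :: 'm mpoly) \<in> mpolys 1" by (rule subring_one[OF is_subring_mpolys])
    show "w \<in> mpolys 1" by (rule w_in)
    show "w \<noteq> 0" by (rule w0)
    show "(mvar 0 :: 'm alg_closure mpoly) \<in> mpolys 1" by (rule mvar_in_mpolys) simp
    show "(mvar 0 :: 'm alg_closure mpoly) \<noteq> 0" unfolding mvar_def by (metis lookup_single_eq lookup_zero one_neq_zero)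
  next
    fix y :: "nat \<Rightarrow> 'm alg_closure"
    assume "mpoly_eval (mvar 0) y \<noteq> 0"
    then have y0: "y 0 \<noteq> 0" using comm_ring_hom.mev_var[OF id_hom, of y 0] by (simp add: mpoly_eval_eq)
    have "Polynomial.degree (P - [:1 / y 0:]) > 0"
    proof -
      have "Polynomial.coeff (P - [:1 / y 0:]) (card (UNIV :: 'm set)) = Polynomial.lead_coeff P"
        using card0 by (simp add: degP coeff_pCons split: nat.split)
      moreover have "P \<noteq> 0" using degP card0 by auto
      ultimately have "card (UNIV :: 'm set) \<le> Polynomial.degree (P - [:1 / y 0:])" by (intro le_degree) simp
      then show ?thesis using card0 by simp
    qed
    then obtain t where t: "poly (P - [:1 / y 0:]) t = 0" using alg_closed_imp_poly_has_root by blast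
    have e: "comm_ring_hom (mev to_ac (\<lambda>_. t) :: 'm mpoly \<Rightarrow> _)" by (rule comm_ring_hom.comm_ring_hom_mev[OF to_ac_hom])
    interpret e: comm_ring_hom "mev to_ac (\<lambda>_. t) :: 'm mpoly \<Rightarrow> _" by (rule e)
    have "mev to_ac (\<lambda>_. t) w = poly P t"
      unfolding ev_w[OF e] by (simp add: P_def poly_prod comm_ring_hom.mev_var[OF to_ac_hom] comm_ring_hom.mev_const[OF to_ac_hom])
    also have "\<dots> = 1 / y 0" using t by simp
    finally show "\<exists>a. \<forall>i<1::nat. mev to_ac a w \<noteq> 0 \<and> mev to_ac a 1 = y i * mev to_ac a w"
      using y0 by (intro exI[of _ "\<lambda>_. t"]) (simp add: e.hom_one)
  next
    fix E and i :: nat assume E: "is_subfield E" "range (\<lambda>c. gen_const (to_ac c)) \<subseteq> E"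
      and pE: "\<And>i. i < (1::nat) \<Longrightarrow> Fract (lift_mpoly (1 :: 'm mpoly)) (lift_mpoly w) \<in> E" and i: "i < 1"
    note sr = is_subfield_imp_subring[OF E(1)]
    note psr = is_subring_polys_over[OF sr]
    interpret l: comm_ring_hom "lift_mpoly :: 'm mpoly \<Rightarrow> _" by (rule lift_mpoly_hom)
    interpret gc: comm_ring_hom "gen_const :: 'm alg_closure \<Rightarrow> _" by (rule gen_const_hom)
    interpret gcp: map_poly_comm_ring_hom "gen_const :: 'm alg_closure \<Rightarrow> _" ..
    define G where "G p = Fract (lift_mpoly p) 1" for p :: "'m mpoly"
    have G: "comm_ring_hom G" unfolding G_def[abs_def] by (rule comm_ring_hom_compose[OF Fract_one_hom lift_mpoly_hom])
    have lw: "lift_mpoly w \<noteq> 0" using w0 by (simp add: lift_mpoly_eq_0_iff)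
    have "inverse (Fract (lift_mpoly (1 :: 'm mpoly)) (lift_mpoly w)) \<in> E"
      by (rule subfield_inverse[OF E(1)]) (rule pE[of 0], simp)
    then have GwE: "G w \<in> E" by (simp add: G_def l.hom_one)
    have Gw: "G w = poly (map_poly gen_const P) (gen_var 0)"
    proof -
      have "map_poly gen_const P = (\<Prod>s\<in>(UNIV :: 'm set). [:- gen_const (to_ac s), 1:])"
        unfolding P_def gcp.hom_prod
        by (intro prod.cong refl poly_eqI) (auto simp: coeff_map_poly coeff_pCons gc.hom_uminus split: nat.split)
      then show ?thesis
        unfolding ev_w[OF G] by (simp add: poly_prod G_def lift_mpoly_var lift_mpoly_const gen_var_def gen_const_def)
    qed
    have "gen_var 0 \<in> sepgen E"
    proof (rule sepgen_root)
      let ?p = "map_poly gen_const P - [:G w:]"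
      have PE: "map_poly gen_const P \<in> polys_over E"
      proof -
        have "map_poly gen_const P = (\<Prod>s\<in>(UNIV :: 'm set). [:- gen_const (to_ac s), 1:])"
          unfolding P_def gcp.hom_prod
          by (intro prod.cong refl poly_eqI) (auto simp: coeff_map_poly coeff_pCons gc.hom_uminus split: nat.split)
        also have "\<dots> \<in> polys_over E"
          using E(2) by (intro subring_prod[OF psr] polys_over_pCons[OF sr] subring_uminus[OF sr] subring_zero[OF psr] subring_one[OF sr]) auto
        finally show ?thesis .
      qed
      then have "?p \<in> polys_over E" by (intro subring_diff[OF psr] polys_over_const[OF sr] GwE)
      then show "Polynomial.coeff ?p k \<in> sepgen E" for k unfolding polys_over_def by (intro sepgen_base) blast
      show "poly ?p (gen_var 0) = 0" by (simp only: poly_diff Gw poly_pCons poly_0 mult_zero_right add_0_right diff_self)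
      have "pderiv P \<noteq> 0"
      proof
        assume "pderiv P = 0"
        have "P = [:- to_ac 0, 1:] * (\<Prod>s\<in>UNIV - {0}. [:- to_ac s, 1:])"
          unfolding P_def using fin by (intro prod.remove) auto
        then have "poly (pderiv P) (to_ac 0) = (\<Prod>s\<in>UNIV - {0 :: 'm}. to_ac 0 - to_ac s)"
          by (simp only: poly_pderiv_linear_mult poly_prod) simp
        also have "\<dots> \<noteq> 0" using fin by simp
        finally show False using \<open>pderiv P = 0\<close> by simp
      qed
      moreover have "pderiv (map_poly gen_const P) = map_poly gen_const (pderiv P)"
        by (rule poly_eqI) (simp add: coeff_pderiv coeff_map_poly gc.hom_mult gc.hom_add gc.hom_of_nat)
      ultimately show "poly (pderiv ?p) (gen_var 0) \<noteq> 0"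
        using gen_var_transcendental[of "pderiv P" 0] by (simp only: pderiv_diff pderiv_singleton diff_0_right not_False_eq_True)
    qed
    then show "gen_var i \<in> sepgen E" using i by simp
  qed
  then obtain b :: "nat \<Rightarrow> 'm" and y where y: "mev (\<lambda>c. c) b 1 = y * mev (\<lambda>c. c) b w" by auto
  have e: "comm_ring_hom (mev (\<lambda>c. c) b :: 'm mpoly \<Rightarrow> _)" by (rule comm_ring_hom.comm_ring_hom_mev[OF id_hom])
  have "mev (\<lambda>c. c) b (const_mpoly (b 0) :: 'm mpoly) = b 0" "mev (\<lambda>c. c) b (mvar 0 :: 'm mpoly) = b 0"
    using comm_ring_hom.mev_const[OF id_hom, of b "b 0"] comm_ring_hom.mev_var[OF id_hom, of b 0] by simp_all
  then have "mev (\<lambda>c. c) b w = 0"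
    unfolding ev_w[OF e] using fin by (intro prod_zero bexI[of _ "b 0"]) simp_all
  moreover have "mev (\<lambda>c. c) b (1 :: 'm mpoly) = 1" using comm_ring_hom.mev_const[OF id_hom, of b 1] by simp
  ultimately show False using y by simp
qed

section \<open>The curve \<open>y\<^sup>m + g(x) = 0\<close>\<close>

lemma monic_division:
  fixes p q :: "'a::idom poly"
  assumes "Polynomial.lead_coeff q = 1"
  shows "\<exists>s r. p = q * s + r \<and> (r = 0 \<or> Polynomial.degree r < Polynomial.degree q)"
proof -
  obtain s r where sr: "pseudo_divmod p q = (s, r)" by force
  have "q \<noteq> 0" using assms by auto
  from pseudo_divmod[OF this sr] assms show ?thesis by auto
qed

text \<open>Polynomials in \<open>x, y\<close> as polynomials in \<open>y\<close> over the polynomials in \<open>x\<close>.\<close>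

definition to_poly2 :: "'c::idom mpoly \<Rightarrow> 'c poly poly" where
  "to_poly2 = mev (\<lambda>c. [:[:c:]:]) (\<lambda>i. if i = 0 then [:[:0, 1:]:] else [:0, 1:])"

definition of_poly2 :: "'c::idom poly poly \<Rightarrow> 'c mpoly" where
  "of_poly2 P = poly (map_poly (\<lambda>c. poly (map_poly const_mpoly c) (mvar 0)) P) (mvar 1)"

lemma const_poly2_hom: "comm_ring_hom (\<lambda>c :: 'c::idom. [:[:c:]:])"
  by standard (auto simp: one_pCons)

lemma to_poly2_hom: "comm_ring_hom (to_poly2 :: 'c::idom mpoly \<Rightarrow> _)"
  unfolding to_poly2_def by (rule comm_ring_hom.comm_ring_hom_mev[OF const_poly2_hom])

lemma poly2_hom: "comm_ring_hom (\<lambda>P :: 'c::idom poly poly. poly (poly P [:y:]) x)"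
  by standard auto

lemma eval_to_poly2:
  assumes "p \<in> mpolys 2"
  shows "poly (poly (to_poly2 p) [:a 1:]) (a 0) = mev (\<lambda>c. c) a p"
proof -
  have "poly (poly (to_poly2 p) [:a 1:]) (a 0) =
    mev (\<lambda>c. poly (poly [:[:c:]:] [:a 1:]) (a 0)) (\<lambda>i. poly (poly (if i = 0 then [:[:0, 1:]:] else [:0, 1:]) [:a 1:]) (a 0)) p"
    unfolding to_poly2_def by (rule comm_ring_hom.mev_cong_hom[OF const_poly2_hom poly2_hom])
  also have "\<dots> = mev (\<lambda>c. poly (poly [:[:c:]:] [:a 1:]) (a 0)) a p"
    by (rule mev_cong[OF assms]) (auto simp: less_Suc_eq numeral_2_eq_2)
  finally show ?thesis by simp
qed

lemma of_poly2_in: "of_poly2 P \<in> mpolys 2"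
proof -
  note sr = is_subring_mpolys
  have 1: "poly (map_poly const_mpoly c) (mvar 0) \<in> mpolys 2" for c :: "'a poly"
    by (intro poly_in_subring[OF sr] mvar_in_mpolys)
      (auto simp: polys_over_def coeff_map_poly const_mpoly_def[of 0] const_mpoly_in_mpolys)
  show ?thesis unfolding of_poly2_def
    by (intro poly_in_subring[OF sr] mvar_in_mpolys) (auto simp: polys_over_def coeff_map_poly 1)
qed

lemma map_poly_pCons0: "f 0 = 0 \<Longrightarrow> map_poly f (pCons a p) = pCons (f a) (map_poly f p)"
  by (rule poly_eqI) (simp add: coeff_map_poly coeff_pCons split: nat.split)

lemma to_poly2_of_poly2: "to_poly2 (of_poly2 P) = P"
proof -
  interpret t: comm_ring_hom "to_poly2 :: 'a mpoly \<Rightarrow> _" by (rule to_poly2_hom)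
  have var: "to_poly2 (mvar 0 :: 'a mpoly) = [:[:0, 1:]:]" "to_poly2 (mvar 1 :: 'a mpoly) = [:0, 1:]"
    unfolding to_poly2_def by (simp_all add: comm_ring_hom.mev_var[OF const_poly2_hom])
  have const: "to_poly2 (const_mpoly c :: 'a mpoly) = [:[:c:]:]" for c
    unfolding to_poly2_def by (rule comm_ring_hom.mev_const[OF const_poly2_hom])
  have const0: "const_mpoly (0 :: 'a) = 0" by (simp add: const_mpoly_def)
  have inner: "to_poly2 (poly (map_poly const_mpoly c) (mvar 0)) = [:c:]" for c :: "'a poly"
  proof (induction c)
    case (pCons a c)
    have "poly (map_poly const_mpoly (pCons a c)) (mvar 0) = const_mpoly a + mvar 0 * poly (map_poly const_mpoly c) (mvar 0)"
      by (simp add: map_poly_pCons0 const0)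
    then show ?case using pCons.IH by (simp add: t.hom_add t.hom_mult var const)
  qed (simp add: t.hom_zero)
  show ?thesis unfolding of_poly2_def
  proof (induction P)
    case (pCons c P)
    have "poly (map_poly (\<lambda>c. poly (map_poly const_mpoly c) (mvar 0)) (pCons c P)) (mvar 1) =
      poly (map_poly const_mpoly c) (mvar 0) + mvar 1 * poly (map_poly (\<lambda>c. poly (map_poly const_mpoly c) (mvar 0)) P) (mvar 1)"
      by (simp add: map_poly_pCons0)
    then show ?case using pCons.IH by (simp add: t.hom_add t.hom_mult var inner del: One_nat_def)
  qed (simp add: t.hom_zero)
qed

lemma to_poly2_inj:
  fixes p q :: "'c::Fields.field alg_closure mpoly"
  assumes "p \<in> mpolys 2" "q \<in> mpolys 2" "to_poly2 p = to_poly2 q"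
  shows "p = q"
proof -
  interpret t: comm_ring_hom "to_poly2 :: 'c alg_closure mpoly \<Rightarrow> _" by (rule to_poly2_hom)
  have pq: "p - q \<in> mpolys 2" by (rule subring_diff[OF is_subring_mpolys assms(1,2)])
  have "to_poly2 (p - q) = 0" using assms(3) by (simp add: t.hom_minus)
  then have "p - q = 0"
    using eval_to_poly2[OF pq] by (intro mpoly_eq_0I[OF infinite_alg_closure pq]) (metis poly_0)
  then show ?thesis by simp
qed

text \<open>The form that x^m + \<pi> y^m + \<pi>^2 = 0 takes after division by \<pi>. The simple
  root x0 supplies the prime X - x0 for Eisenstein's criterion, and m nonzero in M makes y separable
  over M(x).\<close>

locale power_curve =
  fixes g :: "'m::Fields.field poly" and m :: nat and x0 :: "'m alg_closure"
  assumes m: "m > 0" "of_nat m \<noteq> (0 :: 'm)"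
    and x0: "poly (map_poly to_ac g) x0 = 0" "poly (pderiv (map_poly to_ac g)) x0 \<noteq> 0"
begin

definition gc :: "'m alg_closure poly" where "gc = map_poly to_ac g"

definition G :: "'m alg_closure poly poly" where "G = Polynomial.monom 1 m + [:gc:]"

definition V :: "(nat \<Rightarrow> 'm alg_closure) set" where
  "V = {a \<in> affine_space 2. a 1 ^ m + poly gc (a 0) = 0}"

definition g0 :: "'m mpoly" where "g0 = mvar 1 ^ m + poly (map_poly const_mpoly g) (mvar 0)"

lemma gc_nonzero: "gc \<noteq> 0" using x0(2) by (auto simp: gc_def)

lemma m_ac: "of_nat m \<noteq> (0 :: 'm alg_closure)"
  using m(2) by (metis to_ac_of_nat to_ac_eq_0_iff)

lemma coeff_G: "Polynomial.coeff G i = (if i = m then 1 else if i = 0 then gc else 0)"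
  using m by (auto simp: G_def coeff_pCons split: nat.split)

lemma degree_G: "Polynomial.degree G = m"
  by (intro antisym degree_le le_degree) (auto simp: coeff_G)

lemma lead_G: "Polynomial.lead_coeff G = 1"
  unfolding degree_G by (simp add: coeff_G)

lemma G_nonzero: "G \<noteq> 0" using lead_G by auto

lemma eval_G: "poly (poly G [:y:]) x = y ^ m + poly gc x"
  by (simp add: G_def poly_monom)

text \<open>Eisenstein's criterion at \<open>x0\<close>.\<close>

lemma irreducible_G: "irreducible G"
proof (rule irreducibleI)
  show "G \<noteq> 0" by (rule G_nonzero)
  show "\<not> G dvd 1"
  proof
    assume "G dvd 1"
    then obtain H where H: "G * H = 1" by (metis dvdE)
    then have "Polynomial.degree G + Polynomial.degree H = 0"
      using degree_mult_eq[of G H] by (metis G_nonzero degree_1 mult_zero_right zero_neq_one)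
    then show False using degree_G m by simp
  qed
  fix A B assume AB: "G = A * B"
  have nz: "A \<noteq> 0" "B \<noteq> 0" using G_nonzero AB by auto
  have "Polynomial.lead_coeff A * Polynomial.lead_coeff B = 1" using lead_G by (simp only: AB lead_coeff_mult)
  then have units: "Polynomial.lead_coeff A dvd 1" "Polynomial.lead_coeff B dvd 1" by (metis dvd_triv_left dvd_triv_right)+
  have deg: "Polynomial.degree A + Polynomial.degree B = m" using degree_G AB nz by (simp add: degree_mult_eq)
  have unit0: "C dvd 1" if C: "Polynomial.degree C = 0" "Polynomial.lead_coeff C dvd 1" for C :: "'m alg_closure poly poly"
  proof -
    obtain c where c: "C = [:c:]" using C(1) by (rule degree_eq_zeroE)
    then obtain d where "c * d = 1" using C(2) by (metis dvdE lead_coeff_pCons(2))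
    then have "C * [:d:] = 1" by (simp add: c one_pCons mult.commute)
    then show ?thesis by (metis dvd_triv_left)
  qed
  show "A dvd 1 \<or> B dvd 1"
  proof (rule ccontr)
    assume "\<not> (A dvd 1 \<or> B dvd 1)"
    then have deg0: "Polynomial.degree A > 0" "Polynomial.degree B > 0" using units by (metis gr0I unit0)+
    interpret e: comm_ring_hom "\<lambda>c :: 'm alg_closure poly. poly c x0" by standard auto
    interpret ep: map_poly_comm_ring_hom "\<lambda>c :: 'm alg_closure poly. poly c x0" ..
    let ?e = "map_poly (\<lambda>c :: 'm alg_closure poly. poly c x0)"
    \<comment> \<open>Modulo X - x0 only the power of y is left of G, because gc(x0) = 0.\<close>
    have "?e G = Polynomial.monom 1 m"
      by (rule poly_eqI) (use m x0(1) in \<open>auto simp: coeff_map_poly coeff_G gc_def\<close>)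
    then have prod: "?e A * ?e B = Polynomial.monom 1 m" by (simp only: AB ep.hom_mult)
    have enz: "?e A \<noteq> 0" "?e B \<noteq> 0" using prod by (auto simp: Polynomial.monom_eq_0_iff)
    have ord_le: "order 0 (?e C) \<le> Polynomial.degree C" if "?e C \<noteq> 0" for C
      using order_degree[OF that, of 0] degree_map_poly_le[of "\<lambda>c. poly c x0" C] by linarith
    \<comment> \<open>The orders at 0 add up to m, the sum of the degrees, and neither exceeds its
      degree, so both are positive. The constant coefficients of A and B then vanish at x0, and x0
      would be a double root of gc.\<close>
    have ord: "order 0 (?e A) + order 0 (?e B) = m"
    proof -
      have "order 0 (?e A * ?e B) = order 0 (?e A) + order 0 (?e B)" using enz by (intro order_mult) auto
      moreover have "order 0 (Polynomial.monom (1 :: 'm alg_closure) m) = m"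
        using order_power_n_n[of "0 :: 'm alg_closure" m] by (simp add: Polynomial.monom_altdef)
      ultimately show ?thesis using prod by simp
    qed
    then have "order 0 (?e A) \<noteq> 0" "order 0 (?e B) \<noteq> 0"
      using ord_le[OF enz(1)] ord_le[OF enz(2)] deg deg0 by linarith+
    then have "poly (?e A) 0 = 0" "poly (?e B) 0 = 0" using order_root by blast+
    then have z: "poly (Polynomial.coeff A 0) x0 = 0" "poly (Polynomial.coeff B 0) x0 = 0"
      by (simp_all add: poly_0_coeff_0 coeff_map_poly)
    have "gc = Polynomial.coeff A 0 * Polynomial.coeff B 0"
      using m coeff_G[of 0] by (simp add: AB coeff_mult)
    then have "poly (pderiv gc) x0 = 0" using z by (simp add: pderiv_mult)
    then show False using x0(2) by (simp add: gc_def)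
  qed
qed

lemma prime_G: "prime_elem G"
  by (rule irreducible_imp_prime_elem[OF irreducible_G])

lemma V_fibre: "\<exists>a\<in>V. a 0 = t"
proof -
  have "Polynomial.degree (Polynomial.monom 1 m + [:poly gc t:]) > 0"
  proof -
    have "Polynomial.coeff (Polynomial.monom 1 m + [:poly gc t:]) m = 1"
      using m by (auto simp: coeff_pCons split: nat.split)
    then have "m \<le> Polynomial.degree (Polynomial.monom 1 m + [:poly gc t:])" by (intro le_degree) simp
    then show ?thesis using m by simp
  qed
  then obtain s where "poly (Polynomial.monom 1 m + [:poly gc t:]) s = 0" using alg_closed_imp_poly_has_root by blast
  then have "s ^ m + poly gc t = 0" by (simp add: poly_monom)
  then show ?thesis
    by (intro bexI[of _ "\<lambda>i. if i = 0 then t else if i = 1 then s else undefined"]) (auto simp: V_def affine_space_def split: if_splits)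
qed

text \<open>Division by the monic G leaves a remainder of degree below m in y. If one of its
  coefficients were nonzero, there would be a t at which neither this coefficient nor gc vanishes;
  the fibre over t has m distinct points, too many zeros for the specialised remainder.\<close>

lemma vanish_V_iff:
  assumes p: "p \<in> mpolys 2"
  shows "(\<forall>a\<in>V. mpoly_eval p a = 0) \<longleftrightarrow> G dvd to_poly2 p"
proof
  assume "G dvd to_poly2 p"
  then obtain K where K: "to_poly2 p = G * K" by (rule dvdE)
  show "\<forall>a\<in>V. mpoly_eval p a = 0"
  proof
    fix a assume a: "a \<in> V"
    have "mpoly_eval p a = poly (poly G [:a 1:]) (a 0) * poly (poly K [:a 1:]) (a 0)"
      unfolding mpoly_eval_eq eval_to_poly2[OF p, symmetric] K by simp
    then show "mpoly_eval p a = 0" using a by (simp add: eval_G V_def)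
  qed
next
  assume van: "\<forall>a\<in>V. mpoly_eval p a = 0"
  obtain K \<rho> where K: "to_poly2 p = G * K + \<rho>" "\<rho> = 0 \<or> Polynomial.degree \<rho> < m"
    using monic_division[OF lead_G, of "to_poly2 p"] degree_G by auto
  have "Polynomial.coeff \<rho> j = 0" for j
  proof (rule ccontr)
    assume cj: "Polynomial.coeff \<rho> j \<noteq> 0"
    have "finite {t. poly (Polynomial.coeff \<rho> j * gc) t = 0}"
      using cj gc_nonzero by (intro poly_roots_finite) auto
    then obtain t where t: "poly (Polynomial.coeff \<rho> j * gc) t \<noteq> 0"
      using infinite_alg_closure[where 'a = 'm] by (metis (mono_tags, lifting) UNIV_eq_I mem_Collect_eq)
    let ?h = "Polynomial.monom 1 m + [:poly gc t:]"
    have coeff_h: "Polynomial.coeff ?h i = (if i = m then 1 else if i = 0 then poly gc t else 0)" for i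
      using m by (auto simp: coeff_pCons split: nat.split)
    have deg_h: "Polynomial.degree ?h = m"
      by (intro antisym degree_le le_degree) (use coeff_h in \<open>auto simp del: coeff_add\<close>)
    have "poly (pderiv ?h) y \<noteq> 0" if "poly ?h y = 0" for y
    proof -
      have "y ^ m + poly gc t = 0" using that by (simp add: poly_monom)
      then have "y \<noteq> 0" using t m by (auto simp: power_0_left)
      then show ?thesis using m_ac by (simp add: pderiv_add pderiv_monom poly_monom pderiv_pCons)
    qed
    moreover have "Polynomial.lead_coeff ?h = 1" unfolding deg_h coeff_h by simp
    ultimately obtain \<theta> where \<theta>: "inj_on \<theta> {..<m}" "?h = (\<Prod>i<m. [:- \<theta> i, 1:])"
      using monic_simple_roots_factor[of ?h] unfolding deg_h by blast
    let ?r = "map_poly (\<lambda>c. poly c t) \<rho>"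
    have "?r = 0"
    proof (rule poly_eq_of_roots[OF \<theta>(1)])
      show "Polynomial.degree ?r < m"
        using K(2) m degree_map_poly_le[of "\<lambda>c. poly c t" \<rho>] by auto
      show "Polynomial.degree (0 :: 'm alg_closure poly) < m" using m by simp
      fix i assume i: "i < m"
      have "poly ?h (\<theta> i) = 0" unfolding \<theta>(2) poly_prod using i by (intro prod_zero) auto
      then have root: "\<theta> i ^ m + poly gc t = 0" by (simp add: poly_monom)
      define a where "a = (\<lambda>k :: nat. if k = 0 then t else if k = 1 then \<theta> i else undefined)"
      have "a \<in> V" using root by (auto simp: a_def V_def affine_space_def split: if_splits)
      then have "poly (poly (to_poly2 p) [:a 1:]) (a 0) = 0"
        using van eval_to_poly2[OF p, of a] by (simp add: mpoly_eval_eq)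
      then have "poly (poly \<rho> [:\<theta> i:]) t = 0"
        using root by (simp add: K(1) a_def eval_G)
      moreover have "poly (poly \<rho> [:\<theta> i:]) t = poly ?r (\<theta> i)"
        by (induction \<rho>) (simp_all add: map_poly_pCons0)
      ultimately show "poly ?r (\<theta> i) = poly 0 (\<theta> i)" by simp
    qed
    then have "Polynomial.coeff ?r j = 0" by simp
    then show False using t by (simp add: coeff_map_poly)
  qed
  then have "\<rho> = 0" by (simp add: poly_eq_iff)
  then show "G dvd to_poly2 p" using K(1) by simp
qed

lemma V_affine: "V \<subseteq> affine_space 2" by (auto simp: V_def)

lemma to_poly2_g0: "to_poly2 (lift_mpoly g0) = G"
proof -
  interpret t: comm_ring_hom "\<lambda>p. to_poly2 (lift_mpoly p :: 'm alg_closure mpoly)"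
    by (rule comm_ring_hom_compose[OF to_poly2_hom lift_mpoly_hom])
  have var: "to_poly2 (lift_mpoly (mvar 0 :: 'm mpoly)) = [:[:0, 1:]:]" "to_poly2 (lift_mpoly (mvar 1 :: 'm mpoly)) = [:0, 1:]"
    unfolding lift_mpoly_var unfolding to_poly2_def by (simp_all add: comm_ring_hom.mev_var[OF const_poly2_hom])
  have const: "to_poly2 (lift_mpoly (const_mpoly c :: 'm mpoly)) = [:[:to_ac c:]:]" for c
    unfolding lift_mpoly_const to_poly2_def by (rule comm_ring_hom.mev_const[OF const_poly2_hom])
  have const0: "const_mpoly (0 :: 'm) = 0" by (simp add: const_mpoly_def)
  have "to_poly2 (lift_mpoly (poly (map_poly const_mpoly c) (mvar 0))) = [:map_poly to_ac c:]" for c :: "'m poly"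
  proof (induction c)
    case (pCons a c)
    have "poly (map_poly const_mpoly (pCons a c)) (mvar 0) = const_mpoly a + mvar 0 * poly (map_poly const_mpoly c) (mvar 0)"
      by (simp add: map_poly_pCons0 const0)
    then show ?case using pCons.IH by (simp add: t.hom_add t.hom_mult var const map_poly_pCons0)
  qed (simp add: t.hom_zero)
  moreover have "[:0, 1:] ^ m = (Polynomial.monom 1 m :: 'm alg_closure poly poly)" by (simp add: Polynomial.monom_altdef)
  ultimately show ?thesis by (simp add: g0_def t.hom_add t.hom_power var(2) G_def gc_def del: One_nat_def)
qed

lemma g0_in: "g0 \<in> mpolys 2"
  unfolding g0_def
  by (intro subring_add[OF is_subring_mpolys] subring_power[OF is_subring_mpolys] mvar_in_mpolys poly_in_subring[OF is_subring_mpolys])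
    (auto simp: polys_over_def coeff_map_poly const_mpoly_def[of 0] const_mpoly_in_mpolys)

lemma vanishing_ideal_V: "vanishing_ideal 2 V = {p \<in> mpolys 2. G dvd to_poly2 p}"
  unfolding vanishing_ideal_def using vanish_V_iff by blast

lemma ideal_vanishing_ideal: "ideal (vanishing_ideal 2 V) (mpoly_ring 2)"
proof -
  interpret cring "mpoly_ring 2 :: 'm alg_closure mpoly ring" by (rule cring_mpoly_ring)
  interpret t: comm_ring_hom "to_poly2 :: 'm alg_closure mpoly \<Rightarrow> _" by (rule to_poly2_hom)
  note sr = is_subring_mpolys
  have add: "x \<oplus>\<^bsub>mpoly_ring 2\<^esub> y = x + y" for x y :: "'m alg_closure mpoly"
    by (simp add: mpoly_ring_def ring_of_type_algebra_def)
  have inv: "\<ominus>\<^bsub>mpoly_ring 2\<^esub> x = - x" if "x \<in> mpolys 2" for x :: "'m alg_closure mpoly"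
    using that subring_uminus[OF sr that] by (intro minus_equality) (simp_all add: mpoly_ring_simps add)
  show ?thesis
  proof (rule idealI)
    show "ring (mpoly_ring 2 :: 'm alg_closure mpoly ring)" by (rule ring_axioms)
    show "subgroup (vanishing_ideal 2 V) (add_monoid (mpoly_ring 2))"
    proof (rule add.subgroupI)
      show "vanishing_ideal 2 V \<subseteq> carrier (mpoly_ring 2)" by (auto simp: vanishing_ideal_V mpoly_ring_simps)
      show "vanishing_ideal 2 V \<noteq> {}" using subring_zero[OF sr] by (auto simp: vanishing_ideal_V t.hom_zero intro!: exI[of _ 0])
      fix p assume p: "p \<in> vanishing_ideal 2 V"
      then show "\<ominus>\<^bsub>mpoly_ring 2\<^esub> p \<in> vanishing_ideal 2 V"
        using subring_uminus[OF sr] by (auto simp: vanishing_ideal_V inv t.hom_uminus)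
      fix q assume "q \<in> vanishing_ideal 2 V"
      then show "p \<oplus>\<^bsub>mpoly_ring 2\<^esub> q \<in> vanishing_ideal 2 V"
        using p subring_add[OF sr] by (auto simp: vanishing_ideal_V add t.hom_add)
    qed
  next
    fix a x :: "'m alg_closure mpoly" assume "a \<in> vanishing_ideal 2 V" "x \<in> carrier (mpoly_ring 2)"
    then show "x \<otimes>\<^bsub>mpoly_ring 2\<^esub> a \<in> vanishing_ideal 2 V" "a \<otimes>\<^bsub>mpoly_ring 2\<^esub> x \<in> vanishing_ideal 2 V"
      using subring_mult[OF sr] by (auto simp: vanishing_ideal_V mpoly_ring_simps t.hom_mult)
  qed
qed

text \<open>Irreducibility is the primality of G; V is defined over M because the single equation
  g0, with coefficients in M, generates the whole vanishing ideal.\<close>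

lemma abs_irreducible_V: "abs_irreducible_variety 2 V"
  unfolding abs_irreducible_variety_def
proof (intro conjI)
  interpret t: comm_ring_hom "to_poly2 :: 'm alg_closure mpoly \<Rightarrow> _" by (rule to_poly2_hom)
  have lg0: "lift_mpoly g0 \<in> mpolys 2" using g0_in by (simp add: lift_mpoly_in_mpolys)
  have "mpoly_eval (lift_mpoly g0) a = a 1 ^ m + poly gc (a 0)" for a
    unfolding mpoly_eval_eq eval_to_poly2[OF lg0, symmetric] to_poly2_g0 by (rule eval_G)
  then have "V = zero_locus 2 {lift_mpoly g0}" by (auto simp: V_def zero_locus_def)
  then show "zariski_closed 2 V" unfolding zariski_closed_def using lg0 by blast
  show "zariski_irreducible 2 V"
  proof (rule zariski_irreducibleI[OF _ _ V_affine])
    show "V \<noteq> {}" using V_fibre by blast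
    fix p q :: "'m alg_closure mpoly"
    assume p: "p \<in> mpolys 2" and q: "q \<in> mpolys 2" and pq: "\<And>x. x \<in> V \<Longrightarrow> mpoly_eval p x * mpoly_eval q x = 0"
    have "\<forall>x\<in>V. mpoly_eval (p * q) x = 0"
      using pq by (simp add: mpoly_eval_eq comm_ring_hom.mev_mult[OF id_hom])
    then have "G dvd to_poly2 (p * q)" using vanish_V_iff subring_mult[OF is_subring_mpolys p q] by blast
    then have "G dvd to_poly2 p * to_poly2 q" by (simp add: t.hom_mult)
    then have "G dvd to_poly2 p \<or> G dvd to_poly2 q" using prime_G by (simp add: prime_elem_dvd_mult_iff)
    then show "(\<forall>x\<in>V. mpoly_eval p x = 0) \<or> (\<forall>x\<in>V. mpoly_eval q x = 0)"
      using vanish_V_iff[OF p] vanish_V_iff[OF q] by blast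
  qed
  interpret R: cring "mpoly_ring 2 :: 'm alg_closure mpoly ring" by (rule cring_mpoly_ring)
  let ?L = "lift_mpoly ` base_ideal 2 V"
  have sub: "?L \<subseteq> vanishing_ideal 2 V" by (auto simp: base_ideal_def)
  have subc: "?L \<subseteq> carrier (mpoly_ring 2)" using sub by (auto simp: vanishing_ideal_def mpoly_ring_simps)
  have g0L: "lift_mpoly g0 \<in> ?L"
    using g0_in lg0 by (auto simp: base_ideal_def vanishing_ideal_V to_poly2_g0)
  show "defined_over_base 2 V"
    unfolding defined_over_base_def
  proof
    show "Idl\<^bsub>mpoly_ring 2\<^esub> ?L \<subseteq> vanishing_ideal 2 V"
      by (rule R.genideal_minimal[OF ideal_vanishing_ideal sub])
    show "vanishing_ideal 2 V \<subseteq> Idl\<^bsub>mpoly_ring 2\<^esub> ?L"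
    proof
      fix p assume "p \<in> vanishing_ideal 2 V"
      then obtain K where p: "p \<in> mpolys 2" and K: "to_poly2 p = G * K"
        unfolding vanishing_ideal_V by (blast elim: dvdE)
      have "p = lift_mpoly g0 * of_poly2 K"
        by (rule to_poly2_inj[OF p subring_mult[OF is_subring_mpolys lg0 of_poly2_in]])
          (simp add: K t.hom_mult to_poly2_g0 to_poly2_of_poly2)
      moreover have "lift_mpoly g0 \<in> Idl\<^bsub>mpoly_ring 2\<^esub> ?L" using R.genideal_self[OF subc] g0L by blast
      then have "lift_mpoly g0 \<otimes>\<^bsub>mpoly_ring 2\<^esub> of_poly2 K \<in> Idl\<^bsub>mpoly_ring 2\<^esub> ?L"
        by (intro ideal.I_r_closed[OF R.genideal_ideal[OF subc]]) (simp_all add: mpoly_ring_simps of_poly2_in)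
      ultimately show "p \<in> Idl\<^bsub>mpoly_ring 2\<^esub> ?L" by (simp add: mpoly_ring_simps)
    qed
  qed
qed

end

section \<open>The generic point of the curve\<close>

type_synonym 'm curve_field = "'m alg_closure poly fract alg_closure"

context power_curve begin

text \<open>The generic point lives in an algebraic closure of the rational functions in x, with y
  any solution of Y^m + gc = 0. Irreducibility of G makes the polynomial relations the same for
  every choice.\<close>

definition J :: "'m alg_closure poly \<Rightarrow> 'm curve_field" where "J c = to_ac (Fract c 1)"

lemma J_hom: "comm_ring_hom J"
  unfolding J_def[abs_def] by (rule comm_ring_hom_compose[OF to_ac_hom Fract_one_hom])

lemma J_eq_0_iff: "J c = 0 \<longleftrightarrow> c = 0"
  by (simp add: J_def Fract_one_eq_0_iff)

lemma generic_root: "\<exists>y. y ^ m + J gc = 0"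
proof -
  have "Polynomial.coeff (Polynomial.monom 1 m + [:J gc:]) m = 1"
    using m by (auto simp: coeff_pCons split: nat.split)
  then have "m \<le> Polynomial.degree (Polynomial.monom 1 m + [:J gc:])" by (intro le_degree) simp
  then have "Polynomial.degree (Polynomial.monom 1 m + [:J gc:]) > 0" using m by simp
  then obtain y where "poly (Polynomial.monom 1 m + [:J gc:]) y = 0" using alg_closed_imp_poly_has_root by blast
  then show ?thesis by (auto simp: poly_monom)
qed

definition Y :: "'m curve_field" where "Y = (SOME y. y ^ m + J gc = 0)"

lemma Y: "Y ^ m + J gc = 0"
  unfolding Y_def by (rule someI_ex[OF generic_root])

lemma Y_nonzero: "Y \<noteq> 0"
  using Y gc_nonzero m by (auto simp: power_0_left J_eq_0_iff)

definition Ev :: "'m alg_closure poly poly \<Rightarrow> 'm curve_field" where "Ev P = poly (map_poly J P) Y"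

lemma Ev_hom: "comm_ring_hom Ev"
proof -
  interpret j: comm_ring_hom J by (rule J_hom)
  interpret jp: map_poly_comm_ring_hom J ..
  show ?thesis by standard (simp_all add: Ev_def jp.hom_add jp.hom_mult)
qed

lemma Ev_const: "Ev [:c:] = J c"
proof -
  interpret j: comm_ring_hom J by (rule J_hom)
  show ?thesis by (simp add: Ev_def map_poly_pCons0)
qed

lemma Ev_X: "Ev [:0, 1:] = Y"
proof -
  interpret j: comm_ring_hom J by (rule J_hom)
  show ?thesis by (simp add: Ev_def map_poly_pCons0)
qed

lemma Ev_G: "Ev G = 0"
proof -
  interpret e: comm_ring_hom Ev by (rule Ev_hom)
  have "Ev G = Y ^ m + J gc"
    by (simp add: G_def e.hom_add Ev_const Polynomial.monom_altdef e.hom_power Ev_X)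
  then show ?thesis using Y by simp
qed

text \<open>\<open>G\<close> is the minimal polynomial of \<open>Y\<close>: it divides a multiple of any relation of least degree.\<close>

lemma relation_degree:
  assumes "P \<noteq> 0" "Ev P = 0"
  shows "Polynomial.degree P \<ge> m"
proof -
  interpret e: comm_ring_hom Ev by (rule Ev_hom)
  define h where "h = arg_min Polynomial.degree (\<lambda>h. h \<noteq> 0 \<and> Ev h = 0)"
  have h: "h \<noteq> 0 \<and> Ev h = 0" and least: "\<And>h'. h' \<noteq> 0 \<and> Ev h' = 0 \<Longrightarrow> Polynomial.degree h \<le> Polynomial.degree h'"
    unfolding h_def using arg_min_nat_lemma[of "\<lambda>h. h \<noteq> 0 \<and> Ev h = 0" P Polynomial.degree] assms by blast+
  have deg0: "Polynomial.degree h \<noteq> 0"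
  proof
    assume "Polynomial.degree h = 0"
    then obtain c where "h = [:c:]" by (rule degree_eq_zeroE)
    then show False using h by (simp add: Ev_const J_eq_0_iff)
  qed
  obtain q r where qr: "pseudo_divmod G h = (q, r)" by force
  define l where "l = Polynomial.lead_coeff h ^ (Suc (Polynomial.degree G) - Polynomial.degree h)"
  have l0: "l \<noteq> 0" using h by (simp add: l_def)
  have G_eq: "[:l:] * G = h * q + r" and r: "r = 0 \<or> Polynomial.degree r < Polynomial.degree h"
    using pseudo_divmod[OF conjunct1[OF h] qr] by (simp_all add: l_def)
  have "Ev ([:l:] * G) = Ev (h * q) + Ev r" by (simp only: G_eq e.hom_add)
  moreover have "Ev ([:l:] * G) = 0" by (simp only: e.hom_mult Ev_G mult_zero_right)
  moreover have "Ev (h * q) = 0" using h by (simp only: e.hom_mult mult_zero_left)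
  ultimately have "Ev r = 0" by simp
  then have "r = 0" using r least[of r] by (metis not_le)
  then have hq: "[:l:] * G = h * q" using G_eq by simp
  then have "G dvd h * q" by (metis dvd_triv_right)
  then have "G dvd h \<or> G dvd q" using prime_G by (simp add: prime_elem_dvd_mult_iff)
  \<comment> \<open>If G divided q, cancelling G would make h a divisor of the nonzero constant l,
    although h has positive degree.\<close>
  then have "G dvd h"
  proof
    assume "G dvd q"
    then obtain w where "q = G * w" by (rule dvdE)
    then have "G * [:l:] = G * (h * w)" using hq by (simp only: mult_ac)
    then have lw: "[:l:] = h * w" using G_nonzero by (metis mult_cancel_left)
    then have "h \<noteq> 0" "w \<noteq> 0" using l0 by auto
    then have "Polynomial.degree [:l:] = Polynomial.degree h + Polynomial.degree w"
      unfolding lw by (rule degree_mult_eq)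
    then show ?thesis using deg0 by simp
  qed
  then have "m \<le> Polynomial.degree h" using h dvd_imp_degree_le[of G h] by (simp add: degree_G)
  also have "\<dots> \<le> Polynomial.degree P" using least assms by blast
  finally show ?thesis .
qed

lemma Ev_eq_0_iff: "Ev P = 0 \<longleftrightarrow> G dvd P"
proof
  interpret e: comm_ring_hom Ev by (rule Ev_hom)
  obtain s r where P: "P = G * s + r" "r = 0 \<or> Polynomial.degree r < m"
    using monic_division[OF lead_G, of P] degree_G by auto
  have Er: "Ev P = Ev r" by (simp add: P(1) e.hom_add e.hom_mult Ev_G)
  show "G dvd P" if "Ev P = 0"
  proof -
    have "r = 0" using P(2) relation_degree[of r] that Er by (metis not_le)
    then show ?thesis using P(1) by simp
  qed
  show "Ev P = 0" if "G dvd P"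
    using that by (auto elim!: dvdE simp: e.hom_mult Ev_G)
qed

definition \<kappa> :: "'m \<Rightarrow> 'm curve_field" where "\<kappa> c = J [:to_ac c:]"

definition \<xi> :: "nat \<Rightarrow> 'm curve_field" where "\<xi> i = (if i = 0 then J [:0, 1:] else Y)"

lemma mev_curve: "mev \<kappa> \<xi> p = Ev (to_poly2 (lift_mpoly p))"
proof -
  have "Ev (to_poly2 (lift_mpoly p)) = mev (\<lambda>c. Ev [:[:to_ac c:]:]) (\<lambda>i. Ev (if i = 0 then [:[:0, 1:]:] else [:0, 1:])) p"
    unfolding to_poly2_def mev_lift
    by (rule comm_ring_hom.mev_cong_hom[OF comm_ring_hom_compose[OF const_poly2_hom to_ac_hom] Ev_hom])
  also have "(\<lambda>c. Ev [:[:to_ac c:]:]) = \<kappa>" by (simp add: \<kappa>_def Ev_const fun_eq_iff)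
  also have "(\<lambda>i. Ev (if i = 0 then [:[:0, 1:]:] else [:0, 1:])) = \<xi>"
    by (simp add: \<xi>_def Ev_const Ev_X fun_eq_iff)
  finally show ?thesis by simp
qed

lemma const_poly_to_ac_hom: "comm_ring_hom (\<lambda>c :: 'm. [:to_ac c:])"
  by standard (auto simp: one_pCons)

lemma \<kappa>_hom: "comm_ring_hom \<kappa>"
  unfolding \<kappa>_def[abs_def] by (rule comm_ring_hom_compose[OF J_hom const_poly_to_ac_hom])

lemma function_field_model_curve: "function_field_model \<kappa> 2 V \<xi>"
proof (intro function_field_model.intro \<kappa>_hom function_field_model_axioms.intro)
  fix p :: "'m mpoly" assume p: "p \<in> mpolys 2"
  then have "lift_mpoly p \<in> mpolys 2" by (simp add: lift_mpoly_in_mpolys)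
  then show "p \<in> base_ideal 2 V \<longleftrightarrow> mev \<kappa> \<xi> p = 0"
    using p by (simp add: base_ideal_def vanishing_ideal_V mev_curve Ev_eq_0_iff)
qed

text \<open>PAC is applied to the projection to the x-coordinate. It is onto over the algebraic
  closure, and Y is a simple root of its equation because m Y^(m - 1) is nonzero.\<close>

theorem PAC_over_rational_point:
  assumes PAC: "PAC_over (R :: 'm set)"
  shows "\<exists>x y. y ^ m + poly g x = 0"
proof -
  interpret function_field_model \<kappa> 2 V \<xi> by (rule function_field_model_curve)
  interpret j: comm_ring_hom J by (rule J_hom)
  have "\<exists>a\<in>V. (\<forall>i<2. a i \<in> range to_ac) \<and>
    (\<forall>i<1::nat. \<exists>y\<in>R. mev to_ac a (mvar 0) = to_ac y * mev to_ac a 1)"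
  proof (rule PAC_overD[OF PAC abs_irreducible_V, where g = 1])
    show "(mvar 0 :: 'm mpoly) \<in> mpolys 2" by (rule mvar_in_mpolys) simp
    show "(1 :: 'm mpoly) \<in> denoms" by (rule one_in_denoms)
    show "(1 :: 'm alg_closure mpoly) \<in> mpolys 1" by (rule subring_one[OF is_subring_mpolys])
    show "(1 :: 'm alg_closure mpoly) \<noteq> 0" by simp
  next
    fix y :: "nat \<Rightarrow> 'm alg_closure"
    obtain a where a: "a \<in> V" "a 0 = y 0" using V_fibre by blast
    interpret e: comm_ring_hom "mev to_ac a :: 'm mpoly \<Rightarrow> _" by (rule comm_ring_hom.comm_ring_hom_mev[OF to_ac_hom])
    show "\<exists>a\<in>V. \<forall>i<1. mev to_ac a (1 :: 'm mpoly) \<noteq> 0 \<and> mev to_ac a (mvar 0) = y i * mev to_ac a 1"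
      using a by (intro bexI[of _ a]) (simp_all add: comm_ring_hom.mev_var[OF to_ac_hom] e.hom_one)
  next
    fix E :: "'m curve_field set" and i :: nat
    assume E: "is_subfield E" "range \<kappa> \<subseteq> E" "\<And>i. i < (1::nat) \<Longrightarrow> ev (mvar 0) / ev 1 \<in> E" and i: "i < 2"
    note sr = is_subfield_imp_subring[OF E(1)]
    have xE: "J [:0, 1:] \<in> E" using E(3)[of 0] by (simp add: kap.mev_var ev.hom_one \<xi>_def)
    have "J (map_poly to_ac p) \<in> E" for p :: "'m poly"
    proof (induction p)
      case 0
      show ?case using subring_zero[OF sr] by simp
    next
      case (pCons c p)
      have "J (map_poly to_ac (pCons c p)) = J ([:to_ac c:] + [:0, 1:] * map_poly to_ac p)"
        by (simp add: map_poly_pCons0)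
      also have "\<dots> = \<kappa> c + J [:0, 1:] * J (map_poly to_ac p)"
        by (simp only: j.hom_add j.hom_mult \<kappa>_def)
      also have "\<dots> \<in> E" using E(2) xE pCons.IH by (intro subring_add[OF sr] subring_mult[OF sr]) auto
      finally show ?case .
    qed
    then have gE: "J gc \<in> E" by (simp add: gc_def)
    have "Y \<in> sepgen E"
    proof (rule sepgen_root)
      let ?p = "Polynomial.monom 1 m + [:J gc:]"
      show "Polynomial.coeff ?p k \<in> sepgen E" for k
        using gE subring_zero[OF sr] subring_one[OF sr] m
        by (intro sepgen_base) (auto simp: coeff_pCons split: nat.split)
      show "poly ?p Y = 0" using Y by (simp add: poly_monom)
      have "of_nat m \<noteq> (0 :: 'm curve_field)"
      proof -
        have "\<kappa> (of_nat m) = of_nat m" by (rule kap.hom_of_nat)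
        moreover have "\<kappa> (of_nat m) \<noteq> 0" using m(2) by (simp add: \<kappa>_def J_eq_0_iff del: to_ac_of_nat)
        ultimately show ?thesis by simp
      qed
      then show "poly (pderiv ?p) Y \<noteq> 0"
        using Y_nonzero by (simp add: pderiv_add pderiv_monom poly_monom pderiv_pCons)
    qed
    then show "\<xi> i \<in> sepgen E" using xE by (auto simp: \<xi>_def intro: sepgen_base)
  qed
  then obtain a where a: "a \<in> V" "a 0 \<in> range to_ac" "a 1 \<in> range to_ac" by force
  obtain x y where xy: "a 0 = to_ac x" "a 1 = to_ac y" using a by blast
  have "poly (map_poly to_ac p) (to_ac x) = to_ac (poly p x)" for p :: "'m poly"
    by (induction p) (simp_all add: map_poly_pCons0)
  then have "to_ac (y ^ m + poly g x) = 0" using a(1) by (simp add: V_def gc_def xy del: One_nat_def)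
  then show ?thesis by (auto simp del: to_ac_add to_ac_power)
qed

end

theorem theoremB:
  fixes K :: "'m::field set"
  assumes "finitely_generated_field (ring_of_type_algebra :: 'm ring) K"
    and "galois_extension (ring_of_type_algebra :: 'm ring) K"
    and "\<not> separably_closed TYPE('m)"
  shows "\<not> PAC_over K"
proof (cases "K = UNIV")
  case False
  then show ?thesis using not_PAC_over_proper_galois[OF assms(2,3)] by blast
next
  case True
  then consider "finite (UNIV :: 'm set)" |
    (infinite) \<pi> N where "\<pi> \<noteq> (0 :: 'm)" "\<forall>m>N. \<forall>x y. x ^ m + \<pi> * y ^ m + \<pi>\<^sup>2 \<noteq> 0"
    using finitely_generated_field_cases[where 'a = 'm] assms(1) by blast
  then show ?thesis
  proof cases
    case 1
    then show ?thesis by (rule not_PAC_over_finite)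
  next
    case infinite
    \<comment> \<open>N + 1 and N + 2 differ by 1, so at least one of them is nonzero in M.\<close>
    obtain m where mN: "m > N" "m > 0" "of_nat m \<noteq> (0 :: 'm)"
    proof (cases "of_nat (Suc N) = (0 :: 'm)")
      case True
      then have "of_nat (Suc (Suc N)) \<noteq> (0 :: 'm)" by (simp add: add.assoc)
      then show ?thesis using that[of "Suc (Suc N)"] by simp
    qed (use that[of "Suc N"] in simp)
    define g where "g = Polynomial.smult (inverse \<pi>) (Polynomial.monom 1 m + [:\<pi>\<^sup>2:])"
    have lift_g: "map_poly to_ac g = Polynomial.smult (inverse (to_ac \<pi>)) (Polynomial.monom 1 m + [:(to_ac \<pi>)\<^sup>2:])"
      by (rule poly_eqI) (simp add: g_def coeff_map_poly coeff_pCons split: nat.split)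
    have ac: "of_nat m \<noteq> (0 :: 'm alg_closure)" "to_ac \<pi> \<noteq> 0"
      using mN(3) infinite(1) by (metis to_ac_of_nat to_ac_eq_0_iff)+
    \<comment> \<open>A zero of g over the algebraic closure; it is nonzero, and therefore simple,
      as m is nonzero in M.\<close>
    obtain x0 where x0: "x0 ^ m = - ((to_ac \<pi>)\<^sup>2)"
      using nth_root_exists[of m "- ((to_ac \<pi>)\<^sup>2)"] mN(2) by auto
    have "x0 \<noteq> 0" using x0 ac(2) mN(2) by (auto simp: power_0_left)
    then interpret power_curve g m x0
      using mN(2,3) ac x0
      by unfold_locales
        (simp_all add: lift_g poly_monom pderiv_smult pderiv_add pderiv_monom pderiv_pCons)
    show ?thesis
    proof
      assume "PAC_over K"
      then obtain x y where "y ^ m + poly g x = 0" using PAC_over_rational_point by blast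
      then have root: "y ^ m + inverse \<pi> * (x ^ m + \<pi>\<^sup>2) = 0" by (simp add: g_def poly_monom)
      have scale: "b + \<pi> * a = 0" if "a + inverse \<pi> * b = 0" for a b
      proof -
        have "\<pi> * (inverse \<pi> * b) = b" using infinite(1) by simp
        moreover have "\<pi> * (a + inverse \<pi> * b) = 0" unfolding that by (rule mult_zero_right)
        ultimately show ?thesis by (simp only: distrib_left add.commute)
      qed
      have "x ^ m + \<pi> * y ^ m + \<pi>\<^sup>2 = 0" using scale[OF root] by (simp only: ac_simps)
      then show False using infinite(2) mN(1) by blast
    qed
  qed
qed

end
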